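(* Let $\Delta$ be a closed homology manifold (connected, pure, $(d-1)$-dimensional, $d\ge4$). If $\pi_1(\Delta)$ has a subgroup of index $t$, then $$\frac{t-1}{t}\binom{d+1}{2}\le h_2-h_1\le\binom{h_1}{2}.$$ In particular, if $|\pi_1(\Delta)|$ is finite and greater than $\binom{d+1}{2}$, or if $\beta_1>0$, then $\binom{d+1}{2}\le h_2-h_1\le\binom{h_1}{2}$.
   Context: Fix a field $k$. For a face $\rho$, $\operatorname{lk}\rho=\{\tau\in\Delta:\tau\cap\rho=\emptyset,\tau\cup\rho\in\Delta\}$. $\Delta$ is a $k$-homology manifold if for every nonempty face $\rho$, $H_*(\operatorname{lk}\rho;k)$ is isomorphic to the $k$-homology of $S^{d-|\rho|-1}$ or of the ball $B^{d-|\rho|-1}$; its boundary consists of the faces $\rho$ with $H_{d-|\rho|-1}(\operatorname{lk}\rho;k)=0$. It is closed if its boundary is empty and $H_{d-1}(\Delta;k)\cong k$. $\beta_i$ are the Betti numbers over $k$. With $f_{j}$ the number of $j$-dimensional faces and $f_{-1}=1$, the $h$-vector is $h_i=\sum_{j=0}^i(-1)^{i-j}\binom{d-j}{d-i}f_{j-1}$. *)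

theory Defs
  imports
    "HOL-Analysis.Analysis"
    "HOL-Algebra.Coset"
    "HOL-Library.Function_Algebras"
    "HOL-Library.Set_Algebras"
begin

section \<open>Finite abstract simplicial complexes\<close>

text \<open>
  The empty set is a face, of dimension $-1$. (The library's \<open>simplicial_complex\<close> is the geometric
  notion, a set of simplices in a Euclidean space.)
\<close>

definition abstract_complex :: "'a set set \<Rightarrow> bool" where
  "abstract_complex \<Delta> \<longleftrightarrow>
     finite \<Delta> \<and> {} \<in> \<Delta> \<and> (\<forall>\<sigma>\<in>\<Delta>. finite \<sigma>) \<and> (\<forall>\<sigma>\<in>\<Delta>. \<forall>\<tau>. \<tau> \<subseteq> \<sigma> \<longrightarrow> \<tau> \<in> \<Delta>)"

definition face_dim :: "'a set \<Rightarrow> int" where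
  "face_dim \<sigma> = int (card \<sigma>) - 1"

definition facets :: "'a set set \<Rightarrow> 'a set set" where
  "facets \<Delta> = {\<sigma>\<in>\<Delta>. \<forall>\<tau>\<in>\<Delta>. \<sigma> \<subseteq> \<tau> \<longrightarrow> \<tau> = \<sigma>}"

definition pure_of_dim :: "int \<Rightarrow> 'a set set \<Rightarrow> bool" where
  "pure_of_dim m \<Delta> \<longleftrightarrow> (\<forall>\<sigma>\<in>facets \<Delta>. face_dim \<sigma> = m)"

definition link :: "'a set set \<Rightarrow> 'a set \<Rightarrow> 'a set set" where
  "link \<Delta> \<rho> = {\<tau>\<in>\<Delta>. \<tau> \<inter> \<rho> = {} \<and> \<tau> \<union> \<rho> \<in> \<Delta>}"

definition f_vector :: "'a set set \<Rightarrow> int \<Rightarrow> nat" where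
  "f_vector \<Delta> j = card {\<sigma>\<in>\<Delta>. face_dim \<sigma> = j}"

text \<open>Here \<open>d\<close> is one more than the dimension of the complex, and \<open>i \<le> d\<close> is intended.\<close>

definition h_vector :: "nat \<Rightarrow> 'a set set \<Rightarrow> nat \<Rightarrow> int" where
  "h_vector d \<Delta> i =
     (\<Sum>j=0..i. (-1) ^ (i - j) * int ((d - j) choose (d - i)) * int (f_vector \<Delta> (int j - 1)))"


section \<open>Reduced simplicial homology over a field\<close>

text \<open>
  A chain assigns a coefficient to each face; the linear order on the vertices serves only to orient
  the faces. Coefficientwise, the usual boundary
  $\partial[v_0,\dots,v_i] = \sum_j (-1)^j [v_0,\dots,\widehat{v_j},\dots,v_i]$ reads as in
  \<open>bdry\<close> below: the position of \<open>v\<close> in \<open>insert v \<tau>\<close> is the number of elements of \<open>\<tau>\<close> below \<open>v\<close>.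
  As the empty face is a generator in degree $-1$, the complex is augmented and the homology is
  reduced.
\<close>

definition chains :: "'a set set \<Rightarrow> int \<Rightarrow> ('a set \<Rightarrow> 'k::field) set" where
  "chains \<Delta> i = {c. \<forall>\<sigma>. c \<sigma> \<noteq> 0 \<longrightarrow> \<sigma> \<in> \<Delta> \<and> face_dim \<sigma> = i}"

definition bdry :: "'a::linorder set set \<Rightarrow> ('a set \<Rightarrow> 'k::field) \<Rightarrow> 'a set \<Rightarrow> 'k" where
  "bdry \<Delta> c = (\<lambda>\<tau>. \<Sum>v\<in>\<Union>\<Delta> - \<tau>. (-1) ^ card {w\<in>\<tau>. w < v} * c (insert v \<tau>))"

definition cycles :: "'a::linorder set set \<Rightarrow> int \<Rightarrow> ('a set \<Rightarrow> 'k::field) set" where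
  "cycles \<Delta> i = {c \<in> chains \<Delta> i. bdry \<Delta> c = 0}"

definition boundaries :: "'a::linorder set set \<Rightarrow> int \<Rightarrow> ('a set \<Rightarrow> 'k::field) set" where
  "boundaries \<Delta> i = bdry \<Delta> ` chains \<Delta> (i + 1)"

text \<open>The quotient space of cycles by boundaries, its elements being cosets.\<close>

definition homology :: "'a::linorder set set \<Rightarrow> int \<Rightarrow> ('a set \<Rightarrow> 'k::field) set set" where
  "homology \<Delta> i = (\<lambda>z. z +o boundaries \<Delta> i) ` cycles \<Delta> i"

definition scale :: "'k::field \<Rightarrow> ('b \<Rightarrow> 'k) \<Rightarrow> 'b \<Rightarrow> 'k" where
  "scale a c = (\<lambda>x. a * c x)"

definition coordinate_space :: "nat \<Rightarrow> (nat \<Rightarrow> 'k::field) set" where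
  "coordinate_space n = {v. \<forall>j\<ge>n. v j = 0}"

text \<open>
  The $i$-th homology over the field \<open>'k\<close> is isomorphic to the vector space $k^n$. Adding the
  boundaries in the scalar multiple \<open>a X\<close> of a coset matters only for \<open>a = 0\<close>.
\<close>

definition homology_iso :: "'k::field itself \<Rightarrow> 'a::linorder set set \<Rightarrow> int \<Rightarrow> nat \<Rightarrow> bool" where
  "homology_iso K \<Delta> i n \<longleftrightarrow>
     (\<exists>\<phi> :: ('a set \<Rightarrow> 'k) set \<Rightarrow> nat \<Rightarrow> 'k.
        bij_betw \<phi> (homology \<Delta> i) (coordinate_space n) \<and>
        (\<forall>X\<in>homology \<Delta> i. \<forall>Y\<in>homology \<Delta> i. \<phi> (X + Y) = \<phi> X + \<phi> Y) \<and>
        (\<forall>a. \<forall>X\<in>homology \<Delta> i. \<phi> (scale a ` X + boundaries \<Delta> i) = scale a (\<phi> X)))"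

text \<open>Reduced Betti numbers; these agree with the unreduced ones in positive degrees.\<close>

definition betti :: "'k::field itself \<Rightarrow> 'a::linorder set set \<Rightarrow> int \<Rightarrow> nat" where
  "betti K \<Delta> i = (THE n. homology_iso K \<Delta> i n)"


section \<open>Homology manifolds\<close>

text \<open>
  The reduced homology of the sphere $S^m$ is $k$ in degree $m$ and zero otherwise, where $S^{-1}$
  is empty (the link of a facet is \<open>{{}}\<close>); that of a ball is zero.
\<close>

definition has_sphere_homology :: "'k::field itself \<Rightarrow> int \<Rightarrow> 'a::linorder set set \<Rightarrow> bool" where
  "has_sphere_homology K m \<Delta> \<longleftrightarrow> (\<forall>i. homology_iso K \<Delta> i (if i = m then 1 else 0))"

definition has_ball_homology :: "'k::field itself \<Rightarrow> 'a::linorder set set \<Rightarrow> bool" where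
  "has_ball_homology K \<Delta> \<longleftrightarrow> (\<forall>i. homology_iso K \<Delta> i 0)"

definition homology_manifold :: "'k::field itself \<Rightarrow> nat \<Rightarrow> 'a::linorder set set \<Rightarrow> bool" where
  "homology_manifold K d \<Delta> \<longleftrightarrow>
     abstract_complex \<Delta> \<and>
     (\<forall>\<rho>\<in>\<Delta>. \<rho> \<noteq> {} \<longrightarrow>
        has_sphere_homology K (int d - int (card \<rho>) - 1) (link \<Delta> \<rho>) \<or>
        has_ball_homology K (link \<Delta> \<rho>))"

definition manifold_boundary :: "'k::field itself \<Rightarrow> nat \<Rightarrow> 'a::linorder set set \<Rightarrow> 'a set set" where
  "manifold_boundary K d \<Delta> =
     {\<rho>\<in>\<Delta>. homology_iso K (link \<Delta> \<rho>) (int d - int (card \<rho>) - 1) 0}"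

definition closed_homology_manifold :: "'k::field itself \<Rightarrow> nat \<Rightarrow> 'a::linorder set set \<Rightarrow> bool" where
  "closed_homology_manifold K d \<Delta> \<longleftrightarrow>
     homology_manifold K d \<Delta> \<and> manifold_boundary K d \<Delta> = {} \<and> homology_iso K \<Delta> (int d - 1) 1"


section \<open>Geometric realization and fundamental group\<close>

text \<open>
  Points are given by barycentric coordinates. The topology is that of pointwise convergence, which
  for a finite complex is the usual one.
\<close>

definition realization :: "'a set set \<Rightarrow> ('a \<Rightarrow> real) set" where
  "realization \<Delta> =
     {x. (\<forall>v. 0 \<le> x v) \<and> {v. x v \<noteq> 0} \<in> \<Delta> \<and> (\<Sum>v\<in>{v. x v \<noteq> 0}. x v) = 1}"

definition loops_at :: "'b::topological_space set \<Rightarrow> 'b \<Rightarrow> (real \<Rightarrow> 'b) set" where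
  "loops_at S x = {p. path p \<and> path_image p \<subseteq> S \<and> pathstart p = x \<and> pathfinish p = x}"

definition homotopy_class :: "'b::topological_space set \<Rightarrow> (real \<Rightarrow> 'b) \<Rightarrow> (real \<Rightarrow> 'b) set" where
  "homotopy_class S p = {q. homotopic_paths S p q}"

definition fundamental_group ::
    "'b::topological_space set \<Rightarrow> 'b \<Rightarrow> (real \<Rightarrow> 'b) set monoid" where
  "fundamental_group S x =
     \<lparr>carrier = homotopy_class S ` loops_at S x,
      monoid.mult = (\<lambda>A B. \<Union>p\<in>A. \<Union>q\<in>B. homotopy_class S (p +++ q)),
      one = homotopy_class S (\<lambda>_. x)\<rparr>"

text \<open>Only finite indices: \<open>card\<close> is zero for an infinite set of cosets, hence \<open>0 < t\<close>.\<close>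

definition has_subgroup_of_index :: "('g, 'm) monoid_scheme \<Rightarrow> nat \<Rightarrow> bool" where
  "has_subgroup_of_index G t \<longleftrightarrow> 0 < t \<and> (\<exists>H. subgroup H G \<and> card (rcosets\<^bsub>G\<^esub> H) = t)"

end

theory Submission
  imports Defs "HOL-Computational_Algebra.Polynomial" "HOL-Number_Theory.Cong"
begin

text \<open>
  Put \<open>g_2 = h_2 - h_1 = f_1 - d f_0 + (d + 1 choose 2)\<close>. The upper bound is \<open>f_1 \<le> (f_0 choose 2)\<close>.
  For the lower bound place the vertices at points \<open>(1, t, ..., t ^ d)\<close> of the moment curve. An
  infinitesimal motion then assigns to each vertex \<open>v\<close> a polynomial \<open>q_v\<close> of degree at most \<open>d\<close> with
  \<open>q_u(t_v) + q_v(t_u) = 0\<close> for all \<open>u\<close>, \<open>v\<close> that are equal or adjacent; the trivial motions are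
  \<open>q_v(s) = b(t_v, s)\<close> with \<open>b\<close> skew-symmetric, a space of dimension \<open>d + 1 choose 2\<close>. The link of a
  vertex is a strongly connected pseudomanifold, so by Fogelsanger's theorem it is rigid in dimension
  \<open>d - 1\<close> for generic \<open>t\<close>; hence the stars are rigid in dimension \<open>d\<close>, and they are glued along facets.

  The gluing also works on a connected cover with the placement pulled back from the base: there, too,
  all motions are trivial and in particular constant on the fibres. Without a cover this gives
  \<open>f_1 \<ge> d f_0 - (d + 1 choose 2)\<close>. If a finite connected cover has at least two sheets, no nonzero
  motion sums to zero over all fibres, and counting unknowns and equations gives \<open>f_1 \<ge> d f_0\<close>, that is
  \<open>g_2 \<ge> (d + 1 choose 2)\<close>. Such a cover exists if the fundamental group has a proper subgroup of
  finite index, and also if \<open>\<beta>_1 > 0\<close>: a cocycle over \<open>k\<close> that is not a coboundary yields one over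
  \<open>\<int> / p\<close> for some prime \<open>p\<close>.
\<close>

section \<open>Infinitesimal motions on the moment curve\<close>

text \<open>Why the moment curve: any d + 1 of its points are independent, so general position of a
  placement is just injectivity of the parameters, a covector is a polynomial whose roots can be
  counted, and coning is division by a linear factor. The condition q_u(t_v) + q_v(t_u) = 0 is the
  projective form of infinitesimal rigidity. Applying g_2 >= 0 to an n-sheeted cover would give the
  factor (n - 1) / n of the statement. The placement pulled back from the base is not even injective
  on the cover, so rigidity of the cover cannot come from genericity there; but the argument uses
  only stars, which map isomorphically to stars of the base. In return motions can be compared along
  a fibre, and with (n - 1) d f_0 unknowns against (n - 1) f_1 equations the factor disappears:
  every n >= 2 gives the full (d + 1 choose 2). The links have dimension at least two because d >=
  4. This matters: a one-dimensional circuit is a polygon, and a quadrilateral is flexible in the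
  plane.\<close>

text \<open>Fraction-free Gaussian elimination, by induction on the columns, in place of a rank or
  determinant argument: a pivot that is nonzero at \<open>s1\<close> is a nonzero polynomial, so it
  vanishes at finitely many \<open>s\<close> only, and away from these a kernel vector is determined
  by its restriction to \<open>I\<close>.\<close>

lemma generic_injective:
  fixes M :: "'j \<Rightarrow> 'i \<Rightarrow> 'k::field poly"
  assumes "finite I"
    and "\<And>x. (\<forall>j\<in>J. (\<Sum>i\<in>I. poly (M j i) s1 * x i) = 0) \<Longrightarrow> \<forall>i\<in>I. x i = 0"
  shows "finite {s. \<exists>x. (\<forall>j\<in>J. (\<Sum>i\<in>I. poly (M j i) s * x i) = 0) \<and> (\<exists>i\<in>I. x i \<noteq> 0)}"
  using assms
proof (induction I arbitrary: M rule: finite_induct)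
  case empty
  then show ?case by simp
next
  case (insert i0 I)
  \<comment> \<open>If column \<open>i0\<close> vanished at \<open>s1\<close>, the unit vector of
    \<open>i0\<close> would lie in the kernel.\<close>
  obtain j0 where j0: "j0 \<in> J" "poly (M j0 i0) s1 \<noteq> 0"
  proof (rule ccontr)
    assume "\<not> thesis"
    with that have "\<forall>j\<in>J. poly (M j i0) s1 = 0" by blast
    then have "\<forall>j\<in>J. (\<Sum>i\<in>insert i0 I. poly (M j i) s1 * (if i = i0 then 1 else 0)) = 0"
      using insert.hyps by (auto intro!: sum.neutral)
    from insert.prems[OF this] show False by auto
  qed
  define M' where "M' j i = M j0 i0 * M j i - M j i0 * M j0 i" for j i
  have elim: "(\<Sum>i\<in>I. poly (M' j i) s * x i) =
      poly (M j0 i0) s * (\<Sum>i\<in>I. poly (M j i) s * x i) - poly (M j i0) s * (\<Sum>i\<in>I. poly (M j0 i) s * x i)"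
    for j s and x :: "'i \<Rightarrow> 'k"
    unfolding M'_def sum_distrib_left sum_subtractf[symmetric] by (intro sum.cong) (auto simp: algebra_simps)
  have "finite {s. \<exists>x. (\<forall>j\<in>J. (\<Sum>i\<in>I. poly (M' j i) s * x i) = 0) \<and> (\<exists>i\<in>I. x i \<noteq> 0)}"
  proof (rule insert.IH)
    fix x assume x: "\<forall>j\<in>J. (\<Sum>i\<in>I. poly (M' j i) s1 * x i) = 0"
    \<comment> \<open>\<open>x\<close> is extended to \<open>i0\<close> so that row
      \<open>j0\<close> holds at \<open>s1\<close>; the other rows then follow from those of
      \<open>M'\<close>.\<close>
    define y where "y = x(i0 := - (\<Sum>i\<in>I. poly (M j0 i) s1 * x i) / poly (M j0 i0) s1)"
    have yI: "(\<Sum>i\<in>I. poly (M j i) s1 * y i) = (\<Sum>i\<in>I. poly (M j i) s1 * x i)" for j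
      using insert.hyps by (intro sum.cong) (auto simp: y_def)
    have "(\<Sum>i\<in>insert i0 I. poly (M j i) s1 * y i) = 0" if "j \<in> J" for j
    proof -
      have "poly (M j0 i0) s1 * (\<Sum>i\<in>insert i0 I. poly (M j i) s1 * y i) = (\<Sum>i\<in>I. poly (M' j i) s1 * x i)"
        using insert.hyps j0 unfolding elim by (simp add: yI) (simp add: y_def field_simps)
      then show ?thesis using x that j0 by simp
    qed
    with insert.prems[of y] have "\<forall>i\<in>insert i0 I. y i = 0" by blast
    then show "\<forall>i\<in>I. x i = 0" using insert.hyps by (auto simp: y_def split: if_splits)
  qed
  moreover have "finite {s. poly (M j0 i0) s = 0}"
    using j0 by (intro poly_roots_finite) auto
  ultimately have fin: "finite ({s. \<exists>x. (\<forall>j\<in>J. (\<Sum>i\<in>I. poly (M' j i) s * x i) = 0) \<and> (\<exists>i\<in>I. x i \<noteq> 0)}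
      \<union> {s. poly (M j0 i0) s = 0})" by blast
  show ?case
  proof (rule finite_subset[OF _ fin], rule subsetI, rule ccontr)
    fix s
    assume "s \<in> {s. \<exists>x. (\<forall>j\<in>J. (\<Sum>i\<in>insert i0 I. poly (M j i) s * x i) = 0) \<and> (\<exists>i\<in>insert i0 I. x i \<noteq> 0)}"
    then obtain x where x: "\<And>j. j \<in> J \<Longrightarrow> (\<Sum>i\<in>insert i0 I. poly (M j i) s * x i) = 0"
      "\<exists>i\<in>insert i0 I. x i \<noteq> 0" by blast
    assume s: "s \<notin> {s. \<exists>x. (\<forall>j\<in>J. (\<Sum>i\<in>I. poly (M' j i) s * x i) = 0) \<and> (\<exists>i\<in>I. x i \<noteq> 0)}
      \<union> {s. poly (M j0 i0) s = 0}"
    have sI: "(\<Sum>i\<in>I. poly (M j i) s * x i) = - poly (M j i0) s * x i0" if "j \<in> J" for j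
      using x(1)[OF that] insert.hyps by (simp add: add_eq_0_iff)
    have "(\<Sum>i\<in>I. poly (M' j i) s * x i) = 0" if "j \<in> J" for j
      unfolding elim using sI[OF that] sI[OF j0(1)] by simp
    with s have "\<forall>i\<in>I. x i = 0" by blast
    moreover from this have "x i0 = 0" using sI[OF j0(1)] s by simp
    ultimately show False using x(2) by auto
  qed
qed

lemma underdetermined_system:
  fixes M :: "'j \<Rightarrow> 'i \<Rightarrow> 'k::field"
  assumes "finite J" "finite I" "card J < card I"
  shows "\<exists>x. (\<forall>j\<in>J. (\<Sum>i\<in>I. M j i * x i) = 0) \<and> (\<exists>i\<in>I. x i \<noteq> 0)"
  using assms
proof (induction J arbitrary: M I rule: finite_induct)
  case empty
  then obtain i where "i \<in> I" by fastforce
  then show ?case by (auto intro!: exI[of _ "\<lambda>_. 1"])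
next
  case (insert j0 J)
  show ?case
  proof (cases "\<forall>i\<in>I. M j0 i = 0")
    case True
    have "card J < card I" using insert by simp
    from insert.IH[OF insert.prems(1) this, of M] show ?thesis
      using True by auto
  next
    case False
    then obtain i0 where i0: "i0 \<in> I" "M j0 i0 \<noteq> 0" by blast
    define I' where "I' = I - {i0}"
    have I': "I = insert i0 I'" "i0 \<notin> I'" "finite I'" "card J < card I'"
      using i0 insert by (auto simp: I'_def card_Diff_singleton)
    obtain x where x: "\<forall>j\<in>J. (\<Sum>i\<in>I'. (M j i - M j i0 / M j0 i0 * M j0 i) * x i) = 0" "\<exists>i\<in>I'. x i \<noteq> 0"
      using insert.IH[OF I'(3,4), of "\<lambda>j i. M j i - M j i0 / M j0 i0 * M j0 i"] by blast
    define y where "y = x(i0 := - (\<Sum>i\<in>I'. M j0 i * x i) / M j0 i0)"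
    have yI: "(\<Sum>i\<in>I'. M j i * y i) = (\<Sum>i\<in>I'. M j i * x i)" for j
      using I' by (intro sum.cong) (auto simp: y_def)
    have "(\<Sum>i\<in>I. M j i * y i) = 0" if "j \<in> insert j0 J" for j
    proof -
      have "(\<Sum>i\<in>I. M j i * y i) = M j i0 * y i0 + (\<Sum>i\<in>I'. M j i * x i)"
        using I' yI by simp
      also have "\<dots> = (\<Sum>i\<in>I'. (M j i - M j i0 / M j0 i0 * M j0 i) * x i)"
        using i0 by (simp add: y_def left_diff_distrib sum_subtractf sum_distrib_left sum_divide_distrib mult.assoc)
      also have "\<dots> = 0"
        using x(1) that i0 by auto
      finally show ?thesis .
    qed
    moreover have "\<exists>i\<in>I. y i \<noteq> 0" using x(2) I' by (auto simp: y_def)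
    ultimately show ?thesis by blast
  qed
qed

lemma poly_eq_0_if_roots:
  fixes p :: "'k::idom poly"
  assumes "degree p \<le> n" "\<And>x. x \<in> A \<Longrightarrow> poly p x = 0" "n < card A"
  shows "p = 0"
proof (rule ccontr)
  assume "p \<noteq> 0"
  then have "card A \<le> card {x. poly p x = 0}"
    using assms(2) by (intro card_mono poly_roots_finite) auto
  also have "\<dots> \<le> degree p" by (rule card_poly_roots_bound[OF \<open>p \<noteq> 0\<close>])
  finally show False using assms by simp
qed

section \<open>Motions, trivial motions and rigidity\<close>

text \<open>The case \<open>u = v\<close> is included, so membership in \<open>\<Union>C\<close> is
  \<open>joined C u u\<close>, and \<open>motion\<close> contains the self-conditions q_u(t_u) =
  0.\<close>

definition joined :: "'v set set \<Rightarrow> 'v \<Rightarrow> 'v \<Rightarrow> bool" where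
  "joined C u v \<longleftrightarrow> (\<exists>\<sigma>\<in>C. u \<in> \<sigma> \<and> v \<in> \<sigma>)"

text \<open>A skew-symmetric bilinear form on R^(e+1), restricted to the moment curve. Only the
  degree in the second variable is bounded; skew symmetry carries the bound over to the
  first.\<close>

definition skew_family :: "nat \<Rightarrow> (real \<Rightarrow> real poly) \<Rightarrow> bool" where
  "skew_family e b \<longleftrightarrow> (\<forall>s. degree (b s) \<le> e) \<and> (\<forall>r s. poly (b r) s + poly (b s) r = 0)"

text \<open>With q_u read as a covector and P_v = (1, t_v, ..., t_v^e), the equations are q_u(P_v) +
  q_v(P_u) = 0. A velocity w_u at an affine point p_u corresponds to the covector (- p_u . w_u,
  w_u), which turns them into the familiar (p_u - p_v) . (w_u - w_v) = 0.\<close>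

definition motion :: "nat \<Rightarrow> ('v \<Rightarrow> real) \<Rightarrow> 'v set set \<Rightarrow> ('v \<Rightarrow> real poly) \<Rightarrow> bool" where
  "motion e t C q \<longleftrightarrow> (\<forall>u\<in>\<Union>C. degree (q u) \<le> e) \<and>
     (\<forall>u v. joined C u v \<longrightarrow> poly (q u) (t v) + poly (q v) (t u) = 0)"

definition rigid :: "nat \<Rightarrow> ('v \<Rightarrow> real) \<Rightarrow> 'v set set \<Rightarrow> bool" where
  "rigid e t C \<longleftrightarrow>
     (\<forall>q. motion e t C q \<longrightarrow> (\<exists>b. skew_family e b \<and> (\<forall>u\<in>\<Union>C. q u = b (t u))))"

lemma motionI:
  assumes "\<And>u. u \<in> \<Union>C \<Longrightarrow> degree (q u) \<le> e"
    and "\<And>u v. joined C u v \<Longrightarrow> poly (q u) (t v) + poly (q v) (t u) = 0"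
  shows "motion e t C q"
  using assms by (simp add: motion_def)

lemma motion_degree:
  assumes "motion e t C q" "u \<in> \<Union>C"
  shows "degree (q u) \<le> e"
  using assms(1)[unfolded motion_def, THEN conjunct1] assms(2) by (rule bspec)

lemma motion_joined:
  assumes "motion e t C q" "joined C u v"
  shows "poly (q u) (t v) + poly (q v) (t u) = 0"
  using assms(1)[unfolded motion_def, THEN conjunct2] assms(2) by simp

lemma rigidE:
  assumes "rigid e t C" "motion e t C q"
  obtains b where "skew_family e b" "\<And>u. u \<in> \<Union>C \<Longrightarrow> q u = b (t u)"
proof -
  have "\<exists>b. skew_family e b \<and> (\<forall>u\<in>\<Union>C. q u = b (t u))"
    using assms(1)[unfolded rigid_def, rule_format, OF assms(2)] .
  then show thesis using that by blast
qed

lemma joined_sym: "joined C u v \<Longrightarrow> joined C v u"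
  by (auto simp: joined_def)

lemma joined_refl: "u \<in> \<Union>C \<longleftrightarrow> joined C u u"
  by (auto simp: joined_def)

lemma motion_mono:
  assumes "motion e t C q" "\<And>u v. joined C' u v \<Longrightarrow> joined C u v"
  shows "motion e t C' q"
proof -
  have "u \<in> \<Union>C" if "u \<in> \<Union>C'" for u
    using assms(2)[of u u] that by (auto simp: joined_def)
  then show ?thesis
    by (intro motionI motion_degree[OF assms(1)] motion_joined[OF assms(1)] assms(2))
qed

lemma motion_self:
  assumes "motion e t C q" "u \<in> \<Union>C"
  shows "poly (q u) (t u) = 0"
proof -
  have "poly (q u) (t u) + poly (q u) (t u) = 0"
    using assms unfolding joined_refl by (rule motion_joined)
  then show ?thesis by simp
qed

lemma rigid_mono:
  assumes "rigid e t C" "\<And>u v. joined C u v \<Longrightarrow> joined C' u v" "\<Union>C' \<subseteq> \<Union>C"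
  shows "rigid e t C'"
  unfolding rigid_def
proof (intro allI impI)
  fix q assume "motion e t C' q"
  then have "motion e t C q" using assms(2) by (rule motion_mono)
  from assms(1) this obtain b where "skew_family e b" "\<And>u. u \<in> \<Union>C \<Longrightarrow> q u = b (t u)"
    by (rule rigidE) blast
  with assms(3) show "\<exists>b. skew_family e b \<and> (\<forall>u\<in>\<Union> C'. q u = b (t u))"
    by (intro exI[of _ b]) auto
qed

lemma skew_family_add:
  assumes "skew_family e b" "skew_family e c"
  shows "skew_family e (\<lambda>s. b s + c s)"
proof -
  have "poly (b r + c r) s + poly (b s + c s) r = 0" for r s
  proof -
    have "poly (b r) s + poly (b s) r = 0" "poly (c r) s + poly (c s) r = 0"
      using assms unfolding skew_family_def by blast+
    then show ?thesis unfolding poly_add by linarith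
  qed
  then show ?thesis using assms unfolding skew_family_def by (blast intro: degree_add_le)
qed

lemma skew_family_diff:
  assumes "skew_family e b" "skew_family e c"
  shows "skew_family e (\<lambda>s. b s - c s)"
proof -
  have "poly (b r - c r) s + poly (b s - c s) r = 0" for r s
  proof -
    have "poly (b r) s + poly (b s) r = 0" "poly (c r) s + poly (c s) r = 0"
      using assms unfolding skew_family_def by blast+
    then show ?thesis unfolding poly_diff by linarith
  qed
  then show ?thesis using assms unfolding skew_family_def by (blast intro: degree_diff_le)
qed

lemma motion_diff:
  assumes "motion e t C q" "motion e t C q'"
  shows "motion e t C (\<lambda>u. q u - q' u)"
proof (rule motionI)
  show "degree (q u - q' u) \<le> e" if "u \<in> \<Union>C" for u
    using assms that by (intro degree_diff_le motion_degree)
  show "poly (q u - q' u) (t v) + poly (q v - q' v) (t u) = 0" if "joined C u v" for u v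
    using motion_joined[OF assms(1) that] motion_joined[OF assms(2) that] by simp
qed

lemma motion_skew_family:
  assumes "skew_family e b"
  shows "motion e t C (\<lambda>u. b (t u))"
proof -
  have "degree (b s) \<le> e" "poly (b r) s + poly (b s) r = 0" for r s
    using assms unfolding skew_family_def by blast+
  then show ?thesis unfolding motion_def by simp
qed

lemma skew_family_self: "skew_family e b \<Longrightarrow> poly (b s) s = 0"
  unfolding skew_family_def by (metis add_cancel_right_left double_zero)

text \<open>A skew form that vanishes on a hyperplane is zero: for \<open>s\<close> outside
  \<open>A\<close>, skew symmetry makes the points of \<open>A\<close> roots of \<open>b s\<close>,
  and \<open>s\<close> itself is another, so a polynomial of degree at most \<open>e\<close> has
  \<open>e + 1\<close> roots.\<close>

lemma skew_family_eq_0: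
  assumes "skew_family e b" "finite A" "card A = e" "\<And>r. r \<in> A \<Longrightarrow> b r = 0"
  shows "b s = 0"
proof -
  have A0: "poly (b s) r = 0" if "r \<in> A" for r s
    using assms(1,4) that unfolding skew_family_def by (metis add_0 poly_0)
  have out: "b s = 0" if "s \<notin> A" for s
  proof (rule poly_eq_0_if_roots[where A = "insert s A" and n = e])
    show "degree (b s) \<le> e" using assms(1) by (simp add: skew_family_def)
    show "poly (b s) x = 0" if "x \<in> insert s A" for x
      using that A0 skew_family_self[OF assms(1)] by auto
    show "e < card (insert s A)" using that assms by simp
  qed
  then show ?thesis using assms(4) by blast
qed

lemma skew_family_eqI:
  assumes "skew_family e b" "skew_family e c" "finite S" "inj_on t S" "e \<le> card S"
    "\<And>u. u \<in> S \<Longrightarrow> b (t u) = c (t u)"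
  shows "b = c"
proof -
  obtain S' where S': "S' \<subseteq> S" "card S' = e" "finite S'"
    using assms(3,5) by (metis obtain_subset_with_card_n finite_subset)
  have "card (t ` S') = e"
    using S' assms(4) by (metis card_image inj_on_subset)
  then have "b s - c s = 0" for s
    using skew_family_eq_0[OF skew_family_diff[OF assms(1,2)], of "t ` S'"] S' assms(6) by auto
  then show ?thesis by auto
qed

text \<open>Gluing: the trivial motions found on the two parts agree at \<open>e\<close> common
  vertices, hence everywhere by \<open>skew_family_eqI\<close>.\<close>

lemma rigid_Un:
  assumes "rigid e t C" "rigid e t D" "S \<subseteq> \<Union>C" "S \<subseteq> \<Union>D" "finite S" "inj_on t S" "e \<le> card S"
  shows "rigid e t (C \<union> D)"
  unfolding rigid_def
proof (intro allI impI)
  fix q assume q: "motion e t (C \<union> D) q"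
  have "motion e t C q" "motion e t D q"
    by (rule motion_mono[OF q]; auto simp: joined_def)+
  then obtain b c where b: "skew_family e b" "\<And>u. u \<in> \<Union>C \<Longrightarrow> q u = b (t u)"
    and c: "skew_family e c" "\<And>u. u \<in> \<Union>D \<Longrightarrow> q u = c (t u)"
    using rigidE[OF assms(1)] rigidE[OF assms(2)] by metis
  have "b (t u) = c (t u)" if "u \<in> S" for u
  proof -
    have "q u = b (t u)" using b(2) assms(3) that by blast
    moreover have "q u = c (t u)" using c(2) assms(4) that by blast
    ultimately show ?thesis by simp
  qed
  then have "b = c"
    by (rule skew_family_eqI[OF b(1) c(1) assms(5-7)])
  then show "\<exists>b. skew_family e b \<and> (\<forall>u\<in>\<Union> (C \<union> D). q u = b (t u))"
    using b c by (intro exI[of _ b]) auto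
qed

lemma prod_linear_dvd:
  fixes q :: "'k::field poly"
  assumes "finite A" "\<And>r. r \<in> A \<Longrightarrow> poly q r = 0"
  shows "(\<Prod>r\<in>A. [:- r, 1:]) dvd q"
  using assms
proof (induction A arbitrary: q rule: finite_induct)
  case (insert r A)
  have "[:- r, 1:] dvd q" using insert.prems[of r] poly_eq_0_iff_dvd[of q r] by blast
  then obtain q' where q': "q = [:- r, 1:] * q'" by (auto elim: dvdE)
  have "poly q' s = 0" if "s \<in> A" for s
    using insert.prems[of s] insert.hyps that q' by auto
  then have "(\<Prod>r\<in>A. [:- r, 1:]) dvd q'" by (rule insert.IH)
  then show ?case unfolding q' prod.insert[OF insert.hyps] by (rule mult_dvd_mono[OF dvd_refl])
qed simp

text \<open>With \<open>P = \<Prod>r\<in>A. (X - r)\<close> and \<open>q = P r\<close>, the value of \<open>b x\<close> at \<open>s\<close> is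
  \<open>P(x) P(s) (r(s) - r(x)) / P(a)\<close>.\<close>

lemma skew_family_interpolate:
  assumes "finite A" "a \<notin> A" "card A < Suc e" "degree q \<le> e" "\<And>r. r \<in> insert a A \<Longrightarrow> poly q r = 0"
  obtains b where "skew_family e b" "b a = q" "\<And>r. r \<in> A \<Longrightarrow> b r = 0"
proof (cases "card A = e")
  case True
  have "q = 0"
    using assms True by (intro poly_eq_0_if_roots[where A = "insert a A" and n = e]) auto
  then show ?thesis by (intro that[of "\<lambda>_. 0"]) (auto simp: skew_family_def)
next
  case False
  define P where "P = (\<Prod>r\<in>A. [:- r, 1:])"
  have P_deg: "degree P = card A"
    unfolding P_def by (subst degree_prod_sum_eq) auto
  have P0: "poly P x = 0 \<longleftrightarrow> x \<in> A" for x
    unfolding P_def poly_prod using assms(1) by auto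
  have "P dvd q"
    unfolding P_def using assms(1,5) by (intro prod_linear_dvd) auto
  then obtain r where r: "q = P * r" by (auto elim: dvdE)
  have ra: "poly r a = 0" using assms(2,5) r P0 by auto
  define b where "b x = smult (poly P x / poly P a) (P * r) - smult (poly P x * poly r x / poly P a) P" for x
  show ?thesis
  proof (rule that[of b])
    have "degree P \<le> e" using P_deg assms by simp
    then have "degree (b s) \<le> e" for s
      unfolding b_def using r assms(4)
      by (intro degree_diff_le order.trans[OF degree_smult_le]) auto
    moreover have "poly (b r) s + poly (b s) r = 0" for r s
      by (simp add: b_def algebra_simps)
    ultimately show "skew_family e b"
      unfolding skew_family_def by blast
    show "b a = q" using P0[of a] assms(2) ra r by (simp add: b_def)
    show "b x = 0" if "x \<in> A" for x using that P0[of x] by (simp add: b_def)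
  qed
qed

text \<open>The form is built one vertex at a time. After subtraction of the form for
  \<open>A\<close> the motion vanishes on \<open>A\<close>, so its value at \<open>a\<close> has
  roots at all points of \<open>insert a A\<close> and can be matched by a form that vanishes on
  \<open>A\<close>. The bound \<open>Suc e\<close> is what this interpolation allows.\<close>

lemma rigid_clique:
  assumes "finite S" "inj_on t S" "card S \<le> Suc e"
  shows "rigid e t {S}"
  unfolding rigid_def
proof (intro allI impI)
  fix q assume q: "motion e t {S} q"
  have j: "joined {S} u v" if "u \<in> S" "v \<in> S" for u v using that by (simp add: joined_def)
  have "\<exists>b. skew_family e b \<and> (\<forall>u\<in>A. q u = b (t u))" if "A \<subseteq> S" for A
    using finite_subset[OF that assms(1)] that
  proof (induction A rule: finite_induct)
    case empty
    show ?case by (intro exI[of _ "\<lambda>_. 0"]) (simp add: skew_family_def)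
  next
    case (insert a A)
    then obtain b where b: "skew_family e b" "\<And>u. u \<in> A \<Longrightarrow> q u = b (t u)" by blast
    define q' where "q' u = q u - b (t u)" for u
    have q': "motion e t {S} q'"
      unfolding q'_def by (rule motion_diff[OF q motion_skew_family[OF b(1)]])
    have q'0: "q' u = 0" if "u \<in> A" for u using b(2)[OF that] by (simp add: q'_def)
    have "inj_on t (insert a A)" using insert.prems assms(2) by (rule inj_on_subset[rotated])
    then have inj: "t a \<notin> t ` A" "inj_on t A" using insert.hyps by auto
    have "card (insert a A) \<le> Suc e" using insert.prems assms by (meson card_mono order_trans)
    then have "card A < Suc e" using insert.hyps by simp
    obtain c where c: "skew_family e c" "c (t a) = q' a" "\<And>r. r \<in> t ` A \<Longrightarrow> c r = 0"
    proof (rule skew_family_interpolate[of "t ` A" "t a" e "q' a"])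
      show "card (t ` A) < Suc e" using card_image_le[OF insert.hyps(1), of t] \<open>card A < Suc e\<close> by simp
      show "degree (q' a) \<le> e" using insert.prems by (intro motion_degree[OF q']) auto
      fix r assume "r \<in> insert (t a) (t ` A)"
      then obtain u where u: "u \<in> insert a A" "r = t u" by blast
      have "poly (q' a) (t u) + poly (q' u) (t a) = 0"
        using insert.prems u by (intro motion_joined[OF q'] j) auto
      then show "poly (q' a) r = 0" using u q'0 by (cases "u = a") auto
    qed (use insert.hyps inj in auto)
    show ?case
    proof (intro exI conjI ballI)
      show "skew_family e (\<lambda>s. b s + c s)" by (rule skew_family_add[OF b(1) c(1)])
      fix u assume "u \<in> insert a A"
      then show "q u = b (t u) + c (t u)"
        using b(2) c(2,3) by (auto simp: q'_def)
    qed
  qed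
  from this[of S] show "\<exists>b. skew_family e b \<and> (\<forall>u\<in>\<Union>{S}. q u = b (t u))" by simp
qed

text \<open>Subtracting the form that agrees with \<open>q\<close> on the clique \<open>S\<close>
  reduces rigidity to injectivity of a linear system, the one in which the motion is pinned to zero
  on \<open>S\<close>. \<open>pinned_motion_eq_0\<close> is the converse; both apply with
  \<open>card S = e\<close>.\<close>

lemma rigid_if_pinned:
  assumes "\<And>u v. u \<in> S \<Longrightarrow> v \<in> S \<Longrightarrow> joined C u v"
    and "finite S" "inj_on t S" "card S \<le> Suc e"
    and "\<And>q u. motion e t C q \<Longrightarrow> (\<And>v. v \<in> S \<Longrightarrow> q v = 0) \<Longrightarrow> u \<in> \<Union>C \<Longrightarrow> q u = 0"
  shows "rigid e t C"
  unfolding rigid_def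
proof (intro allI impI)
  fix q assume q: "motion e t C q"
  have "motion e t {S} q"
    by (rule motion_mono[OF q]) (use assms(1) in \<open>auto simp: joined_def\<close>)
  with rigid_clique[OF assms(2-4)] obtain b where b: "skew_family e b" "\<And>u. u \<in> \<Union>{S} \<Longrightarrow> q u = b (t u)"
    by (rule rigidE) blast
  have "q u - b (t u) = 0" if "u \<in> \<Union>C" for u
  proof (rule assms(5)[of "\<lambda>u. q u - b (t u)"])
    show "motion e t C (\<lambda>u. q u - b (t u))" by (rule motion_diff[OF q motion_skew_family[OF b(1)]])
  qed (use b(2) that in auto)
  then show "\<exists>b. skew_family e b \<and> (\<forall>u\<in>\<Union>C. q u = b (t u))"
    using b(1) by (intro exI[of _ b]) auto
qed

lemma pinned_motion_eq_0:
  assumes "rigid e t C" "S \<subseteq> \<Union>C" "finite S" "inj_on t S" "e \<le> card S"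
    and "motion e t C q" "\<And>v. v \<in> S \<Longrightarrow> q v = 0" "u \<in> \<Union>C"
  shows "q u = 0"
proof -
  obtain b where b: "skew_family e b" "\<And>u. u \<in> \<Union>C \<Longrightarrow> q u = b (t u)"
    using assms(1,6) by (rule rigidE) blast
  have "b = (\<lambda>_. 0)"
  proof (rule skew_family_eqI[OF b(1) _ assms(3-5)])
    show "skew_family e (\<lambda>_. 0)" by (simp add: skew_family_def)
    show "b (t v) = 0" if "v \<in> S" for v
      using b(2)[of v] assms(2) assms(7)[OF that] that by auto
  qed
  then show ?thesis using b(2)[OF assms(8)] by simp
qed

section \<open>Rigidity along polynomial families of placements\<close>

lemma poly_as_sum_le: "degree p \<le> n \<Longrightarrow> poly p x = (\<Sum>k\<le>n. x ^ k * coeff p k)"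
  for p :: "'k::comm_semiring_1 poly"
  unfolding poly_altdef
  by (intro sum.mono_neutral_cong_left) (auto simp: mult.commute coeff_eq_0)

lemma sum_row:
  fixes c :: "'v \<Rightarrow> nat \<Rightarrow> 'k::comm_semiring_1"
  assumes "finite V" "u \<in> V"
  shows "(\<Sum>w\<in>V. \<Sum>k\<le>e. (if w = u then g k else 0) * c w k) = (\<Sum>k\<le>e. g k * c u k)"
proof -
  have "(\<Sum>w\<in>V. \<Sum>k\<le>e. (if w = u then g k else 0) * c w k) = (\<Sum>w\<in>V. if w = u then \<Sum>k\<le>e. g k * c u k else 0)"
    by (intro sum.cong) auto
  then show ?thesis using assms by simp
qed

text \<open>\<open>generic_injective\<close> for unknowns that are polynomials, encoded by their
  coefficients up to degree \<open>e\<close>.\<close>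

lemma generic_poly_family:
  fixes L :: "'j \<Rightarrow> 'v \<Rightarrow> nat \<Rightarrow> real poly"
  assumes "finite V"
    and inj: "\<And>q. (\<And>v. v \<in> V \<Longrightarrow> degree (q v) \<le> e) \<Longrightarrow>
      (\<And>j. j \<in> J \<Longrightarrow> (\<Sum>v\<in>V. \<Sum>k\<le>e. poly (L j v k) s1 * coeff (q v) k) = 0) \<Longrightarrow> \<forall>v\<in>V. q v = 0"
  shows "finite {s. \<exists>q. (\<forall>v\<in>V. degree (q v) \<le> e) \<and>
      (\<forall>j\<in>J. (\<Sum>v\<in>V. \<Sum>k\<le>e. poly (L j v k) s * coeff (q v) k) = 0) \<and> (\<exists>v\<in>V. q v \<noteq> 0)}"
proof -
  define M where "M j i = L j (fst i) (snd i)" for j and i :: "'v \<times> nat"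
  have sums: "(\<Sum>i\<in>V \<times> {..e}. poly (M j i) s * x i) = (\<Sum>v\<in>V. \<Sum>k\<le>e. poly (L j v k) s * x (v, k))" for j s x
    by (simp add: M_def sum.cartesian_product split_def)
  have "finite {s. \<exists>x. (\<forall>j\<in>J. (\<Sum>i\<in>V \<times> {..e}. poly (M j i) s * x i) = 0) \<and> (\<exists>i\<in>V \<times> {..e}. x i \<noteq> 0)}"
  proof (rule generic_injective)
    show "finite (V \<times> {..e})" using assms(1) by simp
    fix x assume x: "\<forall>j\<in>J. (\<Sum>i\<in>V \<times> {..e}. poly (M j i) s1 * x i) = 0"
    define q where "q v = (\<Sum>k\<le>e. monom (x (v, k)) k)" for v
    have cq: "coeff (q v) k = x (v, k)" if "k \<le> e" for v k
      using that by (simp add: q_def coeff_sum)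
    have "degree (q v) \<le> e" for v
      unfolding q_def by (intro degree_sum_le) (auto intro: order.trans[OF degree_monom_le])
    moreover have "(\<Sum>v\<in>V. \<Sum>k\<le>e. poly (L j v k) s1 * coeff (q v) k) = 0" if "j \<in> J" for j
      using x that unfolding sums by (simp add: cq)
    ultimately have "\<forall>v\<in>V. q v = 0" by (intro inj)
    then have "x (v, k) = 0" if "v \<in> V" "k \<le> e" for v k using cq[OF that(2), of v] that(1) by simp
    then show "\<forall>i\<in>V \<times> {..e}. x i = 0" by auto
  qed
  then show ?thesis
  proof (rule rev_finite_subset, intro subsetI CollectI)
    fix s assume "s \<in> {s. \<exists>q. (\<forall>v\<in>V. degree (q v) \<le> e) \<and>
      (\<forall>j\<in>J. (\<Sum>v\<in>V. \<Sum>k\<le>e. poly (L j v k) s * coeff (q v) k) = 0) \<and> (\<exists>v\<in>V. q v \<noteq> 0)}"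
    then obtain q v where q: "\<And>v. v \<in> V \<Longrightarrow> degree (q v) \<le> e"
      "\<And>j. j \<in> J \<Longrightarrow> (\<Sum>v\<in>V. \<Sum>k\<le>e. poly (L j v k) s * coeff (q v) k) = 0" "v \<in> V" "q v \<noteq> 0"
      by blast
    show "\<exists>x. (\<forall>j\<in>J. (\<Sum>i\<in>V \<times> {..e}. poly (M j i) s * x i) = 0) \<and> (\<exists>i\<in>V \<times> {..e}. x i \<noteq> 0)"
      unfolding sums
    proof (intro exI[of _ "\<lambda>i. coeff (q (fst i)) (snd i)"] conjI ballI)
      show "\<exists>i\<in>V \<times> {..e}. coeff (q (fst i)) (snd i) \<noteq> 0"
        using q(1)[OF q(3)] q(3,4) by (intro bexI[of _ "(v, degree (q v))"]) auto
    qed (use q(2) in simp)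
  qed
qed

text \<open>The equation of the pair \<open>u\<close>, \<open>v\<close> as a row in the coefficients
  of the motion, for vertices that move along \<open>T\<close> with the parameter \<open>s\<close>.
  The two separate summands also cover \<open>u = v\<close>.\<close>

definition pair_row :: "('v \<Rightarrow> real poly) \<Rightarrow> 'v \<Rightarrow> 'v \<Rightarrow> 'v \<Rightarrow> nat \<Rightarrow> real poly" where
  "pair_row T u v w k = (if w = u then T v ^ k else 0) + (if w = v then T u ^ k else 0)"

lemma pair_row_sum:
  assumes "finite V" "u \<in> V" "v \<in> V" "degree (q u) \<le> e" "degree (q v) \<le> e"
  shows "(\<Sum>w\<in>V. \<Sum>k\<le>e. poly (pair_row T u v w k) s * coeff (q w) k)
    = poly (q u) (poly (T v) s) + poly (q v) (poly (T u) s)"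
proof -
  have "(\<Sum>w\<in>V. \<Sum>k\<le>e. poly (pair_row T u v w k) s * coeff (q w) k) =
      (\<Sum>w\<in>V. \<Sum>k\<le>e. (if w = u then poly (T v) s ^ k else 0) * coeff (q w) k) +
      (\<Sum>w\<in>V. \<Sum>k\<le>e. (if w = v then poly (T u) s ^ k else 0) * coeff (q w) k)"
    unfolding sum.distrib[symmetric] pair_row_def by (intro sum.cong) (auto simp: poly_power algebra_simps)
  also have "\<dots> = poly (q u) (poly (T v) s) + poly (q v) (poly (T u) s)"
    using assms by (simp add: sum_row poly_as_sum_le)
  finally show ?thesis .
qed

definition pin_row :: "'v \<Rightarrow> nat \<Rightarrow> 'v \<Rightarrow> nat \<Rightarrow> real poly" where
  "pin_row u l w k = (if w = u then if k = l then 1 else 0 else 0)"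

lemma pin_row_sum:
  assumes "finite V" "u \<in> V" "l \<le> e"
  shows "(\<Sum>w\<in>V. \<Sum>k\<le>e. poly (pin_row u l w k) s * coeff (q w) k) = coeff (q u) l"
proof -
  have "(\<Sum>w\<in>V. \<Sum>k\<le>e. poly (pin_row u l w k) s * coeff (q w) k) =
      (\<Sum>w\<in>V. \<Sum>k\<le>e. (if w = u then (if k = l then 1 else 0) else 0) * coeff (q w) k)"
    unfolding pin_row_def by (intro sum.cong) auto
  also have "\<dots> = (\<Sum>k\<le>e. (if k = l then 1 else 0) * coeff (q u) k)"
    by (rule sum_row[OF assms(1,2)])
  also have "\<dots> = (\<Sum>k\<le>e. if k = l then coeff (q u) l else 0)" by (intro sum.cong) auto
  finally show ?thesis using assms(3) by simp
qed

text \<open>As long as \<open>S\<close> is placed injectively, rigidity means that the pair rows and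
  the pin rows on \<open>S\<close> have only the zero solution; this persists for almost all
  \<open>s\<close> because the rows are polynomial in \<open>s\<close>.\<close>

lemma rigid_line:
  assumes "finite (\<Union>C)" "\<And>u v. u \<in> S \<Longrightarrow> v \<in> S \<Longrightarrow> joined C u v" "card S = e"
    and "rigid e (\<lambda>u. poly (T u) s1) C" "inj_on (\<lambda>u. poly (T u) s1) S"
  shows "finite {s. inj_on (\<lambda>u. poly (T u) s) S \<and> \<not> rigid e (\<lambda>u. poly (T u) s) C}"
proof -
  have SC: "S \<subseteq> \<Union>C" using assms(2) by (auto simp: joined_def)
  then have finS: "finite S" using assms(1) finite_subset by blast
  define J where "J = Inl ` {(u, v). joined C u v} \<union> Inr ` (S \<times> {..e})"
  define L where "L j = (case j of Inl (u, v) \<Rightarrow> pair_row T u v | Inr (u, l) \<Rightarrow> pin_row u l)" for j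
  have in_V: "u \<in> \<Union>C" "v \<in> \<Union>C" if "joined C u v" for u v using that by (auto simp: joined_def)
  have pair: "(\<Sum>w\<in>\<Union>C. \<Sum>k\<le>e. poly (L (Inl (u, v)) w k) s * coeff (q w) k)
      = poly (q u) (poly (T v) s) + poly (q v) (poly (T u) s)"
    if "joined C u v" "\<And>w. w \<in> \<Union>C \<Longrightarrow> degree (q w) \<le> e" for u v q s
    using pair_row_sum[OF assms(1) in_V[OF that(1)]] that(2) in_V[OF that(1)] by (simp add: L_def)
  have pin: "(\<Sum>w\<in>\<Union>C. \<Sum>k\<le>e. poly (L (Inr (u, l)) w k) s * coeff (q w) k) = coeff (q u) l"
    if "u \<in> S" "l \<le> e" for u l q s
    using pin_row_sum[OF assms(1) subsetD[OF SC that(1)] that(2)] by (simp add: L_def)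
  have "finite {s. \<exists>q. (\<forall>v\<in>\<Union>C. degree (q v) \<le> e) \<and>
      (\<forall>j\<in>J. (\<Sum>v\<in>\<Union>C. \<Sum>k\<le>e. poly (L j v k) s * coeff (q v) k) = 0) \<and> (\<exists>v\<in>\<Union>C. q v \<noteq> 0)}"
  proof (rule generic_poly_family[OF assms(1), where ?s1.0 = s1], rule ballI)
    fix q :: "'a \<Rightarrow> real poly" and u
    assume q: "\<And>v. v \<in> \<Union>C \<Longrightarrow> degree (q v) \<le> e"
      "\<And>j. j \<in> J \<Longrightarrow> (\<Sum>v\<in>\<Union>C. \<Sum>k\<le>e. poly (L j v k) s1 * coeff (q v) k) = 0" and u: "u \<in> \<Union>C"
    show "q u = 0"
    proof (rule pinned_motion_eq_0[OF assms(4) SC finS assms(5) _ _ _ u])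
      show "motion e (\<lambda>u. poly (T u) s1) C q"
      proof (rule motionI[OF q(1)])
        fix u v assume "joined C u v"
        moreover from this have "Inl (u, v) \<in> J" by (simp add: J_def)
        ultimately show "poly (q u) (poly (T v) s1) + poly (q v) (poly (T u) s1) = 0"
          using q(2) pair[of u v q s1, OF _ q(1)] by simp
      qed
      fix v assume "v \<in> S"
      then have "coeff (q v) l = 0" if "l \<le> e" for l
        using q(2)[of "Inr (v, l)"] unfolding pin[OF \<open>v \<in> S\<close> that] using that by (simp add: J_def image_iff)
      moreover have "coeff (q v) l = 0" if "\<not> l \<le> e" for l
        using q(1)[of v] SC \<open>v \<in> S\<close> that by (intro coeff_eq_0) fastforce
      ultimately show "q v = 0" by (intro poly_eqI) auto
    qed (use assms in auto)
  qed
  then show ?thesis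
  proof (rule rev_finite_subset, intro subsetI CollectI, elim CollectE conjE)
    fix s assume inj: "inj_on (\<lambda>u. poly (T u) s) S" and "\<not> rigid e (\<lambda>u. poly (T u) s) C"
    obtain q u where q: "motion e (\<lambda>u. poly (T u) s) C q" "\<And>v. v \<in> S \<Longrightarrow> q v = 0" "u \<in> \<Union>C" "q u \<noteq> 0"
    proof (rule ccontr)
      assume "\<not> thesis"
      then have "rigid e (\<lambda>u. poly (T u) s) C"
        using that assms(3) by (intro rigid_if_pinned[OF assms(2) finS inj]) auto
      with \<open>\<not> rigid e (\<lambda>u. poly (T u) s) C\<close> show False by blast
    qed
    have deg: "\<And>w. w \<in> \<Union>C \<Longrightarrow> degree (q w) \<le> e" using q(1) by (rule motion_degree)
    have "(\<Sum>v\<in>\<Union>C. \<Sum>k\<le>e. poly (L j v k) s * coeff (q v) k) = 0" if "j \<in> J" for j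
      using that unfolding J_def
    proof (elim UnE imageE)
      fix p assume p: "j = Inl p" "p \<in> {(u, v). joined C u v}"
      then obtain u v where uv: "p = (u, v)" "joined C u v" by blast
      show ?thesis
        unfolding p uv(1) using pair[OF uv(2), of q s] deg motion_joined[OF q(1) uv(2)] by simp
    next
      fix p assume p: "j = Inr p" "p \<in> S \<times> {..e}"
      then obtain u l where ul: "p = (u, l)" "u \<in> S" "l \<le> e" by auto
      show ?thesis unfolding p ul(1) using pin[OF ul(2,3), of s q] q(2)[OF ul(2)] by simp
    qed
    with deg q(3,4) show "\<exists>q. (\<forall>v\<in>\<Union>C. degree (q v) \<le> e) \<and>
      (\<forall>j\<in>J. (\<Sum>v\<in>\<Union>C. \<Sum>k\<le>e. poly (L j v k) s * coeff (q v) k) = 0) \<and> (\<exists>v\<in>\<Union>C. q v \<noteq> 0)"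
      by blast
  qed
qed

section \<open>Cones, common placements and vertex splits\<close>

text \<open>Projection from the point of \<open>a\<close>: once a trivial motion has made q_a zero,
  each q_u vanishes at t_a, and dividing by the linear factor leaves a motion of \<open>C\<close> in
  one dimension less. The projection maps the moment curve to a moment curve, so the parameters stay
  the same.\<close>

lemma rigid_cone:
  assumes rig: "rigid e t C" and aC: "a \<notin> \<Union>C" and inj: "inj_on t (insert a (\<Union>C))"
    and D: "\<Union>D = insert a (\<Union>C)" "\<And>u. u \<in> \<Union>C \<Longrightarrow> joined D a u" "\<And>u v. joined C u v \<Longrightarrow> joined D u v"
  shows "rigid (Suc e) t D"
  unfolding rigid_def
proof (intro allI impI)
  fix q assume q: "motion (Suc e) t D q"
  obtain b where b: "skew_family (Suc e) b" "b (t a) = q a"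
  proof (rule skew_family_interpolate[of "{}" "t a" "Suc e" "q a"])
    show "degree (q a) \<le> Suc e" using D(1) by (intro motion_degree[OF q]) simp
    show "poly (q a) r = 0" if "r \<in> insert (t a) {}" for r
      using that D(1) motion_self[OF q, of a] by simp
  qed (use that in auto)
  define q' where "q' u = q u - b (t u)" for u
  have q': "motion (Suc e) t D q'"
    unfolding q'_def by (rule motion_diff[OF q motion_skew_family[OF b(1)]])
  have q'a: "q' a = 0" using b(2) by (simp add: q'_def)
  have ne: "t u \<noteq> t a" if "u \<in> \<Union>C" for u
    using inj that aC by (metis inj_on_contraD insertI1 insertI2)
  have "\<exists>r. q' u = [:- t a, 1:] * r \<and> degree r \<le> e" if "u \<in> \<Union>C" for u
  proof -
    have "poly (q' a) (t u) + poly (q' u) (t a) = 0" using D(2)[OF that] by (rule motion_joined[OF q'])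
    then have "poly (q' u) (t a) = 0" by (simp add: q'a)
    then have "[:- t a, 1:] dvd q' u" using poly_eq_0_iff_dvd by blast
    then obtain r where r: "q' u = [:- t a, 1:] * r" unfolding dvd_def by blast
    have "degree (q' u) \<le> Suc e" using that D(1) by (intro motion_degree[OF q']) auto
    then have "degree r \<le> e" unfolding r by (cases "r = 0") (simp_all add: degree_mult_eq del: mult_pCons_left)
    with r show ?thesis by blast
  qed
  then obtain r where r: "\<And>u. u \<in> \<Union>C \<Longrightarrow> q' u = [:- t a, 1:] * r u"
    "\<And>u. u \<in> \<Union>C \<Longrightarrow> degree (r u) \<le> e" by metis
  \<comment> \<open>The quotients satisfy (t_v - t_a) r_u(t_v) + (t_u - t_a) r_v(t_u) = 0; this
    scaling removes the factors.\<close>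
  define r' where "r' u = smult (1 / (t u - t a)) (r u)" for u
  have "motion e t C r'"
  proof (rule motionI)
    show "degree (r' u) \<le> e" if "u \<in> \<Union>C" for u
      unfolding r'_def using r(2)[OF that] by (rule order.trans[OF degree_smult_le])
    fix u v assume uv: "joined C u v"
    then have uvC: "u \<in> \<Union>C" "v \<in> \<Union>C" by (auto simp: joined_def)
    have "poly (q' u) (t v) + poly (q' v) (t u) = 0" using D(3)[OF uv] by (rule motion_joined[OF q'])
    then have "(t v - t a) * poly (r u) (t v) + (t u - t a) * poly (r v) (t u) = 0"
      unfolding r(1)[OF uvC(1)] r(1)[OF uvC(2)] poly_mult by simp
    then show "poly (r' u) (t v) + poly (r' v) (t u) = 0"
      using ne[OF uvC(1)] ne[OF uvC(2)] by (simp add: r'_def field_simps)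
  qed
  with rig obtain c where c: "skew_family e c" "\<And>u. u \<in> \<Union>C \<Longrightarrow> r' u = c (t u)"
    by (rule rigidE) blast
  \<comment> \<open>As a form, c'(s, z) = (s - t_a) (z - t_a) c(s, z): both divisions are
    undone.\<close>
  define c' where "c' s = smult (s - t a) ([:- t a, 1:] * c s)" for s
  have c': "skew_family (Suc e) c'"
    unfolding skew_family_def
  proof (intro conjI allI)
    fix s
    have "degree (c s) \<le> e" using c(1) by (simp add: skew_family_def)
    then show "degree (c' s) \<le> Suc e"
      unfolding c'_def
      by (intro order.trans[OF degree_smult_le] order.trans[OF degree_mult_le]) simp
    fix r
    have "poly (c r) s + poly (c s) r = 0" using c(1) unfolding skew_family_def by blast
    moreover have "poly (c' r) s + poly (c' s) r = (r - t a) * (s - t a) * (poly (c r) s + poly (c s) r)"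
      by (simp add: c'_def algebra_simps)
    ultimately show "poly (c' r) s + poly (c' s) r = 0" by simp
  qed
  have "q' u = c' (t u)" if "u \<in> \<Union>D" for u
  proof (cases "u = a")
    case True
    then show ?thesis using q'a by (simp add: c'_def)
  next
    case False
    then have u: "u \<in> \<Union>C" using that D(1) by auto
    have "r u = smult (t u - t a) (c (t u))"
      unfolding c(2)[OF u, symmetric] r'_def using ne[OF u] by simp
    then show ?thesis unfolding r(1)[OF u] c'_def by simp
  qed
  then show "\<exists>b. skew_family (Suc e) b \<and> (\<forall>u\<in>\<Union>D. q u = b (t u))"
    using skew_family_add[OF b(1) c'] by (intro exI[of _ "\<lambda>s. b s + c' s"]) (auto simp: q'_def algebra_simps)
qed

lemma finite_not_inj_on_line:
  fixes s1 :: real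
  assumes "finite U" "inj_on (\<lambda>u. poly (T u) s1) U"
  shows "finite {s. \<not> inj_on (\<lambda>u. poly (T u) s) U}"
proof (rule finite_subset)
  show "{s. \<not> inj_on (\<lambda>u. poly (T u) s) U} \<subseteq> (\<Union>u\<in>U. \<Union>v\<in>U - {u}. {s. poly (T u - T v) s = 0})"
    by (auto simp: inj_on_def) 
  have "finite {s. poly (T u - T v) s = 0}" if "u \<in> U" "v \<in> U - {u}" for u v
  proof (rule poly_roots_finite)
    have "poly (T u) s1 \<noteq> poly (T v) s1" using assms(2) that by (auto dest: inj_onD)
    then show "T u - T v \<noteq> 0" by auto
  qed
  then show "finite (\<Union>u\<in>U. \<Union>v\<in>U - {u}. {s. poly (T u - T v) s = 0})"
    using assms(1) by blast
qed

text \<open>One injective placement suffices: by \<open>rigid_line\<close>, given a clique of size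
  \<open>e\<close>, it passes rigidity on to almost all placements on any line through it.\<close>

definition generically_rigid :: "nat \<Rightarrow> 'v set set \<Rightarrow> bool" where
  "generically_rigid e C \<longleftrightarrow> (\<exists>t. inj_on t (\<Union>C) \<and> rigid e t C)"

text \<open>A placement that is good for \<open>P\<close> is connected by a line to one that is
  rigid for the next \<open>C\<close>. Each of the finitely many conditions holds at one end of the
  line and so fails at finitely many of its points only. The clique \<open>S\<close> is what
  \<open>rigid_line\<close> pins.\<close>

lemma generically_rigid_common:
  assumes "finite P" "finite U"
    and "\<And>C. C \<in> P \<Longrightarrow> generically_rigid e C"
    and "\<And>C. C \<in> P \<Longrightarrow> finite (\<Union>C)"
    and "\<And>C. C \<in> P \<Longrightarrow> \<exists>S. card S = e \<and> (\<forall>u\<in>S. \<forall>v\<in>S. joined C u v)"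
  shows "\<exists>t. inj_on t U \<and> (\<forall>C\<in>P. inj_on t (\<Union>C) \<and> rigid e t C)"
  using assms(1,3-5)
proof (induction P rule: finite_induct)
  case empty
  obtain f :: "'a \<Rightarrow> nat" where "inj_on f U" using finite_imp_inj_to_nat_seg[OF assms(2)] by blast
  then have "inj_on (\<lambda>u. real (f u)) U" by (simp add: inj_on_def)
  then show ?case by (intro exI[of _ "\<lambda>u. real (f u)"]) simp
next
  case (insert C P)
  obtain t0 where t0: "inj_on t0 U" "\<And>D. D \<in> P \<Longrightarrow> inj_on t0 (\<Union>D) \<and> rigid e t0 D"
    using insert.IH insert.prems by auto
  obtain t1 where t1: "inj_on t1 (\<Union>C)" "rigid e t1 C"
    using insert.prems(1)[of C] by (auto simp: generically_rigid_def)
  define T where "T u = [:t0 u, t1 u - t0 u:]" for u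
  have T0: "(\<lambda>u. poly (T u) 0) = t0" and T1: "(\<lambda>u. poly (T u) 1) = t1" by (simp_all add: T_def)
  have bad: "finite {s. \<not> (inj_on (\<lambda>u. poly (T u) s) (\<Union>D) \<and> rigid e (\<lambda>u. poly (T u) s) D)}"
    if D: "D \<in> insert C P" for D
  proof -
    obtain s1 where s1: "inj_on (\<lambda>u. poly (T u) s1) (\<Union>D)" "rigid e (\<lambda>u. poly (T u) s1) D"
    proof (cases "D = C")
      case True
      then show ?thesis using that[of 1] t1 unfolding T1 by blast
    next
      case False
      then show ?thesis using that[of 0] t0(2)[of D] D unfolding T0 by blast
    qed
    obtain S where S: "card S = e" "\<And>u v. u \<in> S \<Longrightarrow> v \<in> S \<Longrightarrow> joined D u v"
      using insert.prems(3)[OF D] by blast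
    have SD: "S \<subseteq> \<Union>D" using S(2) by (auto simp: joined_def)
    have fin: "finite (\<Union>D)" by (rule insert.prems(2)[OF D])
    have "finite {s. inj_on (\<lambda>u. poly (T u) s) S \<and> \<not> rigid e (\<lambda>u. poly (T u) s) D}"
      by (rule rigid_line[OF fin S(2) S(1) s1(2) inj_on_subset[OF s1(1) SD]])
    moreover have "finite {s. \<not> inj_on (\<lambda>u. poly (T u) s) (\<Union>D)}"
      by (rule finite_not_inj_on_line[OF fin s1(1)])
    ultimately show ?thesis
      by (rule rev_finite_subset[OF finite_UnI]) (use inj_on_subset[OF _ SD] in blast)
  qed
  have "finite ({s. \<not> inj_on (\<lambda>u. poly (T u) s) U} \<union>
      (\<Union>D\<in>insert C P. {s. \<not> (inj_on (\<lambda>u. poly (T u) s) (\<Union>D) \<and> rigid e (\<lambda>u. poly (T u) s) D)}))" (is "finite ?B")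
    using finite_not_inj_on_line[OF assms(2), of T 0] t0(1) bad insert.hyps(1) by (simp add: T0)
  then obtain s where "s \<notin> ?B" using ex_new_if_finite infinite_UNIV_char_0 by blast
  then show ?case by blast
qed

lemma poly_pderiv_as_sum_le: "degree p \<le> n \<Longrightarrow> poly (pderiv p) x = (\<Sum>k\<le>n. of_nat k * x ^ (k - 1) * coeff p k)"
  for p :: "real poly"
proof -
  assume n: "degree p \<le> n"
  have "p = (\<Sum>k\<le>n. monom (coeff p k) k)" using poly_as_sum_of_monoms'[OF n] by simp
  then have "pderiv p = pderiv (\<Sum>k\<le>n. monom (coeff p k) k)" by simp
  also have "\<dots> = (\<Sum>k\<le>n. pderiv (monom (coeff p k) k))"
    by (induction n) (simp_all add: pderiv_add)
  finally show ?thesis by (simp add: pderiv_monom poly_sum poly_monom mult_ac)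
qed

text \<open>The divided difference ((a + s)^k - a^k) / s of X^k, written as a polynomial in
  \<open>s\<close>. At \<open>s = 0\<close> it is the derivative at \<open>a\<close>, so the limit
  of two colliding vertices becomes an ordinary parameter value.\<close>

definition quotient_row :: "real \<Rightarrow> nat \<Rightarrow> real poly" where
  "quotient_row a k = (\<Sum>i<k. [:a, 1:] ^ i * [:a:] ^ (k - Suc i))"

lemma quotient_row: "s * poly (quotient_row a k) s = (a + s) ^ k - a ^ k"
  unfolding power_diff_sumr2[of "a + s" k a] quotient_row_def
  by (simp add: poly_sum poly_power mult.commute)

lemma quotient_row_0: "poly (quotient_row a k) 0 = of_nat k * a ^ (k - 1)"
proof -
  have "poly (quotient_row a k) 0 = (\<Sum>i<k. a ^ i * a ^ (k - Suc i))"
    by (simp add: quotient_row_def poly_sum poly_power)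
  also have "\<dots> = (\<Sum>i<k. a ^ (k - 1))"
    by (intro sum.cong) (auto simp flip: power_add)
  finally show ?thesis by simp
qed

text \<open>\<open>x\<close> is placed at t_y + s, and \<open>C'\<close> is the limit
  \<open>s = 0\<close>. There the equation of the edge x y degenerates, so it is replaced by its
  quotient by \<open>s\<close>, which in the limit says that q_x and q_y have the same derivative at
  t_y. Then q_x - q_y has a double root at t_y and a root for each common neighbour in
  \<open>W\<close>, more than its degree allows; hence q_x = q_y and \<open>q\<close> is a motion of
  \<open>C'\<close>.\<close>

lemma rigid_vertex_split:
  assumes rig: "rigid e t C'" and fin: "finite (\<Union>C')" and inj: "inj_on t (\<Union>C')"
    and y: "y \<in> \<Union>C'" and x: "x \<notin> \<Union>C'" and C: "\<Union>C = insert x (\<Union>C')"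
    and away: "\<And>u v. joined C' u v \<Longrightarrow> u \<noteq> y \<Longrightarrow> v \<noteq> y \<Longrightarrow> joined C u v"
    and near: "\<And>u. joined C' u y \<Longrightarrow> u \<noteq> y \<Longrightarrow> joined C u y \<or> joined C u x"
    and xy: "joined C x y"
    and W: "W \<subseteq> \<Union>C' - {y}" "e \<le> Suc (card W)" "\<And>w. w \<in> W \<Longrightarrow> joined C x w \<and> joined C y w"
    and S: "\<And>u v. u \<in> S \<Longrightarrow> v \<in> S \<Longrightarrow> joined C u v" "card S = e" "\<not> (x \<in> S \<and> y \<in> S)"
  shows "generically_rigid e C"
proof -
  define V where "V = \<Union>C"
  have V: "V = insert x (\<Union>C')" and VC: "\<Union>C = V" by (simp_all add: V_def C)
  have finV: "finite V" using fin by (simp add: V)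
  have xne: "x \<noteq> y" using x y by blast
  have SV: "S \<subseteq> V" using S(1) by (auto simp: V_def joined_def)
  have finS: "finite S" using SV finV finite_subset by blast
  have inV: "u \<in> V" "v \<in> V" if "joined C u v" for u v using that by (auto simp: joined_def V_def)
  define \<tau> where "\<tau> = t y"
  define T where "T u = (if u = x then [:\<tau>, 1:] else [:t u:])" for u
  define q_row where "q_row w k = (if w = y then quotient_row \<tau> k else 0) - (if w = x then quotient_row \<tau> k else 0)" for w k
  \<comment> \<open>The pair x y is left out, while the self-equations of \<open>x\<close> and
    \<open>y\<close> stay; \<open>None\<close> stands for the divided edge equation.\<close>
  define J where "J = {Some (Inl (u, v)) | u v. joined C u v \<and> {u, v} \<noteq> {x, y}}
     \<union> {Some (Inr (u, l)) | u l. u \<in> S \<and> l \<le> e} \<union> {None}"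
  define L where "L j = (case j of Some (Inl (u, v)) \<Rightarrow> pair_row T u v | Some (Inr (u, l)) \<Rightarrow> pin_row u l
     | None \<Rightarrow> q_row)" for j
  have pair: "(\<Sum>w\<in>V. \<Sum>k\<le>e. poly (L (Some (Inl (u, v))) w k) s * coeff (q w) k)
      = poly (q u) (poly (T v) s) + poly (q v) (poly (T u) s)"
    if "joined C u v" "\<And>w. w \<in> V \<Longrightarrow> degree (q w) \<le> e" for u v q s
    using pair_row_sum[OF finV inV[OF that(1)], of q e T s] that(2) inV[OF that(1)] by (simp add: L_def)
  have pin: "(\<Sum>w\<in>V. \<Sum>k\<le>e. poly (L (Some (Inr (u, l))) w k) s * coeff (q w) k) = coeff (q u) l"
    if "u \<in> S" "l \<le> e" for u l q s
    using pin_row_sum[OF finV subsetD[OF SV that(1)] that(2)] by (simp add: L_def)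
  have quot: "(\<Sum>w\<in>V. \<Sum>k\<le>e. poly (L None w k) s * coeff (q w) k)
      = (\<Sum>k\<le>e. poly (quotient_row \<tau> k) s * coeff (q y) k) - (\<Sum>k\<le>e. poly (quotient_row \<tau> k) s * coeff (q x) k)" for q s
  proof -
    have "(\<Sum>w\<in>V. \<Sum>k\<le>e. poly (L None w k) s * coeff (q w) k) =
      (\<Sum>w\<in>V. \<Sum>k\<le>e. (if w = y then poly (quotient_row \<tau> k) s else 0) * coeff (q w) k) -
      (\<Sum>w\<in>V. \<Sum>k\<le>e. (if w = x then poly (quotient_row \<tau> k) s else 0) * coeff (q w) k)"
      unfolding sum_subtractf[symmetric] L_def q_row_def by (intro sum.cong) (auto simp: algebra_simps)
    then show ?thesis using finV y by (simp add: sum_row V)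
  qed
  define Bad where "Bad = {s. \<exists>q. (\<forall>v\<in>V. degree (q v) \<le> e) \<and>
      (\<forall>j\<in>J. (\<Sum>v\<in>V. \<Sum>k\<le>e. poly (L j v k) s * coeff (q v) k) = 0) \<and> (\<exists>v\<in>V. q v \<noteq> 0)}"
  have "finite Bad"
    unfolding Bad_def
  proof (rule generic_poly_family[OF finV, where ?s1.0 = 0])
    fix q :: "'a \<Rightarrow> real poly"
    assume deg: "\<And>v. v \<in> V \<Longrightarrow> degree (q v) \<le> e"
      and rows: "\<And>j. j \<in> J \<Longrightarrow> (\<Sum>v\<in>V. \<Sum>k\<le>e. poly (L j v k) 0 * coeff (q v) k) = 0"
    define t' where "t' = t(x := \<tau>)"
    have T0: "poly (T u) 0 = t' u" for u by (simp add: T_def t'_def)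
    have t'y: "t' y = \<tau>" "t' x = \<tau>" using xne by (auto simp: t'_def \<tau>_def)
    have t': "t' u = t u" if "u \<in> \<Union>C'" for u using that x by (auto simp: t'_def)
    have eq: "poly (q u) (t' v) + poly (q v) (t' u) = 0" if "joined C u v" "{u, v} \<noteq> {x, y}" for u v
      using rows[of "Some (Inl (u, v))"] that pair[OF that(1), of q 0] deg by (simp add: J_def T0)
    have q0: "q v = 0" if "v \<in> S" for v
    proof -
      have "coeff (q v) l = 0" if "l \<le> e" for l
        using rows[of "Some (Inr (v, l))"] \<open>v \<in> S\<close> that pin[OF \<open>v \<in> S\<close> that, of 0 q] by (simp add: J_def)
      moreover have "coeff (q v) l = 0" if "\<not> l \<le> e" for l
        using deg[of v] SV \<open>v \<in> S\<close> that by (intro coeff_eq_0) fastforce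
      ultimately show ?thesis by (intro poly_eqI) auto
    qed
    define p where "p = q x - q y"
    have "p = 0"
    proof (rule ccontr)
      assume "p \<noteq> 0"
      have xyV: "x \<in> V" "y \<in> V" using y by (auto simp: V)
      have degp: "degree p \<le> e" unfolding p_def using deg xyV by (intro degree_diff_le)
      have jxx: "joined C x x" "joined C y y" using xyV unfolding V_def joined_refl by blast+
      have "poly (q x) \<tau> = 0" using eq[OF jxx(1)] xne t'y by auto
      moreover have "poly (q y) \<tau> = 0" using eq[OF jxx(2)] xne t'y by auto
      ultimately have "poly p \<tau> = 0" by (simp add: p_def)
      then have "[:- \<tau>, 1:] dvd p" using poly_eq_0_iff_dvd by blast
      then obtain p' where p': "p = [:- \<tau>, 1:] * p'" unfolding dvd_def by blast
      with \<open>p \<noteq> 0\<close> have "p' \<noteq> 0" by auto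
      have degp': "degree p = Suc (degree p')"
        unfolding p' using \<open>p' \<noteq> 0\<close> by (simp add: degree_mult_eq del: mult_pCons_left)
      \<comment> \<open>This is row \<open>None\<close> at \<open>s = 0\<close>.\<close>
      have "poly (pderiv p) \<tau> = 0"
      proof -
        have "poly (pderiv p) \<tau> = poly (pderiv (q x)) \<tau> - poly (pderiv (q y)) \<tau>"
          by (simp add: p_def pderiv_diff)
        also have "\<dots> = - (\<Sum>w\<in>V. \<Sum>k\<le>e. poly (L None w k) 0 * coeff (q w) k)"
          unfolding quot
          by (simp add: poly_pderiv_as_sum_le[OF deg[OF xyV(1)]] poly_pderiv_as_sum_le[OF deg[OF xyV(2)]] quotient_row_0)
        also have "\<dots> = 0" using rows[of None] by (simp add: J_def)
        finally show ?thesis .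
      qed
      then have "poly p' \<tau> = 0" unfolding p' pderiv_mult by (simp add: pderiv_pCons)
      moreover have "poly p' (t w) = 0" if "w \<in> W" for w
      proof -
        have w: "w \<in> \<Union>C'" "w \<noteq> y" "w \<noteq> x" using W(1) x that by auto
        have "poly (q x) (t' w) + poly (q w) (t' x) = 0" "poly (q y) (t' w) + poly (q w) (t' y) = 0"
          using W(3)[OF that] w xne by (intro eq; auto)+
        then have "poly p (t w) = 0" unfolding t'y t'[OF w(1)] p_def by simp
        moreover have "t w \<noteq> \<tau>" unfolding \<tau>_def using inj w y by (auto dest: inj_onD)
        ultimately show ?thesis unfolding p' by simp
      qed
      moreover have "degree p' < card (insert \<tau> (t ` W))"
      proof -
        have "inj_on t (insert y W)" using W(1) y by (intro inj_on_subset[OF inj]) auto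
        moreover have "finite W" using W(1) fin finite_subset by blast
        moreover have "insert \<tau> (t ` W) = t ` insert y W" by (simp add: \<tau>_def)
        moreover have "y \<notin> W" using W(1) by blast
        ultimately have "card (insert \<tau> (t ` W)) = Suc (card W)" by (simp add: card_image)
        then show ?thesis using W(2) degp degp' by simp
      qed
      ultimately have "p' = 0"
        by (intro poly_eq_0_if_roots[of p' "degree p'" "insert \<tau> (t ` W)"]) auto
      with \<open>p' \<noteq> 0\<close> show False by simp
    qed
    then have qxy: "q x = q y" by (simp add: p_def)
    have mot: "motion e t C' q"
    proof (rule motionI)
      show "degree (q u) \<le> e" if "u \<in> \<Union>C'" for u using that by (intro deg) (simp add: V)
      have near': "poly (q u) (t y) + poly (q y) (t u) = 0" if uy: "joined C' u y" for u
      proof (cases "u = y")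
        case True
        then show ?thesis using eq[of y y] y xne t'y by (auto simp: \<tau>_def joined_refl[symmetric] C)
      next
        case False
        have u: "u \<in> \<Union>C'" using uy by (auto simp: joined_def)
        then have "u \<noteq> x" using x by blast
        consider "joined C u y" | "joined C u x" using near[OF uy False] by blast
        then show ?thesis
        proof cases
          case 1
          then show ?thesis using eq[OF 1] False \<open>u \<noteq> x\<close> t'[OF u] t'y by (auto simp: \<tau>_def)
        next
          case 2
          then show ?thesis using eq[OF 2] False \<open>u \<noteq> x\<close> t'[OF u] t'y qxy by (auto simp: \<tau>_def)
        qed
      qed
      fix u v assume uv: "joined C' u v"
      then have uvC: "u \<in> \<Union>C'" "v \<in> \<Union>C'" by (auto simp: joined_def)
      consider "v = y" | "u = y" | "u \<noteq> y" "v \<noteq> y" by blast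
      then show "poly (q u) (t v) + poly (q v) (t u) = 0"
      proof cases
        case 1
        then show ?thesis using near' uv by blast
      next
        case 2
        then show ?thesis using near'[of v] joined_sym[OF uv] by (simp add: add.commute)
      next
        case 3
        then show ?thesis using eq[OF away[OF uv 3]] t'[OF uvC(1)] t'[OF uvC(2)] by (auto simp: doubleton_eq_iff)
      qed
    qed
    \<comment> \<open>\<open>S\<close> may contain \<open>x\<close>, which is not a vertex of
      \<open>C'\<close>; as q_x = q_y, the vertex \<open>y\<close> can take its place.
      \<open>S\<close> does not contain both, so the size is kept.\<close>
    define S' where "S' = (if x \<in> S then insert y (S - {x}) else S)"
    have S': "S' \<subseteq> \<Union>C'" "card S' = e" "finite S'"
      using SV S(2,3) finS y card_Suc_Diff1[OF finS, of x]
      by (auto simp: S'_def V card_insert_if split: if_splits)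
    have "q u = 0" if "u \<in> \<Union>C'" for u
    proof (rule pinned_motion_eq_0[OF rig S'(1,3) inj_on_subset[OF inj S'(1)] _ mot _ that])
      show "q v = 0" if "v \<in> S'" for v
        using that q0 qxy by (auto simp: S'_def split: if_splits)
    qed (simp add: S')
    then show "\<forall>v\<in>V. q v = 0" using qxy y by (auto simp: V)
  qed
  \<comment> \<open>Besides \<open>Bad\<close>, the parameters are excluded at which
    \<open>x\<close> would land on a placed vertex; among them is \<open>s = 0\<close>, where it
    meets \<open>y\<close>.\<close>
  moreover have "finite {s. \<tau> + s \<in> t ` \<Union>C'}"
  proof (rule finite_subset)
    show "{s. \<tau> + s \<in> t ` \<Union>C'} \<subseteq> (\<lambda>r. r - \<tau>) ` t ` \<Union>C'" by force
  qed (use fin in simp)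
  ultimately have "finite (Bad \<union> {s. \<tau> + s \<in> t ` \<Union>C'})" by simp
  with infinite_UNIV_char_0 have "\<exists>s. s \<notin> Bad \<union> {s. \<tau> + s \<in> t ` \<Union>C'}" by (rule ex_new_if_finite)
  then obtain s where s: "s \<notin> Bad" "\<tau> + s \<notin> t ` \<Union>C'" by auto
  define t' where "t' = t(x := \<tau> + s)"
  have t': "t' u = poly (T u) s" for u by (simp add: T_def t'_def)
  have "inj_on t' (\<Union>C')" unfolding t'_def using inj s(2) by (rule inj_on_fun_updI)
  then have inj': "inj_on t' V" unfolding V using s(2) x by (auto simp: t'_def)
  have sne: "s \<noteq> 0" using s(2) y by (auto simp: \<tau>_def)
  have cardS: "card S \<le> Suc e" unfolding S(2) by simp
  have "rigid e t' C"
  proof (rule rigid_if_pinned[OF S(1) finS inj_on_subset[OF inj' SV] cardS])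
    fix q u assume q: "motion e t' C q" "\<And>v. v \<in> S \<Longrightarrow> q v = 0" and u: "u \<in> \<Union>C"
    have deg: "\<And>w. w \<in> V \<Longrightarrow> degree (q w) \<le> e" using motion_degree[OF q(1)] by (simp add: V_def)
    have "(\<Sum>v\<in>V. \<Sum>k\<le>e. poly (L j v k) s * coeff (q v) k) = 0" if j: "j \<in> J" for j
    proof -
      consider u v where "j = Some (Inl (u, v))" "joined C u v" | u l where "j = Some (Inr (u, l))" "u \<in> S" "l \<le> e"
        | "j = None" using j unfolding J_def by blast
      then show ?thesis
      proof cases
        case (1 u v)
        show ?thesis unfolding 1(1) using pair[OF 1(2), of q s] deg motion_joined[OF q(1) 1(2)] by (simp add: t')
      next
        case (2 u l)
        show ?thesis unfolding 2(1) using pin[OF 2(2,3), of s q] q(2)[OF 2(2)] by simp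
      next
        case 3
        have xyV: "x \<in> V" "y \<in> V" using y by (auto simp: V)
        \<comment> \<open>For a motion both q_x(\<tau> + s) and q_y(\<tau>) are zero, so
          \<open>s\<close> times the divided row is the equation of the edge x y.\<close>
        have quo: "s * (\<Sum>k\<le>e. poly (quotient_row \<tau> k) s * coeff (q v) k) = poly (q v) (\<tau> + s) - poly (q v) \<tau>" if "v \<in> V" for v
        proof -
          have "s * (\<Sum>k\<le>e. poly (quotient_row \<tau> k) s * coeff (q v) k)
              = (\<Sum>k\<le>e. (s * poly (quotient_row \<tau> k) s) * coeff (q v) k)"
            by (simp add: sum_distrib_left mult.assoc)
          also have "\<dots> = poly (q v) (\<tau> + s) - poly (q v) \<tau>"
            unfolding quotient_row
            by (simp add: poly_as_sum_le[OF deg[OF that]] left_diff_distrib sum_subtractf)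
          finally show ?thesis .
        qed
        have tx: "t' x = \<tau> + s" "t' y = \<tau>" using xne by (auto simp: t'_def \<tau>_def)
        have "poly (q x) (\<tau> + s) = 0" using motion_self[OF q(1), of x] xyV by (simp add: tx VC)
        moreover have "poly (q y) \<tau> = 0" using motion_self[OF q(1), of y] xyV by (simp add: tx VC)
        moreover have "poly (q x) \<tau> + poly (q y) (\<tau> + s) = 0" using motion_joined[OF q(1) xy] by (simp add: tx)
        ultimately have "s * (\<Sum>w\<in>V. \<Sum>k\<le>e. poly (L None w k) s * coeff (q w) k) = 0"
          unfolding quot right_diff_distrib quo[OF xyV(1)] quo[OF xyV(2)] by simp
        then show ?thesis using sne by (simp add: 3)
      qed
    qed
    then show "q u = 0" using s(1) deg u unfolding Bad_def V_def by blast
  qed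
  then show ?thesis using inj' by (auto simp: generically_rigid_def V_def)
qed

section \<open>Circuits modulo two are generically rigid\<close>

definition cofaces :: "'v set set \<Rightarrow> 'v set \<Rightarrow> 'v set set" where
  "cofaces A \<rho> = {\<sigma>\<in>A. \<rho> \<subseteq> \<sigma>}"

text \<open>A set of faces of size \<open>e\<close> as a chain over the field with two elements; the
  parity condition says that its boundary vanishes.\<close>

definition mod2_cycle :: "nat \<Rightarrow> 'v set set \<Rightarrow> bool" where
  "mod2_cycle e C \<longleftrightarrow> finite C \<and> (\<forall>\<sigma>\<in>C. finite \<sigma> \<and> card \<sigma> = e) \<and>
     (\<forall>\<rho>. Suc (card \<rho>) = e \<longrightarrow> even (card (cofaces C \<rho>)))"

text \<open>The induction runs over circuits instead of pseudomanifolds because contracting an edge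
  turns a circuit into a cycle, which splits into circuits again, while it may destroy the
  pseudomanifold property.\<close>

definition mod2_circuit :: "nat \<Rightarrow> 'v set set \<Rightarrow> bool" where
  "mod2_circuit e C \<longleftrightarrow> mod2_cycle e C \<and> C \<noteq> {} \<and>
     (\<forall>B. B \<subseteq> C \<longrightarrow> B \<noteq> {} \<longrightarrow> mod2_cycle e B \<longrightarrow> B = C)"

lemma finite_cofaces: "finite A \<Longrightarrow> finite (cofaces A \<rho>)"
  by (simp add: cofaces_def)

lemma card_cofaces_Diff:
  assumes "finite B" "A \<subseteq> B"
  shows "card (cofaces B \<rho>) = card (cofaces A \<rho>) + card (cofaces (B - A) \<rho>)"
proof -
  have "cofaces B \<rho> = cofaces A \<rho> \<union> cofaces (B - A) \<rho>" using assms(2) by (auto simp: cofaces_def)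
  moreover have "cofaces A \<rho> \<inter> cofaces (B - A) \<rho> = {}" by (auto simp: cofaces_def)
  ultimately show ?thesis
    using assms finite_subset by (metis card_Un_disjoint finite_Diff finite_cofaces)
qed

lemma odd_cofaces_Union:
  assumes "finite \<A>" "\<And>A. A \<in> \<A> \<Longrightarrow> finite A" "disjoint \<A>" "odd (card (cofaces (\<Union>\<A>) \<rho>))"
  obtains A where "A \<in> \<A>" "odd (card (cofaces A \<rho>))"
proof -
  have "card (cofaces (\<Union>\<A>) \<rho>) = (\<Sum>A\<in>\<A>. card (cofaces A \<rho>))"
  proof -
    have "cofaces (\<Union>\<A>) \<rho> = (\<Union>A\<in>\<A>. cofaces A \<rho>)" by (auto simp: cofaces_def)
    moreover have "cofaces A \<rho> \<inter> cofaces B \<rho> = {}" if "A \<in> \<A>" "B \<in> \<A>" "A \<noteq> B" for A B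
      using disjointD[OF assms(3) that] by (auto simp: cofaces_def)
    ultimately show ?thesis
      using assms(1,2) by (simp add: card_UN_disjoint finite_cofaces)
  qed
  then show thesis using assms(4) that by (metis dvd_sum)
qed

text \<open>Splitting off a minimal nonempty member of \<open>R\<close> leaves a smaller set in
  \<open>R\<close>, since \<open>R\<close> is closed under relative complements.\<close>

lemma exists_minimal_partition:
  assumes "finite B" "R B" "\<And>A B. R A \<Longrightarrow> R B \<Longrightarrow> A \<subseteq> B \<Longrightarrow> R (B - A)"
  shows "\<exists>\<A>. \<Union>\<A> = B \<and> disjoint \<A> \<and>
    (\<forall>A\<in>\<A>. A \<noteq> {} \<and> R A \<and> (\<forall>A'. A' \<subseteq> A \<longrightarrow> A' \<noteq> {} \<longrightarrow> R A' \<longrightarrow> A' = A))"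
  using assms(1,2)
proof (induction B rule: finite_psubset_induct)
  case (psubset B)
  show ?case
  proof (cases "B = {}")
    case True
    then show ?thesis by (intro exI[of _ "{}"]) auto
  next
    case False
    define M where "M = {A. A \<subseteq> B \<and> A \<noteq> {} \<and> R A}"
    have "finite M" "M \<noteq> {}" using psubset False by (auto simp: M_def)
    then obtain A where A: "A \<in> M" "\<And>A'. A' \<in> M \<Longrightarrow> A' \<subseteq> A \<Longrightarrow> A' = A"
      using finite_has_minimal[of M] by auto
    then have "B - A \<subset> B" "R (B - A)" using psubset.prems assms(3) by (auto simp: M_def)
    from psubset.IH[OF this] obtain \<A> where \<A>: "\<Union>\<A> = B - A" "disjoint \<A>"
      "\<forall>A\<in>\<A>. A \<noteq> {} \<and> R A \<and> (\<forall>A'. A' \<subseteq> A \<longrightarrow> A' \<noteq> {} \<longrightarrow> R A' \<longrightarrow> A' = A)"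
      by (elim exE conjE)
    show ?thesis
    proof (intro exI conjI ballI)
      show "\<Union>(insert A \<A>) = B" using \<A>(1) A(1) by (auto simp: M_def)
      show "disjoint (insert A \<A>)" using \<A>(1,2) by (auto simp: disjoint_def)
      fix A1 assume "A1 \<in> insert A \<A>"
      then consider "A1 = A" | "A1 \<in> \<A>" by blast
      then have "A1 \<noteq> {} \<and> R A1 \<and> (\<forall>A'. A' \<subseteq> A1 \<longrightarrow> A' \<noteq> {} \<longrightarrow> R A' \<longrightarrow> A' = A1)"
      proof cases
        case 1
        then show ?thesis using A by (auto simp: M_def)
      next
        case 2
        then show ?thesis using \<A>(3) by blast
      qed
      then show "A1 \<noteq> {}" "R A1" "\<forall>A'. A' \<subseteq> A1 \<longrightarrow> A' \<noteq> {} \<longrightarrow> R A' \<longrightarrow> A' = A1"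
        by blast+
    qed
  qed
qed

section \<open>Contraction of an edge\<close>

locale edge_contraction =
  fixes e :: nat and x y :: 'v
  assumes e: "3 \<le> e" and xy: "x \<noteq> y"
begin

text \<open>The cycles modulo the faces that contain both \<open>x\<close> and \<open>y\<close>: the \<open>A\<close> whose image under the
  contraction of \<open>x\<close> to \<open>y\<close> is a cycle.\<close>

definition rel_cycle :: "'v set set \<Rightarrow> bool" where
  "rel_cycle A \<longleftrightarrow> finite A \<and> (\<forall>\<sigma>\<in>A. finite \<sigma> \<and> card \<sigma> = e \<and> \<not> (x \<in> \<sigma> \<and> y \<in> \<sigma>)) \<and>
     (\<forall>\<rho>. Suc (card \<rho>) = e \<longrightarrow> x \<notin> \<rho> \<longrightarrow> y \<notin> \<rho> \<longrightarrow> even (card (cofaces A \<rho>))) \<and>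
     (\<forall>\<kappa>. card \<kappa> + 2 = e \<longrightarrow> x \<notin> \<kappa> \<longrightarrow> y \<notin> \<kappa> \<longrightarrow>
        even (card (cofaces A (insert x \<kappa>)) + card (cofaces A (insert y \<kappa>))))"

text \<open>The boundary of a relative cycle \<open>A\<close> consists of the faces x \<kappa> and y
  \<kappa> with \<kappa> in \<open>odd_links A\<close>. \<open>filled\<close> cancels it by adding
  the faces x y \<kappa>, so that \<open>odd_links A\<close> becomes the link of the edge x
  y.\<close>

definition odd_links :: "'v set set \<Rightarrow> 'v set set" where
  "odd_links A = {\<kappa>. card \<kappa> + 2 = e \<and> x \<notin> \<kappa> \<and> y \<notin> \<kappa> \<and> odd (card (cofaces A (insert x \<kappa>)))}"

definition filled :: "'v set set \<Rightarrow> 'v set set" where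
  "filled A = A \<union> (\<lambda>\<kappa>. insert x (insert y \<kappa>)) ` odd_links A"

lemma rel_cycle_finite: "rel_cycle A \<Longrightarrow> finite A"
  by (simp add: rel_cycle_def)

lemma rel_cycle_member: "rel_cycle A \<Longrightarrow> \<sigma> \<in> A \<Longrightarrow> finite \<sigma> \<and> card \<sigma> = e \<and> \<not> (x \<in> \<sigma> \<and> y \<in> \<sigma>)"
  by (simp add: rel_cycle_def)

lemma rel_cycle_even2:
  "rel_cycle A \<Longrightarrow> card \<kappa> + 2 = e \<Longrightarrow> x \<notin> \<kappa> \<Longrightarrow> y \<notin> \<kappa> \<Longrightarrow>
    even (card (cofaces A (insert x \<kappa>)) + card (cofaces A (insert y \<kappa>)))"
  by (simp add: rel_cycle_def)

lemma odd_links_finite: "\<kappa> \<in> odd_links A \<Longrightarrow> finite \<kappa>"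
  using e by (intro card_ge_0_finite) (auto simp: odd_links_def)

lemma odd_links_coface:
  assumes "rel_cycle A" "\<kappa> \<in> odd_links A" "z \<in> {x, y}"
  obtains \<sigma> where "\<sigma> \<in> A" "insert z \<kappa> \<subseteq> \<sigma>"
proof -
  have "odd (card (cofaces A (insert x \<kappa>)))" using assms(2) by (simp add: odd_links_def)
  moreover from this have "odd (card (cofaces A (insert y \<kappa>)))"
    using assms(1,2) unfolding rel_cycle_def odd_links_def by auto
  ultimately have "cofaces A (insert z \<kappa>) \<noteq> {}" using assms(3) by auto
  then show thesis using that by (auto simp: cofaces_def)
qed

lemma odd_links_vertices: "rel_cycle A \<Longrightarrow> \<kappa> \<in> odd_links A \<Longrightarrow> \<kappa> \<subseteq> \<Union>A - {x, y}"
  by (elim odd_links_coface[of _ _ x]) (auto simp: odd_links_def)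

lemma finite_odd_links:
  assumes "rel_cycle A"
  shows "finite (odd_links A)"
proof (rule finite_subset)
  show "odd_links A \<subseteq> Pow (\<Union>A)" using odd_links_vertices[OF assms] by blast
  show "finite (Pow (\<Union>A))" using assms by (auto simp: rel_cycle_def)
qed

lemma rel_cycle_Diff:
  assumes "rel_cycle A" "rel_cycle B" "A \<subseteq> B"
  shows "rel_cycle (B - A)"
proof -
  have "card (cofaces B \<rho>) = card (cofaces A \<rho>) + card (cofaces (B - A) \<rho>)" for \<rho>
    using assms by (intro card_cofaces_Diff) (auto simp: rel_cycle_def)
  then show ?thesis using assms unfolding rel_cycle_def by auto
qed

lemma rel_cycle_Union:
  assumes "finite \<A>" "disjoint \<A>" "\<And>A. A \<in> \<A> \<Longrightarrow> rel_cycle A"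
  shows "rel_cycle (\<Union>\<A>)"
  using assms
proof (induction \<A> rule: finite_induct)
  case empty
  show ?case by (simp add: rel_cycle_def cofaces_def)
next
  case (insert A \<A>)
  have IH: "rel_cycle (\<Union>\<A>)" using insert by (auto simp: disjoint_def)
  have "A \<inter> \<Union>\<A> = {}" using insert by (auto simp: disjoint_def)
  then have "\<Union>(insert A \<A>) - A = \<Union>\<A>" by auto
  moreover have fin: "finite (\<Union>(insert A \<A>))" using IH insert.prems by (auto simp: rel_cycle_def)
  ultimately have "card (cofaces (\<Union>(insert A \<A>)) \<rho>) = card (cofaces A \<rho>) + card (cofaces (\<Union>\<A>) \<rho>)" for \<rho>
    using card_cofaces_Diff[OF fin, of A \<rho>] by auto
  moreover have "rel_cycle A" using insert.prems by simp
  ultimately show ?case using IH fin unfolding rel_cycle_def by auto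
qed

text \<open>This is \<open>\<partial>\<partial> = 0\<close>: each member of \<open>A\<close> above \<open>insert x \<mu>\<close> has exactly two faces \<open>insert x \<kappa>\<close>
  with \<open>\<mu> \<subset> \<kappa>\<close>.\<close>

lemma even_odd_links:
  assumes A: "rel_cycle A" and \<mu>: "card \<mu> + 3 = e" "finite \<mu>" "x \<notin> \<mu>" "y \<notin> \<mu>"
  shows "even (card {\<kappa>\<in>odd_links A. \<mu> \<subseteq> \<kappa>})"
proof -
  define Z where "Z = \<Union>A - insert x (insert y \<mu>)"
  have finA: "finite A" "\<And>\<sigma>. \<sigma> \<in> A \<Longrightarrow> finite \<sigma>" using A by (auto simp: rel_cycle_def)
  then have finZ: "finite Z" by (auto simp: Z_def)
  have fib: "card {z\<in>Z. insert x (insert z \<mu>) \<subseteq> \<sigma>} = 2" if "\<sigma> \<in> cofaces A (insert x \<mu>)" for \<sigma>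
  proof -
    have \<sigma>: "\<sigma> \<in> A" "insert x \<mu> \<subseteq> \<sigma>" "y \<notin> \<sigma>" "finite \<sigma>" "card \<sigma> = e"
      using that A by (auto simp: cofaces_def rel_cycle_def)
    then have "{z\<in>Z. insert x (insert z \<mu>) \<subseteq> \<sigma>} = \<sigma> - insert x \<mu>" by (auto simp: Z_def)
    then show ?thesis using \<sigma> \<mu> by (simp add: card_Diff_subset)
  qed
  have "(\<Sum>z\<in>Z. card (cofaces A (insert x (insert z \<mu>))))
      = (\<Sum>z\<in>Z. card {\<sigma>\<in>cofaces A (insert x \<mu>). insert x (insert z \<mu>) \<subseteq> \<sigma>})"
    by (intro sum.cong arg_cong[where f = card]) (auto simp: cofaces_def)
  also have "\<dots> = (\<Sum>\<sigma>\<in>cofaces A (insert x \<mu>). card {z\<in>Z. insert x (insert z \<mu>) \<subseteq> \<sigma>})"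
    unfolding card_eq_sum using finZ finA(1) by (intro sum.swap_restrict) (simp_all add: finite_cofaces)
  also have "\<dots> = 2 * card (cofaces A (insert x \<mu>))" using fib by simp
  finally have "even (\<Sum>z\<in>Z. card (cofaces A (insert x (insert z \<mu>))))" by simp
  then have "even (card {z\<in>Z. odd (card (cofaces A (insert x (insert z \<mu>))))})"
    using finZ by (simp add: even_sum_iff)
  also have "card {z\<in>Z. odd (card (cofaces A (insert x (insert z \<mu>))))} = card {\<kappa>\<in>odd_links A. \<mu> \<subseteq> \<kappa>}"
  proof (rule bij_betw_same_card[where f = "\<lambda>z. insert z \<mu>"], rule bij_betw_imageI)
    show "inj_on (\<lambda>z. insert z \<mu>) {z\<in>Z. odd (card (cofaces A (insert x (insert z \<mu>))))}"
      by (auto simp: inj_on_def Z_def)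
    show "(\<lambda>z. insert z \<mu>) ` {z\<in>Z. odd (card (cofaces A (insert x (insert z \<mu>))))} = {\<kappa>\<in>odd_links A. \<mu> \<subseteq> \<kappa>}"
    proof (intro equalityI subsetI)
      fix \<kappa> assume \<kappa>: "\<kappa> \<in> {\<kappa>\<in>odd_links A. \<mu> \<subseteq> \<kappa>}"
      then have "card (\<kappa> - \<mu>) = 1"
        using \<mu> by (subst card_Diff_subset) (auto simp: odd_links_def)
      then obtain z where z: "\<kappa> - \<mu> = {z}" by (auto simp: card_1_singleton_iff)
      then have "\<kappa> = insert z \<mu>" "z \<notin> \<mu>" using \<kappa> by auto
      then show "\<kappa> \<in> (\<lambda>z. insert z \<mu>) ` {z\<in>Z. odd (card (cofaces A (insert x (insert z \<mu>))))}"
        using \<kappa> odd_links_vertices[OF A, of \<kappa>] by (auto simp: Z_def odd_links_def)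
    next
      fix \<kappa> assume "\<kappa> \<in> (\<lambda>z. insert z \<mu>) ` {z\<in>Z. odd (card (cofaces A (insert x (insert z \<mu>))))}"
      then show "\<kappa> \<in> {\<kappa>\<in>odd_links A. \<mu> \<subseteq> \<kappa>}" using \<mu> by (auto simp: Z_def odd_links_def)
    qed
  qed
  finally show ?thesis .
qed

lemma cofaces_filled:
  "cofaces (filled A) \<rho> = cofaces A \<rho> \<union> {insert x (insert y \<kappa>) | \<kappa>. \<kappa> \<in> odd_links A \<and> \<rho> \<subseteq> insert x (insert y \<kappa>)}"
  by (auto simp: cofaces_def filled_def)

text \<open>For a ridge that contains exactly one of \<open>x\<close> and \<open>y\<close>, an added
  face corrects the parity where it is odd. A ridge that contains both lies in added faces only,
  which \<open>even_odd_links\<close> counts; a ridge that contains neither is too large to lie in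
  an added face.\<close>

lemma mod2_cycle_filled:
  assumes A: "rel_cycle A"
  shows "mod2_cycle e (filled A)"
  unfolding mod2_cycle_def
proof (intro conjI allI impI)
  show "finite (filled A)" using finite_odd_links[OF A] rel_cycle_finite[OF A] by (simp add: filled_def)
  have "finite (insert x (insert y \<kappa>)) \<and> card (insert x (insert y \<kappa>)) = e" if "\<kappa> \<in> odd_links A" for \<kappa>
    using odd_links_finite[OF that] that xy by (simp add: odd_links_def)
  then show "\<forall>\<sigma>\<in>filled A. finite \<sigma> \<and> card \<sigma> = e"
    unfolding filled_def ball_Un ball_simps(9) using rel_cycle_member[OF A] by simp
  fix \<rho> :: "'v set" assume \<rho>: "Suc (card \<rho>) = e"
  have fin\<rho>: "finite \<rho>" using e \<rho> by (intro card_ge_0_finite) linarith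
  have finc: "finite (cofaces A \<rho>)" by (rule finite_cofaces[OF rel_cycle_finite[OF A]])
  have one: "even (card (cofaces (filled A) (insert z \<kappa>)))"
    if \<kappa>: "\<rho> = insert z \<kappa>" "x \<notin> \<kappa>" "y \<notin> \<kappa>" "z \<in> {x, y}" for z \<kappa>
  proof -
    have ck: "card \<kappa> + 2 = e" "finite \<kappa>" using \<kappa> \<rho> fin\<rho> by auto
    have sub: "insert z \<kappa> \<subseteq> insert x (insert y \<kappa>') \<longleftrightarrow> \<kappa>' = \<kappa>" if "\<kappa>' \<in> odd_links A" for \<kappa>'
    proof
      assume "insert z \<kappa> \<subseteq> insert x (insert y \<kappa>')"
      then have "\<kappa> \<subseteq> \<kappa>'" using \<kappa> by auto
      moreover have "card \<kappa> = card \<kappa>'" using ck that by (simp add: odd_links_def)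
      ultimately show "\<kappa>' = \<kappa>" using card_subset_eq[OF odd_links_finite[OF that]] by blast
    qed (use \<kappa> in auto)
    have eqpar: "odd (card (cofaces A (insert z \<kappa>))) \<longleftrightarrow> \<kappa> \<in> odd_links A"
      using \<kappa>(4) rel_cycle_even2[OF A ck(1) \<kappa>(2,3)] ck(1) \<kappa>(2,3) by (auto simp: odd_links_def)
    show ?thesis
    proof (cases "\<kappa> \<in> odd_links A")
      case True
      then have "cofaces (filled A) (insert z \<kappa>) = insert (insert x (insert y \<kappa>)) (cofaces A (insert z \<kappa>))"
        unfolding cofaces_filled using sub by auto
      moreover have "insert x (insert y \<kappa>) \<notin> cofaces A (insert z \<kappa>)"
        using rel_cycle_member[OF A] by (auto simp: cofaces_def)
      ultimately show ?thesis using True eqpar finc \<kappa>(1) by simp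
    next
      case False
      then have "cofaces (filled A) (insert z \<kappa>) = cofaces A (insert z \<kappa>)"
        unfolding cofaces_filled using sub by auto
      then show ?thesis using False eqpar by simp
    qed
  qed
  consider "x \<in> \<rho>" "y \<in> \<rho>" | "x \<in> \<rho>" "y \<notin> \<rho>" | "x \<notin> \<rho>" "y \<in> \<rho>" | "x \<notin> \<rho>" "y \<notin> \<rho>" by blast
  then show "even (card (cofaces (filled A) \<rho>))"
  proof cases
    case 1
    define \<mu> where "\<mu> = \<rho> - {x, y}"
    have \<mu>: "\<rho> = insert x (insert y \<mu>)" "x \<notin> \<mu>" "y \<notin> \<mu>" "finite \<mu>" using 1 fin\<rho> by (auto simp: \<mu>_def)
    then have c\<mu>: "card \<mu> + 3 = e" using \<rho> xy by simp
    have "cofaces A \<rho> = {}" using 1 rel_cycle_member[OF A] by (auto simp: cofaces_def)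
    moreover have "\<rho> \<subseteq> insert x (insert y \<kappa>) \<longleftrightarrow> \<mu> \<subseteq> \<kappa>" if "\<kappa> \<in> odd_links A" for \<kappa>
      using \<mu> that by (auto simp: odd_links_def)
    ultimately have eq: "cofaces (filled A) \<rho> = (\<lambda>\<kappa>. insert x (insert y \<kappa>)) ` {\<kappa>\<in>odd_links A. \<mu> \<subseteq> \<kappa>}"
      unfolding cofaces_filled by auto
    have "inj_on (\<lambda>\<kappa>. insert x (insert y \<kappa>)) {\<kappa>\<in>odd_links A. \<mu> \<subseteq> \<kappa>}"
      by (rule inj_on_inverseI[where g = "\<lambda>\<sigma>. \<sigma> - {x, y}"]) (auto simp: odd_links_def)
    then show ?thesis unfolding eq using even_odd_links[OF A c\<mu> \<mu>(4,2,3)] by (simp add: card_image)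
  next
    case 2
    then show ?thesis using one[of x "\<rho> - {x}"] by (simp add: insert_absorb)
  next
    case 3
    then show ?thesis using one[of y "\<rho> - {y}"] by (simp add: insert_absorb)
  next
    case 4
    have "\<not> \<rho> \<subseteq> insert x (insert y \<kappa>)" if "\<kappa> \<in> odd_links A" for \<kappa>
    proof
      assume "\<rho> \<subseteq> insert x (insert y \<kappa>)"
      then have "\<rho> \<subseteq> \<kappa>" using 4 by auto
      then have "card \<rho> \<le> card \<kappa>" by (rule card_mono[OF odd_links_finite[OF that]])
      then show False using that \<rho> by (simp add: odd_links_def)
    qed
    then have "cofaces (filled A) \<rho> = cofaces A \<rho>" unfolding cofaces_filled by auto
    then show ?thesis using A 4 \<rho> by (simp add: rel_cycle_def)
  qed
qed

definition contract :: "'v set \<Rightarrow> 'v set" where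
  "contract \<sigma> = (if x \<in> \<sigma> then insert y (\<sigma> - {x}) else \<sigma>)"

text \<open>Injectivity lets the cofaces in the image be counted in \<open>B\<close>. No face of
  \<open>A\<close> contains both \<open>x\<close> and \<open>y\<close>, so above a ridge through
  \<open>y\<close> the two kinds of preimages are disjoint.\<close>

lemma card_cofaces_contract:
  assumes "rel_cycle A" "inj_on contract A" "B \<subseteq> A" "x \<notin> \<rho>"
  shows "card (cofaces (contract ` B) \<rho>) = (if y \<in> \<rho>
    then card (cofaces B (insert x (\<rho> - {y}))) + card (cofaces B \<rho>) else card (cofaces B \<rho>))"
proof -
  have "card (cofaces (contract ` B) \<rho>) = card (contract ` {\<sigma>\<in>B. \<rho> \<subseteq> contract \<sigma>})"
    by (intro arg_cong[where f = card]) (auto simp: cofaces_def)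
  also have "\<dots> = card {\<sigma>\<in>B. \<rho> \<subseteq> contract \<sigma>}"
    using assms(2,3) by (intro card_image) (auto intro: inj_on_subset)
  also have "\<dots> = (if y \<in> \<rho>
    then card (cofaces B (insert x (\<rho> - {y}))) + card (cofaces B \<rho>) else card (cofaces B \<rho>))"
  proof (cases "y \<in> \<rho>")
    case True
    have finB: "finite B" using assms(1,3) by (auto simp: rel_cycle_def intro: finite_subset)
    have "{\<sigma>\<in>B. \<rho> \<subseteq> contract \<sigma>} = cofaces B (insert x (\<rho> - {y})) \<union> cofaces B \<rho>"
      using True assms xy by (auto simp: cofaces_def contract_def rel_cycle_def split: if_splits)
    moreover have "cofaces B (insert x (\<rho> - {y})) \<inter> cofaces B \<rho> = {}"
      using True assms by (auto simp: cofaces_def rel_cycle_def)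
    ultimately show ?thesis using True finB by (simp add: card_Un_disjoint finite_cofaces)
  next
    case False
    then have "{\<sigma>\<in>B. \<rho> \<subseteq> contract \<sigma>} = cofaces B \<rho>"
      using assms(4) by (auto simp: cofaces_def contract_def split: if_splits)
    then show ?thesis using False by simp
  qed
  finally show ?thesis .
qed

lemma card_contract:
  assumes "rel_cycle A" "\<sigma> \<in> A"
  shows "finite (contract \<sigma>)" "card (contract \<sigma>) = e"
proof -
  have "finite \<sigma>" "card \<sigma> = e" "\<not> (x \<in> \<sigma> \<and> y \<in> \<sigma>)" using assms by (auto simp: rel_cycle_def)
  then show "finite (contract \<sigma>)" "card (contract \<sigma>) = e"
    using e by (auto simp: contract_def card_insert_if)
qed

text \<open>The two parity conditions of \<open>rel_cycle\<close> are those of the image at ridges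
  without and with \<open>y\<close>. Hence a minimal relative cycle contracts to a circuit, ready
  for the induction hypothesis.\<close>

lemma mod2_cycle_contract_iff:
  assumes A: "rel_cycle A" and inj: "inj_on contract A" and B: "B \<subseteq> A"
  shows "mod2_cycle e (contract ` B) \<longleftrightarrow> rel_cycle B"
proof -
  note card_co = card_cofaces_contract[OF A inj B]
  have finB: "finite B" using A B by (auto simp: rel_cycle_def intro: finite_subset)
  show ?thesis
  proof
    assume cyc: "mod2_cycle e (contract ` B)"
    then have par: "even (card (cofaces (contract ` B) \<rho>))" if "Suc (card \<rho>) = e" for \<rho>
      using that by (simp add: mod2_cycle_def)
    show "rel_cycle B"
      unfolding rel_cycle_def
    proof (intro conjI allI impI)
      show "\<forall>\<sigma>\<in>B. finite \<sigma> \<and> card \<sigma> = e \<and> \<not> (x \<in> \<sigma> \<and> y \<in> \<sigma>)" using A B by (auto simp: rel_cycle_def)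
      show "even (card (cofaces B \<rho>))" if "Suc (card \<rho>) = e" "x \<notin> \<rho>" "y \<notin> \<rho>" for \<rho>
        using par[OF that(1)] card_co[OF that(2)] that by simp
      fix \<kappa> :: "'v set" assume \<kappa>: "card \<kappa> + 2 = e" "x \<notin> \<kappa>" "y \<notin> \<kappa>"
      have "finite \<kappa>" using \<kappa>(1) e by (intro card_ge_0_finite) linarith
      then have "Suc (card (insert y \<kappa>)) = e" using \<kappa> by simp
      from par[OF this] card_co[of "insert y \<kappa>"]
      show "even (card (cofaces B (insert x \<kappa>)) + card (cofaces B (insert y \<kappa>)))"
        using \<kappa> xy by simp
    qed (rule finB)
  next
    assume rel: "rel_cycle B"
    show "mod2_cycle e (contract ` B)"
      unfolding mod2_cycle_def
    proof (intro conjI allI impI)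
      show "\<forall>\<sigma>\<in>contract ` B. finite \<sigma> \<and> card \<sigma> = e" using card_contract[OF rel] by blast
      fix \<rho> :: "'v set" assume \<rho>: "Suc (card \<rho>) = e"
      have fin\<rho>: "finite \<rho>" using e \<rho> by (intro card_ge_0_finite) linarith
      consider "x \<in> \<rho>" | "x \<notin> \<rho>" "y \<in> \<rho>" | "x \<notin> \<rho>" "y \<notin> \<rho>" by blast
      then show "even (card (cofaces (contract ` B) \<rho>))"
      proof cases
        case 1
        then have "cofaces (contract ` B) \<rho> = {}"
          using xy by (auto simp: cofaces_def contract_def split: if_splits)
        then show ?thesis by simp
      next
        case 2
        have "card (\<rho> - {y}) + 2 = e" using \<rho> e 2 fin\<rho> by simp
        then have "even (card (cofaces B (insert x (\<rho> - {y}))) + card (cofaces B (insert y (\<rho> - {y}))))"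
          using rel 2 unfolding rel_cycle_def by blast
        then show ?thesis using card_co[OF 2(1)] 2 by (simp add: insert_absorb)
      next
        case 3
        then show ?thesis using card_co[OF 3(1)] rel \<rho> by (simp add: rel_cycle_def)
      qed
    qed (use finB in simp)
  qed
qed

text \<open>The contraction identifies the two faces. Such a pair exhausts any minimal relative
  cycle that contains it, and on all other minimal relative cycles \<open>contract\<close> is
  injective.\<close>

lemma rel_cycle_pair:
  assumes "finite \<tau>" "Suc (card \<tau>) = e" "x \<notin> \<tau>" "y \<notin> \<tau>"
  shows "rel_cycle {insert x \<tau>, insert y \<tau>}"
proof -
  have ne: "insert x \<tau> \<noteq> insert y \<tau>" using assms xy by auto
  have sub: "\<rho> \<subseteq> \<tau> \<longleftrightarrow> \<rho> = \<tau>" if "Suc (card \<rho>) = e" for \<rho>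
    using assms that card_subset_eq by (metis order_refl old.nat.inject)
  have "even (card (cofaces {insert x \<tau>, insert y \<tau>} \<rho>))" if "Suc (card \<rho>) = e" "x \<notin> \<rho>" "y \<notin> \<rho>" for \<rho>
  proof -
    have "cofaces {insert x \<tau>, insert y \<tau>} \<rho> = (if \<rho> \<subseteq> \<tau> then {insert x \<tau>, insert y \<tau>} else {})"
      using that by (auto simp: cofaces_def)
    then show ?thesis using ne by simp
  qed
  moreover have "even (card (cofaces {insert x \<tau>, insert y \<tau>} (insert x \<kappa>)) + card (cofaces {insert x \<tau>, insert y \<tau>} (insert y \<kappa>)))"
    if "card \<kappa> + 2 = e" "x \<notin> \<kappa>" "y \<notin> \<kappa>" for \<kappa>
  proof -
    have "cofaces {insert x \<tau>, insert y \<tau>} (insert x \<kappa>) = (if \<kappa> \<subseteq> \<tau> then {insert x \<tau>} else {})"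
      "cofaces {insert x \<tau>, insert y \<tau>} (insert y \<kappa>) = (if \<kappa> \<subseteq> \<tau> then {insert y \<tau>} else {})"
      using that assms xy by (auto simp: cofaces_def)
    then show ?thesis by simp
  qed
  ultimately show ?thesis using assms xy by (auto simp: rel_cycle_def)
qed

end

section \<open>Rigidity and connectedness of the filled pieces\<close>

context edge_contraction
begin

lemma joined_filledI1: "\<sigma> \<in> A \<Longrightarrow> u \<in> \<sigma> \<Longrightarrow> v \<in> \<sigma> \<Longrightarrow> joined (filled A) u v"
  by (auto simp: joined_def filled_def)

lemma joined_filledI2:
  "\<kappa> \<in> odd_links A \<Longrightarrow> u \<in> insert x (insert y \<kappa>) \<Longrightarrow> v \<in> insert x (insert y \<kappa>) \<Longrightarrow> joined (filled A) u v"
  unfolding joined_def filled_def by (intro bexI[of _ "insert x (insert y \<kappa>)"] conjI UnI2 imageI)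

lemma joined_filledE:
  assumes "joined (filled A) u v"
  obtains \<sigma> where "\<sigma> \<in> A" "u \<in> \<sigma>" "v \<in> \<sigma>"
  | \<kappa> where "\<kappa> \<in> odd_links A" "u \<in> insert x (insert y \<kappa>)" "v \<in> insert x (insert y \<kappa>)"
proof -
  obtain \<sigma> where "\<sigma> \<in> A \<union> (\<lambda>\<kappa>. insert x (insert y \<kappa>)) ` odd_links A" "u \<in> \<sigma>" "v \<in> \<sigma>"
    using assms unfolding joined_def filled_def by (elim bexE conjE)
  then show thesis using that by (elim UnE imageE) simp_all
qed

lemma finite_Union_filled:
  assumes "rel_cycle A"
  shows "finite (\<Union>(filled A))"
  using mod2_cycle_filled[OF assms] by (auto simp: mod2_cycle_def)

text \<open>Otherwise \<open>A\<close> would itself be a cycle inside the circuit \<open>C\<close>,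
  and a proper one because it misses \<sigma>0.\<close>

lemma odd_links_nonempty:
  assumes "mod2_circuit e C" "\<sigma>0 \<in> C" "x \<in> \<sigma>0" "y \<in> \<sigma>0" "rel_cycle A" "A \<subseteq> C" "A \<noteq> {}"
  shows "odd_links A \<noteq> {}"
proof
  assume "odd_links A = {}"
  then have "mod2_cycle e A" using mod2_cycle_filled[OF assms(5)] by (simp add: filled_def)
  then have "A = C" using assms(1,6,7) by (simp add: mod2_circuit_def)
  then show False using rel_cycle_member[OF assms(5), of \<sigma>0] assms(2-4) by blast
qed

text \<open>The link of x y is a nonempty cycle of sets of size e - 2, so a member shares a ridge
  with another one and there are at least e - 1 vertices: the number of common neighbours that
  \<open>rigid_vertex_split\<close> asks for. Such a ridge exists because \<open>e\<close> is at
  least 3.\<close>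

lemma card_Union_odd_links:
  assumes A: "rel_cycle A" and ne: "odd_links A \<noteq> {}"
  shows "e \<le> Suc (card (\<Union>(odd_links A)))"
proof -
  obtain \<kappa> where \<kappa>: "\<kappa> \<in> odd_links A" using ne by blast
  have k: "finite \<kappa>" "card \<kappa> + 2 = e" "x \<notin> \<kappa>" "y \<notin> \<kappa>"
    using odd_links_finite[OF \<kappa>] \<kappa> by (auto simp: odd_links_def)
  then obtain a where a: "a \<in> \<kappa>" using e by fastforce
  have "card (\<kappa> - {a}) + 3 = e" using k a e by simp
  then have ev: "even (card {\<kappa>'\<in>odd_links A. \<kappa> - {a} \<subseteq> \<kappa>'})"
    using k by (intro even_odd_links[OF A]) auto
  have "\<exists>\<kappa>'\<in>odd_links A. \<kappa>' \<noteq> \<kappa>"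
  proof (rule ccontr)
    assume "\<not> ?thesis"
    then have "{\<kappa>'\<in>odd_links A. \<kappa> - {a} \<subseteq> \<kappa>'} = {\<kappa>}" using \<kappa> by blast
    with ev show False by simp
  qed
  then obtain \<kappa>' where \<kappa>': "\<kappa>' \<in> odd_links A" "\<kappa>' \<noteq> \<kappa>" by blast
  have fin: "finite (\<Union>(odd_links A))"
    using finite_odd_links[OF A] odd_links_finite by blast
  have "\<kappa> \<subset> \<Union>(odd_links A)"
  proof
    show "\<kappa> \<subseteq> \<Union>(odd_links A)" using \<kappa> by blast
    have "\<not> \<kappa>' \<subseteq> \<kappa>"
      using \<kappa>' k card_subset_eq[OF k(1), of \<kappa>'] by (auto simp: odd_links_def)
    then show "\<kappa> \<noteq> \<Union>(odd_links A)" using \<kappa>'(1) by blast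
  qed
  from psubset_card_mono[OF fin this] show ?thesis using k(2) by linarith
qed

text \<open>If \<open>A\<close> is a pair x \<tau>, y \<tau>, its filling has the complete graph on
  \<open>e + 1\<close> vertices. Otherwise \<open>A\<close> contracts injectively to a circuit
  without \<open>x\<close>, which is rigid by induction, and the filling is a vertex split of it,
  with the vertices of the link of x y as \<open>W\<close>.\<close>

lemma generically_rigid_filled:
  assumes C: "mod2_circuit e C" "\<sigma>0 \<in> C" "x \<in> \<sigma>0" "y \<in> \<sigma>0"
    and A: "rel_cycle A" "A \<subseteq> C" "A \<noteq> {}" "\<And>A'. A' \<subseteq> A \<Longrightarrow> A' \<noteq> {} \<Longrightarrow> rel_cycle A' \<Longrightarrow> A' = A"
    and IH: "\<And>B :: 'v set set. mod2_circuit e B \<Longrightarrow> card (\<Union>B) < card (\<Union>C) \<Longrightarrow> generically_rigid e B"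
  shows "generically_rigid e (filled A)"
proof (cases "\<exists>\<tau>. insert x \<tau> \<in> A \<and> insert y \<tau> \<in> A \<and> x \<notin> \<tau> \<and> y \<notin> \<tau>")
  case True
  then obtain \<tau> where \<tau>: "insert x \<tau> \<in> A" "insert y \<tau> \<in> A" "x \<notin> \<tau>" "y \<notin> \<tau>" by blast
  have fin\<tau>: "finite \<tau>" "Suc (card \<tau>) = e" using rel_cycle_member[OF A(1) \<tau>(1)] \<tau> by auto
  have Aeq: "A = {insert x \<tau>, insert y \<tau>}"
    using A(4)[OF _ _ rel_cycle_pair[OF fin\<tau> \<tau>(3,4)]] \<tau>(1,2) by auto
  \<comment> \<open>Some added face is needed here to join \<open>x\<close> and
    \<open>y\<close>.\<close>
  obtain \<kappa> where \<kappa>: "\<kappa> \<in> odd_links A" using odd_links_nonempty[OF C A(1-3)] by blast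
  define X where "X = insert x (insert y \<tau>)"
  have X: "finite X" "card X = Suc e" using fin\<tau> \<tau> xy by (auto simp: X_def)
  have UA: "\<Union>A \<subseteq> X" by (auto simp: Aeq X_def)
  have sub: "\<Union>(filled A) \<subseteq> X"
    using UA odd_links_vertices[OF A(1)] unfolding filled_def X_def by blast
  have jX: "joined (filled A) u v" if uv: "u \<in> X" "v \<in> X" for u v
  proof -
    consider "u \<in> insert x \<tau>" "v \<in> insert x \<tau>" | "u \<in> insert y \<tau>" "v \<in> insert y \<tau>" | "u \<in> {x, y}" "v \<in> {x, y}"
      using uv unfolding X_def by blast
    then show ?thesis
    proof cases
      case 3
      then show ?thesis by (intro joined_filledI2[OF \<kappa>]) auto
    qed (use joined_filledI1 \<tau>(1,2) in blast)+
  qed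
  obtain f :: "'v \<Rightarrow> nat" where "inj_on f X" using finite_imp_inj_to_nat_seg[OF X(1)] by blast
  then have inj: "inj_on (\<lambda>u. real (f u)) X" by (simp add: inj_on_def)
  have "rigid e (\<lambda>u. real (f u)) (filled A)"
  proof (rule rigid_mono[OF rigid_clique[OF X(1) inj]])
    show "joined (filled A) u v" if "joined {X} u v" for u v using that jX by (auto simp: joined_def)
  qed (use X sub in auto)
  then show ?thesis using inj_on_subset[OF inj sub] unfolding generically_rigid_def by blast
next
  case False
  have inj: "inj_on contract A"
  proof (rule inj_onI)
    fix \<sigma> \<sigma>' assume s: "\<sigma> \<in> A" "\<sigma>' \<in> A" "contract \<sigma> = contract \<sigma>'"
    have nb: "\<not> (x \<in> \<sigma> \<and> y \<in> \<sigma>)" "\<not> (x \<in> \<sigma>' \<and> y \<in> \<sigma>')" using rel_cycle_member[OF A(1)] s by blast+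
    consider "x \<in> \<sigma> \<longleftrightarrow> x \<in> \<sigma>'" | "x \<in> \<sigma>" "x \<notin> \<sigma>'" | "x \<notin> \<sigma>" "x \<in> \<sigma>'" by blast
    then show "\<sigma> = \<sigma>'"
    proof cases
      case 1
      then show ?thesis using s(3) nb by (auto simp: contract_def split: if_splits)
    next
      case 2
      then have "\<sigma>' = insert y (\<sigma> - {x})" using s(3) by (simp add: contract_def)
      moreover have "insert x (\<sigma> - {x}) = \<sigma>" using 2 by blast
      ultimately have "insert x (\<sigma> - {x}) \<in> A \<and> insert y (\<sigma> - {x}) \<in> A \<and> x \<notin> \<sigma> - {x} \<and> y \<notin> \<sigma> - {x}"
        using s nb 2 by simp
      with False show ?thesis by blast
    next
      case 3
      then have "\<sigma> = insert y (\<sigma>' - {x})" using s(3) by (simp add: contract_def)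
      moreover have "insert x (\<sigma>' - {x}) = \<sigma>'" using 3 by blast
      ultimately have "insert x (\<sigma>' - {x}) \<in> A \<and> insert y (\<sigma>' - {x}) \<in> A \<and> x \<notin> \<sigma>' - {x} \<and> y \<notin> \<sigma>' - {x}"
        using s nb 3 by simp
      with False show ?thesis by blast
    qed
  qed
  define C' where "C' = contract ` A"
  have "mod2_circuit e C'"
    unfolding mod2_circuit_def
  proof (intro conjI allI impI)
    show "mod2_cycle e C'" unfolding C'_def using mod2_cycle_contract_iff[OF A(1) inj] A(1) by blast
    show "C' \<noteq> {}" using A(3) by (simp add: C'_def)
    fix B assume B: "B \<subseteq> C'" "B \<noteq> {}" "mod2_cycle e B"
    then obtain A' where A': "A' \<subseteq> A" "B = contract ` A'" unfolding C'_def by (meson subset_imageE)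
    then have "rel_cycle A'" using mod2_cycle_contract_iff[OF A(1) inj A'(1)] B(3) by blast
    then have "A' = A" using A(4) A' B(2) by blast
    then show "B = C'" using A' by (simp add: C'_def)
  qed
  have xC': "x \<notin> \<Union>C'" using xy by (auto simp: C'_def contract_def split: if_splits)
  have finC: "finite (\<Union>C)" using C(1) by (auto simp: mod2_circuit_def mod2_cycle_def)
  \<comment> \<open>The contraction loses the vertex \<open>x\<close>; this is the decrease that
    drives the induction.\<close>
  have "\<Union>C' \<subset> \<Union>C"
  proof
    show "\<Union>C' \<subseteq> \<Union>C" using A(2) C(2,4) by (auto simp: C'_def contract_def split: if_splits)
    show "\<Union>C' \<noteq> \<Union>C" using xC' C(2,3) by blast
  qed
  then have finC': "finite (\<Union>C')" and "card (\<Union>C') < card (\<Union>C)"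
    using finC by (auto intro: finite_subset psubset_card_mono)
  then obtain t where t: "inj_on t (\<Union>C')" "rigid e t C'"
    using IH[OF \<open>mod2_circuit e C'\<close>] unfolding generically_rigid_def by blast
  have ne: "odd_links A \<noteq> {}" by (rule odd_links_nonempty[OF C A(1-3)])
  obtain \<kappa> where \<kappa>: "\<kappa> \<in> odd_links A" using ne by blast
  have AC': "u \<in> \<Union>C'" if "\<sigma> \<in> A" "u \<in> \<sigma>" "u \<noteq> x" for u \<sigma>
  proof -
    have "u \<in> contract \<sigma>" using that by (auto simp: contract_def)
    then show ?thesis using that(1) by (auto simp: C'_def)
  qed
  have odd_C': "u \<in> \<Union>C'" if \<kappa>': "\<kappa>' \<in> odd_links A" "u \<in> insert y \<kappa>'" for u \<kappa>'
  proof -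
    obtain \<sigma> where \<sigma>: "\<sigma> \<in> A" "insert y \<kappa>' \<subseteq> \<sigma>" using odd_links_coface[OF A(1) \<kappa>'(1), of y] by blast
    have "x \<notin> \<sigma>" using rel_cycle_member[OF A(1) \<sigma>(1)] \<sigma>(2) by blast
    moreover have "u \<in> \<sigma>" using \<sigma>(2) \<kappa>'(2) by blast
    ultimately show ?thesis by (intro AC'[OF \<sigma>(1)]) auto
  qed
  obtain S where S: "S \<in> A" using A(3) by blast
  show ?thesis
  proof (rule rigid_vertex_split[OF t(2) finC' t(1), of y x "filled A" "\<Union>(odd_links A)" S])
    show "y \<in> \<Union>C'" using odd_C'[OF \<kappa>] by simp
    show "x \<notin> \<Union>C'" by (rule xC')
    show "\<Union>(filled A) = insert x (\<Union>C')"
    proof (intro equalityI subsetI)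
      fix u assume "u \<in> \<Union>(filled A)"
      then obtain \<sigma> where "\<sigma> \<in> A \<union> (\<lambda>\<kappa>. insert x (insert y \<kappa>)) ` odd_links A" and u: "u \<in> \<sigma>"
        unfolding filled_def by (elim UnionE)
      then show "u \<in> insert x (\<Union>C')"
      proof (elim UnE imageE)
        assume "\<sigma> \<in> A"
        then show ?thesis using AC'[of \<sigma> u] u by (cases "u = x") simp_all
      next
        fix \<kappa>' assume "\<kappa>' \<in> odd_links A" "\<sigma> = insert x (insert y \<kappa>')"
        then show ?thesis using odd_C'[of \<kappa>' u] u by (cases "u = x") simp_all
      qed
    next
      fix u assume "u \<in> insert x (\<Union>C')"
      then consider "u \<in> {x, y}" | \<sigma> where "\<sigma> \<in> A" "u \<in> \<sigma>"
        by (auto simp: C'_def contract_def split: if_splits)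
      then show "u \<in> \<Union>(filled A)"
      proof cases
        case 1
        then have "joined (filled A) u u" by (intro joined_filledI2[OF \<kappa>]) auto
        then show ?thesis by (simp only: joined_refl)
      next
        case 2
        then show ?thesis unfolding filled_def by blast
      qed
    qed
    show "joined (filled A) u v" if uv: "joined C' u v" "u \<noteq> y" "v \<noteq> y" for u v
    proof -
      obtain \<sigma> where \<sigma>: "\<sigma> \<in> A" "u \<in> contract \<sigma>" "v \<in> contract \<sigma>" using uv(1) by (auto simp: joined_def C'_def)
      then have "u \<in> \<sigma>" "v \<in> \<sigma>" using uv by (auto simp: contract_def split: if_splits)
      then show ?thesis by (rule joined_filledI1[OF \<sigma>(1)])
    qed
    show "joined (filled A) u y \<or> joined (filled A) u x" if uy: "joined C' u y" "u \<noteq> y" for u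
    proof -
      obtain \<sigma> where \<sigma>: "\<sigma> \<in> A" "u \<in> contract \<sigma>" "y \<in> contract \<sigma>" using uy(1) by (auto simp: joined_def C'_def)
      have "u \<in> \<sigma>" using \<sigma> uy by (auto simp: contract_def split: if_splits)
      moreover have "x \<in> \<sigma> \<or> y \<in> \<sigma>" using \<sigma> by (auto simp: contract_def split: if_splits)
      ultimately show ?thesis using joined_filledI1[OF \<sigma>(1)] by blast
    qed
    show "joined (filled A) x y" by (intro joined_filledI2[OF \<kappa>]) auto
    show "\<Union>(odd_links A) \<subseteq> \<Union>C' - {y}"
    proof
      fix u assume "u \<in> \<Union>(odd_links A)"
      then obtain \<kappa>' where "\<kappa>' \<in> odd_links A" "u \<in> \<kappa>'" by blast
      then show "u \<in> \<Union>C' - {y}" using odd_C'[of \<kappa>' u] by (auto simp: odd_links_def)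
    qed
    show "e \<le> Suc (card (\<Union>(odd_links A)))" by (rule card_Union_odd_links[OF A(1) ne])
    show "joined (filled A) x w \<and> joined (filled A) y w" if "w \<in> \<Union>(odd_links A)" for w
      using that joined_filledI2 by blast
    show "joined (filled A) u v" if "u \<in> S" "v \<in> S" for u v using that by (rule joined_filledI1[OF S])
    show "card S = e" "\<not> (x \<in> S \<and> y \<in> S)" using rel_cycle_member[OF A(1) S] by blast+
  qed
qed

text \<open>If no filled piece of \<open>\<B>\<close> shared a face with one outside, an odd link
  face of the union of \<open>\<B>\<close> would be even for the rest and so odd for the whole.
  Filling the union of \<open>\<B>\<close> would then give a cycle inside \<open>C\<close> that
  misses the faces of the other pieces, against minimality.\<close>

lemma filled_pieces_connected:
  assumes C: "mod2_circuit e C" "\<sigma>0 \<in> C" "x \<in> \<sigma>0" "y \<in> \<sigma>0"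
    and \<A>: "\<Union>\<A> = {\<sigma>\<in>C. \<not> (x \<in> \<sigma> \<and> y \<in> \<sigma>)}" "disjoint \<A>" "\<And>A. A \<in> \<A> \<Longrightarrow> rel_cycle A \<and> A \<noteq> {}"
    and D: "rel_cycle (\<Union>\<A>)" "filled (\<Union>\<A>) = C"
    and \<B>: "\<B> \<subseteq> \<A>" "\<B> \<noteq> {}" "\<B> \<noteq> \<A>"
  obtains A A' where "A \<in> \<B>" "A' \<in> \<A> - \<B>" "filled A \<inter> filled A' \<noteq> {}"
proof (rule ccontr)
  assume contra: "\<not> thesis"
  have fin\<A>: "finite \<A>" using rel_cycle_finite[OF D(1)] by (rule finite_UnionD)
  have B: "rel_cycle (\<Union>\<B>)"
    using \<B>(1) fin\<A> \<A>(2,3) by (intro rel_cycle_Union) (auto intro: finite_subset simp: disjoint_def)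
  have compl: "\<Union>\<A> - \<Union>\<B> = \<Union>(\<A> - \<B>)" using \<A>(2) \<B>(1) by (fastforce simp: disjoint_def)
  have "odd_links (\<Union>\<B>) \<subseteq> odd_links (\<Union>\<A>)"
  proof
    fix \<kappa> assume \<kappa>: "\<kappa> \<in> odd_links (\<Union>\<B>)"
    obtain A where A: "A \<in> \<B>" "odd (card (cofaces A (insert x \<kappa>)))"
    proof (rule odd_cofaces_Union[of \<B> "insert x \<kappa>"])
      show "disjoint \<B>" using \<A>(2) \<B>(1) by (auto simp: disjoint_def)
      show "odd (card (cofaces (\<Union>\<B>) (insert x \<kappa>)))" using \<kappa> by (simp add: odd_links_def)
    qed (use \<B>(1) fin\<A> \<A>(3) rel_cycle_finite in \<open>auto intro: finite_subset\<close>)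
    then have "\<kappa> \<in> odd_links A" using \<kappa> by (simp add: odd_links_def)
    then have fA: "insert x (insert y \<kappa>) \<in> filled A" by (simp add: filled_def)
    have "even (card (cofaces (\<Union>\<A> - \<Union>\<B>) (insert x \<kappa>)))"
    proof (rule ccontr)
      assume odd: "odd (card (cofaces (\<Union>\<A> - \<Union>\<B>) (insert x \<kappa>)))"
      obtain A' where A': "A' \<in> \<A> - \<B>" "odd (card (cofaces A' (insert x \<kappa>)))"
      proof (rule odd_cofaces_Union[of "\<A> - \<B>" "insert x \<kappa>"])
        show "disjoint (\<A> - \<B>)" using \<A>(2) by (auto simp: disjoint_def)
        show "odd (card (cofaces (\<Union>(\<A> - \<B>)) (insert x \<kappa>)))" using odd by (simp add: compl)
      qed (use fin\<A> \<A>(3) rel_cycle_finite in auto)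
      then have "\<kappa> \<in> odd_links A'" using \<kappa> by (simp add: odd_links_def)
      then have "insert x (insert y \<kappa>) \<in> filled A'" by (simp add: filled_def)
      with fA A(1) A'(1) contra that show False by blast
    qed
    moreover have "card (cofaces (\<Union>\<A>) (insert x \<kappa>))
        = card (cofaces (\<Union>\<B>) (insert x \<kappa>)) + card (cofaces (\<Union>\<A> - \<Union>\<B>) (insert x \<kappa>))"
      using rel_cycle_finite[OF D(1)] \<B>(1) by (intro card_cofaces_Diff) auto
    ultimately show "\<kappa> \<in> odd_links (\<Union>\<A>)" using \<kappa> by (simp add: odd_links_def)
  qed
  then have "filled (\<Union>\<B>) \<subseteq> filled (\<Union>\<A>)" using \<B>(1) unfolding filled_def by blast
  moreover obtain A0 where A0: "A0 \<in> \<B>" using \<B>(2) by blast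
  then have "filled (\<Union>\<B>) \<noteq> {}" using \<A>(3)[of A0] \<B>(1) unfolding filled_def by blast
  ultimately have "filled (\<Union>\<B>) = C"
    using C(1) mod2_cycle_filled[OF B] unfolding D(2) mod2_circuit_def by blast
  moreover obtain A1 where A1: "A1 \<in> \<A> - \<B>" using \<B> by blast
  then obtain \<sigma> where \<sigma>: "\<sigma> \<in> A1" using \<A>(3)[of A1] by blast
  then have "\<sigma> \<in> \<Union>\<A> - \<Union>\<B>" using A1 compl by blast
  moreover from this have "\<not> (x \<in> \<sigma> \<and> y \<in> \<sigma>)" "\<sigma> \<in> C" using \<A>(1) by auto
  ultimately show False unfolding filled_def by blast
qed

end

text \<open>Fogelsanger's decomposition: contracting an edge \<open>x y\<close> splits \<open>C\<close> into smaller circuits; each of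
  them is filled up with faces through \<open>x y\<close> and un-contracted by a vertex split, and the resulting
  rigid pieces of \<open>C\<close> hang together along common facets.\<close>

theorem generically_rigid_mod2_circuit:
  assumes "3 \<le> e" "mod2_circuit e C"
  shows "generically_rigid e C"
  using assms(2)
proof (induction "card (\<Union>C)" arbitrary: C rule: less_induct)
  case less
  have cyc: "mod2_cycle e C" "C \<noteq> {}" using less.prems by (auto simp: mod2_circuit_def)
  have finC: "finite C" "\<And>\<sigma>. \<sigma> \<in> C \<Longrightarrow> finite \<sigma> \<and> card \<sigma> = e" using cyc(1) by (auto simp: mod2_cycle_def)
  then have finU: "finite (\<Union>C)" by blast
  obtain \<sigma>0 where \<sigma>0: "\<sigma>0 \<in> C" using cyc(2) by blast
  then have "\<not> card \<sigma>0 \<le> Suc 0" using finC(2) assms(1) by force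
  then obtain x y where xy0: "x \<in> \<sigma>0" "y \<in> \<sigma>0" and xy_ne: "x \<noteq> y"
    using finC(2)[OF \<sigma>0] by (auto simp: card_le_Suc0_iff_eq)
  interpret edge_contraction e x y using assms(1) xy_ne by unfold_locales
  define D where "D = {\<sigma>\<in>C. \<not> (x \<in> \<sigma> \<and> y \<in> \<sigma>)}"
  have DC: "D \<subseteq> C" by (auto simp: D_def)
  \<comment> \<open>A ridge with just one of \<open>x\<close> and \<open>y\<close> lies in at most
    one face through the edge, so the parity of its cofaces in \<open>D\<close> decides whether that
    face belongs to \<open>C\<close>.\<close>
  have CD: "cofaces (C - D) \<rho> = (if insert x (insert y \<rho>) \<in> C then {insert x (insert y \<rho>)} else {})"
    if \<rho>: "Suc (card \<rho>) = e" "card (\<rho> \<inter> {x, y}) = 1" for \<rho>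
  proof -
    have fin\<rho>: "finite \<rho>" using \<rho>(1) assms(1) by (intro card_ge_0_finite) linarith
    have "(x \<in> \<rho> \<and> y \<notin> \<rho>) \<or> (x \<notin> \<rho> \<and> y \<in> \<rho>)"
    proof (rule ccontr)
      assume "\<not> ?thesis"
      then have "\<rho> \<inter> {x, y} = {} \<or> \<rho> \<inter> {x, y} = {x, y}" by blast
      then show False using \<rho>(2) xy_ne by auto
    qed
    then have "(insert x (insert y \<rho>) = insert y \<rho> \<and> y \<notin> \<rho>) \<or> (insert x (insert y \<rho>) = insert x \<rho> \<and> x \<notin> \<rho>)"
      by blast
    then have c: "card (insert x (insert y \<rho>)) = e" using \<rho>(1) fin\<rho> by auto
    have "\<sigma> = insert x (insert y \<rho>)" if "\<sigma> \<in> C" "x \<in> \<sigma>" "y \<in> \<sigma>" "\<rho> \<subseteq> \<sigma>" for \<sigma>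
    proof (rule card_subset_eq[symmetric])
      show "insert x (insert y \<rho>) \<subseteq> \<sigma>" using that by blast
    qed (use finC(2)[OF that(1)] c in auto)
    moreover have "cofaces (C - D) \<rho> = {\<sigma>\<in>C. x \<in> \<sigma> \<and> y \<in> \<sigma> \<and> \<rho> \<subseteq> \<sigma>}"
      by (auto simp: cofaces_def D_def)
    ultimately have "cofaces (C - D) \<rho> \<subseteq> {insert x (insert y \<rho>)}" by blast
    moreover have "insert x (insert y \<rho>) \<in> cofaces (C - D) \<rho> \<longleftrightarrow> insert x (insert y \<rho>) \<in> C"
      by (auto simp: cofaces_def D_def)
    ultimately show ?thesis by (auto split: if_splits)
  qed
  have split: "card (cofaces C \<rho>) = card (cofaces D \<rho>) + card (cofaces (C - D) \<rho>)" for \<rho>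
    by (rule card_cofaces_Diff[OF finC(1) DC])
  have evenC: "even (card (cofaces C \<rho>))" if "Suc (card \<rho>) = e" for \<rho>
    using cyc(1) that by (simp add: mod2_cycle_def)
  have link_iff: "odd (card (cofaces D (insert z \<kappa>))) \<longleftrightarrow> insert x (insert y \<kappa>) \<in> C"
    if "card \<kappa> + 2 = e" "x \<notin> \<kappa>" "y \<notin> \<kappa>" "z \<in> {x, y}" for z \<kappa>
  proof -
    have "finite \<kappa>" using that(1) assms(1) by (intro card_ge_0_finite) linarith
    moreover have "z \<notin> \<kappa>" using that by blast
    ultimately have "Suc (card (insert z \<kappa>)) = e" using that(1) by simp
    moreover have "insert z \<kappa> \<inter> {x, y} = {z}" using that by auto
    moreover have "insert x (insert y (insert z \<kappa>)) = insert x (insert y \<kappa>)" using that by auto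
    ultimately show ?thesis
      using CD[of "insert z \<kappa>"] split[of "insert z \<kappa>"] evenC[of "insert z \<kappa>"] by (auto split: if_splits)
  qed
  have relD: "rel_cycle D"
    unfolding rel_cycle_def
  proof (intro conjI allI impI)
    show "finite D" using finC(1) DC finite_subset by blast
    show "\<forall>\<sigma>\<in>D. finite \<sigma> \<and> card \<sigma> = e \<and> \<not> (x \<in> \<sigma> \<and> y \<in> \<sigma>)" using finC(2) by (auto simp: D_def)
    show "even (card (cofaces D \<rho>))" if \<rho>: "Suc (card \<rho>) = e" "x \<notin> \<rho>" "y \<notin> \<rho>" for \<rho>
    proof -
      have "\<not> \<rho> \<subseteq> \<sigma>" if "\<sigma> \<in> C - D" for \<sigma>
      proof
        assume "\<rho> \<subseteq> \<sigma>"
        have fin\<rho>: "finite \<rho>" using \<rho>(1) assms(1) by (intro card_ge_0_finite) linarith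
        have "insert x (insert y \<rho>) \<subseteq> \<sigma>" "\<sigma> \<in> C" using \<open>\<rho> \<subseteq> \<sigma>\<close> that by (auto simp: D_def)
        then have "card (insert x (insert y \<rho>)) \<le> e" using finC(2)[of \<sigma>] card_mono by blast
        then show False using \<rho> fin\<rho> xy_ne by simp
      qed
      then have "cofaces (C - D) \<rho> = {}" by (auto simp: cofaces_def)
      then show ?thesis using split[of \<rho>] evenC[OF \<rho>(1)] by simp
    qed
    show "even (card (cofaces D (insert x \<kappa>)) + card (cofaces D (insert y \<kappa>)))"
      if "card \<kappa> + 2 = e" "x \<notin> \<kappa>" "y \<notin> \<kappa>" for \<kappa>
      using link_iff[OF that, of x] link_iff[OF that, of y] unfolding even_add by blast
  qed
  have fillD: "filled D = C"
  proof (intro equalityI subsetI)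
    fix \<sigma> assume "\<sigma> \<in> filled D"
    then show "\<sigma> \<in> C" using DC link_iff[of _ x] by (auto simp: filled_def odd_links_def)
  next
    fix \<sigma> assume \<sigma>: "\<sigma> \<in> C"
    show "\<sigma> \<in> filled D"
    proof (cases "\<sigma> \<in> D")
      case False
      define \<kappa> where "\<kappa> = \<sigma> - {x, y}"
      have "x \<in> \<sigma>" "y \<in> \<sigma>" using False \<sigma> by (auto simp: D_def)
      then have eq: "\<sigma> = insert x (insert y \<kappa>)" "x \<notin> \<kappa>" "y \<notin> \<kappa>" by (auto simp: \<kappa>_def)
      have "finite \<kappa>" using finC(2)[OF \<sigma>] by (simp add: \<kappa>_def)
      then have "card \<kappa> + 2 = e" using finC(2)[OF \<sigma>] eq xy_ne by auto
      then have "\<kappa> \<in> odd_links D" using link_iff[of \<kappa> x] eq \<sigma> by (simp add: odd_links_def)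
      then show ?thesis using eq(1) by (auto simp: filled_def)
    qed (simp add: filled_def)
  qed
  obtain \<A> where \<A>: "\<Union>\<A> = D" "disjoint \<A>"
    "\<forall>A\<in>\<A>. A \<noteq> {} \<and> rel_cycle A \<and> (\<forall>A'. A' \<subseteq> A \<longrightarrow> A' \<noteq> {} \<longrightarrow> rel_cycle A' \<longrightarrow> A' = A)"
    using exists_minimal_partition[OF rel_cycle_finite[OF relD], of rel_cycle] relD rel_cycle_Diff by auto
  have relA: "rel_cycle A" "A \<noteq> {}" "A \<subseteq> C" if "A \<in> \<A>" for A using \<A> that DC by auto
  have minA: "A' = A" if "A \<in> \<A>" "A' \<subseteq> A" "A' \<noteq> {}" "rel_cycle A'" for A A' using \<A>(3) that by blast
  have fin\<A>: "finite \<A>" using rel_cycle_finite[OF relD] unfolding \<A>(1)[symmetric] by (rule finite_UnionD)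
  \<comment> \<open>So far each piece is rigid for a placement of its own; gluing needs a common
    one.\<close>
  have "\<exists>t. inj_on t (\<Union>C) \<and> (\<forall>P\<in>filled ` \<A>. inj_on t (\<Union>P) \<and> rigid e t P)"
  proof (rule generically_rigid_common)
    show "finite (filled ` \<A>)" using fin\<A> by simp
    show "finite (\<Union>C)" by (rule finU)
    fix P assume "P \<in> filled ` \<A>"
    then obtain A where A: "A \<in> \<A>" "P = filled A" by blast
    show "generically_rigid e P"
      unfolding A(2)
      by (rule generically_rigid_filled[OF less.prems \<sigma>0 xy0 relA(1)[OF A(1)] relA(3)[OF A(1)] relA(2)[OF A(1)]
          minA[OF A(1)] less.hyps])
    show "finite (\<Union>P)" unfolding A(2) by (rule finite_Union_filled[OF relA(1)[OF A(1)]])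
    obtain S where S: "S \<in> A" using relA(2)[OF A(1)] by blast
    then show "\<exists>S. card S = e \<and> (\<forall>u\<in>S. \<forall>v\<in>S. joined P u v)"
      unfolding A(2) using rel_cycle_member[OF relA(1)[OF A(1)] S] joined_filledI1[OF S] by (intro exI[of _ S]) auto
  qed
  then obtain t where t: "inj_on t (\<Union>C)" "\<And>A. A \<in> \<A> \<Longrightarrow> inj_on t (\<Union>(filled A)) \<and> rigid e t (filled A)"
    by auto
  have ne: "\<A> \<noteq> {}"
  proof
    assume "\<A> = {}"
    then have "D = {}" using \<A>(1) by simp
    then have "C = (\<lambda>\<kappa>. insert x (insert y \<kappa>)) ` odd_links {}" using fillD by (simp add: filled_def)
    then show False using cyc(2) by (simp add: odd_links_def cofaces_def)
  qed
  \<comment> \<open>A maximal rigid subfamily must be everything: otherwise it shares a face, and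
    thus \<open>e\<close> vertices, with a further piece.\<close>
  define M where "M = {\<B>. \<B> \<subseteq> \<A> \<and> \<B> \<noteq> {} \<and> rigid e t (\<Union>(filled ` \<B>))}"
  obtain A0 where A0: "A0 \<in> \<A>" using ne by blast
  then have "{A0} \<in> M" using t(2)[OF A0] by (simp add: M_def)
  moreover have "finite M" using fin\<A> by (simp add: M_def)
  ultimately obtain \<B> where \<B>: "\<B> \<in> M" "\<And>\<B>'. \<B>' \<in> M \<Longrightarrow> \<B> \<subseteq> \<B>' \<Longrightarrow> \<B> = \<B>'"
    using finite_has_maximal[of M] by blast
  have "\<B> = \<A>"
  proof (rule ccontr)
    assume neq: "\<B> \<noteq> \<A>"
    have \<B>': "\<B> \<subseteq> \<A>" "\<B> \<noteq> {}" "rigid e t (\<Union>(filled ` \<B>))" using \<B>(1) by (auto simp: M_def)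
    obtain A A' where AA': "A \<in> \<B>" "A' \<in> \<A> - \<B>" "filled A \<inter> filled A' \<noteq> {}"
    proof (rule filled_pieces_connected[OF less.prems \<sigma>0 xy0, of \<A> \<B>])
      show "\<Union>\<A> = {\<sigma>\<in>C. \<not> (x \<in> \<sigma> \<and> y \<in> \<sigma>)}" using \<A>(1) by (simp add: D_def)
      show "rel_cycle (\<Union>\<A>)" "filled (\<Union>\<A>) = C" using relD fillD \<A>(1) by simp_all
      show "rel_cycle A \<and> A \<noteq> {}" if "A \<in> \<A>" for A using relA[OF that] by blast
    qed (use \<A>(2) \<B>' neq in auto)
    then obtain \<sigma> where \<sigma>: "\<sigma> \<in> filled A" "\<sigma> \<in> filled A'" by blast
    have A'\<A>: "A' \<in> \<A>" using AA' by blast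
    have \<sigma>': "finite \<sigma>" "card \<sigma> = e" using mod2_cycle_filled[OF relA(1)[OF A'\<A>]] \<sigma>(2) by (auto simp: mod2_cycle_def)
    have "rigid e t (\<Union>(filled ` \<B>) \<union> filled A')"
    proof (rule rigid_Un[OF \<B>'(3)])
      show "rigid e t (filled A')" using t(2)[OF A'\<A>] by blast
      show "\<sigma> \<subseteq> \<Union>(\<Union>(filled ` \<B>))" "\<sigma> \<subseteq> \<Union>(filled A')" using \<sigma> AA'(1) by blast+
      show "inj_on t \<sigma>" using t(2)[OF A'\<A>] \<sigma>(2) by (blast intro: inj_on_subset)
    qed (use \<sigma>' in auto)
    then have "insert A' \<B> \<in> M" using \<B>' A'\<A> by (simp add: M_def Un_commute)
    with \<B>(2)[of "insert A' \<B>"] AA'(2) show False by blast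
  qed
  then have rig: "rigid e t (\<Union>(filled ` \<A>))" using \<B>(1) by (simp add: M_def)
  have "rigid e t C"
  proof (rule rigid_mono[OF rig])
    \<comment> \<open>The added faces of a piece may lie outside \<open>C\<close>, but their edges
      are edges of \<open>C\<close>: x \<kappa> and y \<kappa> are contained in faces of
      \<open>A\<close>, and x y in \<sigma>0.\<close>
    fix u v assume "joined (\<Union>(filled ` \<A>)) u v"
    then obtain A where A: "A \<in> \<A>" "joined (filled A) u v" unfolding joined_def by blast
    from A(2) show "joined C u v"
    proof (cases rule: joined_filledE)
      case (1 \<sigma>)
      then show ?thesis using relA(3)[OF A(1)] by (auto simp: joined_def)
    next
      case (2 \<kappa>)
      obtain \<sigma>1 where \<sigma>1: "\<sigma>1 \<in> A" "insert x \<kappa> \<subseteq> \<sigma>1"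
        by (rule odd_links_coface[OF relA(1)[OF A(1)] 2(1), of x]) simp_all
      obtain \<sigma>2 where \<sigma>2: "\<sigma>2 \<in> A" "insert y \<kappa> \<subseteq> \<sigma>2"
        by (rule odd_links_coface[OF relA(1)[OF A(1)] 2(1), of y]) simp_all
      have inC: "\<sigma>1 \<in> C" "\<sigma>2 \<in> C" using subsetD[OF relA(3)[OF A(1)]] \<sigma>1(1) \<sigma>2(1) by simp_all
      consider "u \<in> insert x \<kappa>" "v \<in> insert x \<kappa>" | "u \<in> insert y \<kappa>" "v \<in> insert y \<kappa>" | "u \<in> {x, y}" "v \<in> {x, y}"
        using 2(2,3) by fast
      then show ?thesis
      proof cases
        case 1
        then have "u \<in> \<sigma>1" "v \<in> \<sigma>1" using \<sigma>1(2) by blast+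
        then show ?thesis using inC(1) unfolding joined_def by blast
      next
        case 2
        then have "u \<in> \<sigma>2" "v \<in> \<sigma>2" using \<sigma>2(2) by blast+
        then show ?thesis using inC(2) unfolding joined_def by blast
      next
        case 3
        then have "u \<in> \<sigma>0" "v \<in> \<sigma>0" using xy0 by blast+
        then show ?thesis using \<sigma>0 unfolding joined_def by blast
      qed
    qed
  next
    show "\<Union>C \<subseteq> \<Union>(\<Union>(filled ` \<A>))"
    proof
      fix u assume "u \<in> \<Union>C"
      then obtain \<sigma> where \<sigma>: "\<sigma> \<in> C" "u \<in> \<sigma>" by blast
      have "\<exists>A\<in>\<A>. \<sigma> \<in> filled A"
      proof (cases "\<sigma> \<in> D")
        case True
        then obtain A where "A \<in> \<A>" "\<sigma> \<in> A" unfolding \<A>(1)[symmetric] by (elim UnionE)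
        then show ?thesis by (auto simp: filled_def)
      next
        case False
        then obtain \<kappa> where \<kappa>: "\<kappa> \<in> odd_links D" "\<sigma> = insert x (insert y \<kappa>)"
          using \<sigma>(1) unfolding fillD[symmetric] filled_def by (elim UnE imageE) simp_all
        obtain A where A: "A \<in> \<A>" "odd (card (cofaces A (insert x \<kappa>)))"
        proof (rule odd_cofaces_Union[OF fin\<A> _ \<A>(2), of "insert x \<kappa>"])
          show "odd (card (cofaces (\<Union>\<A>) (insert x \<kappa>)))" using \<kappa>(1) by (simp add: \<A>(1) odd_links_def)
        qed (use relA(1) rel_cycle_finite in auto)
        then have "\<kappa> \<in> odd_links A" using \<kappa>(1) by (simp add: odd_links_def)
        then have "\<sigma> \<in> filled A" by (simp add: \<kappa>(2) filled_def)
        with A(1) show ?thesis by blast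
      qed
      then show "u \<in> \<Union>(\<Union>(filled ` \<A>))" using \<sigma>(2) by blast
    qed
  qed
  with t(1) show ?case unfolding generically_rigid_def by blast
qed

section \<open>Normal pseudomanifolds\<close>

text \<open>What the rigidity argument keeps of a homology manifold: purity, two facets at each
  ridge, connected graphs of the links of positive dimension. The whole complex, the link of the
  empty face, is a separate assumption because its connectedness comes from the realization.\<close>

locale normal_pseudomanifold =
  fixes \<Delta> :: "'a::linorder set set" and d :: nat
  assumes complex: "abstract_complex \<Delta>"
    and d: "4 \<le> d"
    and in_facet: "\<And>\<rho>. \<rho> \<in> \<Delta> \<Longrightarrow> \<exists>\<sigma>\<in>\<Delta>. \<rho> \<subseteq> \<sigma> \<and> card \<sigma> = d"
    and two_facets: "\<And>\<rho>. \<rho> \<in> \<Delta> \<Longrightarrow> Suc (card \<rho>) = d \<Longrightarrow> card {\<sigma>\<in>\<Delta>. card \<sigma> = d \<and> \<rho> \<subseteq> \<sigma>} = 2"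
    and link_connected: "\<And>\<rho> u v. \<rho> \<in> \<Delta> \<Longrightarrow> \<rho> \<noteq> {} \<Longrightarrow> card \<rho> + 2 \<le> d \<Longrightarrow>
      {u} \<in> link \<Delta> \<rho> \<Longrightarrow> {v} \<in> link \<Delta> \<rho> \<Longrightarrow> (u, v) \<in> {(a, b). {a, b} \<in> link \<Delta> \<rho>}\<^sup>*"
    and graph_connected: "\<And>u v. {u} \<in> \<Delta> \<Longrightarrow> {v} \<in> \<Delta> \<Longrightarrow> (u, v) \<in> {(a, b). {a, b} \<in> \<Delta>}\<^sup>*"
begin

definition facets_at :: "'a set \<Rightarrow> 'a set set" where
  "facets_at \<rho> = {\<sigma>\<in>\<Delta>. card \<sigma> = d \<and> \<rho> \<subseteq> \<sigma>}"

lemma finite_complex: "finite \<Delta>"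
  using complex by (simp add: abstract_complex_def)

lemma finite_face: "\<sigma> \<in> \<Delta> \<Longrightarrow> finite \<sigma>"
  using complex by (simp add: abstract_complex_def)

lemma face_subset: "\<sigma> \<in> \<Delta> \<Longrightarrow> \<tau> \<subseteq> \<sigma> \<Longrightarrow> \<tau> \<in> \<Delta>"
  using complex unfolding abstract_complex_def by blast

lemma facets_at_obtain:
  assumes "\<rho> \<in> \<Delta>"
  obtains \<sigma> where "\<sigma> \<in> facets_at \<rho>"
  using in_facet[OF assms] by (auto simp: facets_at_def)

lemma facets_at_mono: "\<rho> \<subseteq> \<rho>' \<Longrightarrow> facets_at \<rho>' \<subseteq> facets_at \<rho>"
  by (auto simp: facets_at_def)

lemma singleton_face: "\<sigma> \<in> \<Delta> \<Longrightarrow> v \<in> \<sigma> \<Longrightarrow> {v} \<in> \<Delta>"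
  by (rule face_subset) auto

text \<open>Downward induction on \<rho>: along a walk in the graph of the link of \<rho>,
  consecutive vertices lie with \<rho> in a common facet, and \<rho> enlarged by a single vertex
  falls under the induction hypothesis. The base is a ridge, where \<open>closed\<close>
  applies.\<close>

lemma strongly_connected:
  assumes B: "B \<subseteq> facets_at {v}"
    and closed: "\<And>\<rho> \<sigma> \<sigma>'. \<rho> \<in> \<Delta> \<Longrightarrow> v \<in> \<rho> \<Longrightarrow> Suc (card \<rho>) = d \<Longrightarrow> \<sigma> \<in> B \<Longrightarrow> \<sigma> \<in> facets_at \<rho> \<Longrightarrow>
      \<sigma>' \<in> facets_at \<rho> \<Longrightarrow> \<sigma>' \<in> B"
    and "\<rho> \<in> \<Delta>" "v \<in> \<rho>" "\<sigma> \<in> B" "\<sigma> \<in> facets_at \<rho>" "\<sigma>' \<in> facets_at \<rho>"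
  shows "\<sigma>' \<in> B"
  using assms(3-)
proof (induction "d - card \<rho>" arbitrary: \<rho> \<sigma> \<sigma>' rule: less_induct)
  case less
  have \<sigma>: "\<sigma> \<in> \<Delta>" "card \<sigma> = d" "\<rho> \<subseteq> \<sigma>" and \<sigma>': "\<sigma>' \<in> \<Delta>" "card \<sigma>' = d" "\<rho> \<subseteq> \<sigma>'"
    using less.prems by (auto simp: facets_at_def)
  have fin: "finite \<sigma>" "finite \<sigma>'" "finite \<rho>" using \<sigma> \<sigma>' less.prems finite_face by auto
  have "card \<rho> \<le> d" using card_mono[OF fin(1) \<sigma>(3)] \<sigma>(2) by simp
  then consider "card \<rho> = d" | "Suc (card \<rho>) = d" | "card \<rho> + 2 \<le> d" by linarith
  then show ?case
  proof cases
    case 1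
    then have "\<rho> = \<sigma>" "\<rho> = \<sigma>'"
      using card_subset_eq[OF fin(1) \<sigma>(3)] card_subset_eq[OF fin(2) \<sigma>'(3)] \<sigma> \<sigma>' by auto
    then show ?thesis using less.prems by simp
  next
    case 2
    show ?thesis by (rule closed[OF less.prems(1,2) 2 less.prems(3,4,5)])
  next
    case 3
    have extend: "\<sigma>2 \<in> B" if w: "w \<notin> \<rho>" "insert w \<rho> \<in> \<Delta>" "\<sigma>1 \<in> B" "\<sigma>1 \<in> facets_at (insert w \<rho>)"
      "\<sigma>2 \<in> facets_at (insert w \<rho>)" for w \<sigma>1 \<sigma>2
    proof (rule less.hyps[of "insert w \<rho>" \<sigma>1 \<sigma>2])
      show "d - card (insert w \<rho>) < d - card \<rho>" using w(1) fin(3) 3 by simp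
      show "v \<in> insert w \<rho>" using less.prems(2) by simp
    qed (use w in auto)
    have not_sub: "\<not> \<tau> \<subseteq> \<rho>" if "card \<tau> = d" for \<tau>
      using card_mono[OF fin(3), of \<tau>] that 3 by linarith
    then obtain u u' where u: "u \<in> \<sigma>" "u \<notin> \<rho>" and u': "u' \<in> \<sigma>'" "u' \<notin> \<rho>"
      using not_sub[OF \<sigma>(2)] not_sub[OF \<sigma>'(2)] by blast
    have link: "{w} \<in> link \<Delta> \<rho>" if "w \<in> \<tau>" "w \<notin> \<rho>" "\<rho> \<subseteq> \<tau>" "\<tau> \<in> \<Delta>" for w \<tau>
      using that face_subset[OF that(4), of "insert w \<rho>"] singleton_face[OF that(4,1)] by (auto simp: link_def)
    have "(u, u') \<in> {(a, b). {a, b} \<in> link \<Delta> \<rho>}\<^sup>*"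
      using link_connected[OF less.prems(1) _ 3 link[OF u \<sigma>(3,1)] link[OF u' \<sigma>'(3,1)]] less.prems(2) by blast
    then have "u' \<notin> \<rho> \<and> facets_at (insert u' \<rho>) \<subseteq> B"
    proof (induction rule: rtrancl_induct)
      case base
      have "insert u \<rho> \<in> \<Delta>" using face_subset[OF \<sigma>(1)] u \<sigma>(3) by simp
      moreover have "\<sigma> \<in> facets_at (insert u \<rho>)" using \<sigma> u by (simp add: facets_at_def)
      ultimately show ?case using extend[OF u(2) _ less.prems(3)] u(2) by blast
    next
      case (step w w')
      then have ww': "{w, w'} \<in> link \<Delta> \<rho>" by simp
      then have in\<Delta>: "{w, w'} \<union> \<rho> \<in> \<Delta>" "w' \<notin> \<rho>" by (auto simp: link_def)
      obtain G where G: "G \<in> facets_at ({w, w'} \<union> \<rho>)" using facets_at_obtain[OF in\<Delta>(1)] .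
      have "G \<in> facets_at (insert w \<rho>)" "G \<in> facets_at (insert w' \<rho>)"
        using G facets_at_mono[of "insert w \<rho>" "{w, w'} \<union> \<rho>"] facets_at_mono[of "insert w' \<rho>" "{w, w'} \<union> \<rho>"] by auto
      moreover have "insert w' \<rho> \<in> \<Delta>" by (rule face_subset[OF in\<Delta>(1)]) auto
      ultimately show ?case using step.IH in\<Delta>(2) extend[of w' G] by blast
    qed
    moreover have "\<sigma>' \<in> facets_at (insert u' \<rho>)" using \<sigma>' u' by (simp add: facets_at_def)
    ultimately show ?thesis by blast
  qed
qed

definition link_facets :: "'a \<Rightarrow> 'a set set" where
  "link_facets v = (\<lambda>\<sigma>. \<sigma> - {v}) ` facets_at {v}"

lemma cofaces_link_facets:
  assumes "v \<notin> \<rho>"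
  shows "cofaces (link_facets v) \<rho> = (\<lambda>\<sigma>. \<sigma> - {v}) ` facets_at (insert v \<rho>)"
  using assms by (auto simp: cofaces_def link_facets_def facets_at_def)

lemma inj_remove: "inj_on (\<lambda>\<sigma>. \<sigma> - {v}) (facets_at {v})"
  by (rule inj_on_inverseI[where g = "insert v"]) (auto simp: facets_at_def)

lemma card_cofaces_link_facets:
  assumes "v \<notin> \<rho>" "Suc (Suc (card \<rho>)) = d"
  shows "card (cofaces (link_facets v) \<rho>) = (if insert v \<rho> \<in> \<Delta> then 2 else 0)"
proof -
  have fin: "finite \<rho>" using assms(2) d by (intro card_ge_0_finite) linarith
  have "card (cofaces (link_facets v) \<rho>) = card (facets_at (insert v \<rho>))"
    unfolding cofaces_link_facets[OF assms(1)]
    by (intro card_image inj_on_subset[OF inj_remove] facets_at_mono) simp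
  moreover have "facets_at (insert v \<rho>) = {}" if "insert v \<rho> \<notin> \<Delta>"
    using that face_subset unfolding facets_at_def by blast
  moreover have "card (facets_at (insert v \<rho>)) = 2" if "insert v \<rho> \<in> \<Delta>"
    using two_facets[OF that] assms fin by (simp add: facets_at_def)
  ultimately show ?thesis by auto
qed

text \<open>The cycle condition says that a ridge through \<open>v\<close> lies in two facets. A
  nonempty subcycle contains both as soon as it contains one, so it is closed under crossing ridges,
  and \<open>strongly_connected\<close> makes it everything.\<close>

lemma link_facets_circuit:
  assumes "{v} \<in> \<Delta>"
  shows "mod2_circuit (d - 1) (link_facets v)"
  unfolding mod2_circuit_def
proof (intro conjI allI impI)
  have fin: "finite (link_facets v)" using finite_complex by (simp add: link_facets_def facets_at_def)
  have v_not: "v \<notin> \<rho>" if "\<rho> \<in> link_facets v" for \<rho> using that by (auto simp: link_facets_def)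
  have members: "finite \<rho> \<and> card \<rho> = d - 1" if "\<rho> \<in> link_facets v" for \<rho>
    using that finite_face by (auto simp: link_facets_def facets_at_def)
  show "mod2_cycle (d - 1) (link_facets v)"
    unfolding mod2_cycle_def
  proof (intro conjI allI impI ballI)
    fix \<rho> :: "'a set" assume \<rho>: "Suc (card \<rho>) = d - 1"
    show "even (card (cofaces (link_facets v) \<rho>))"
    proof (cases "v \<in> \<rho>")
      case True
      then have "cofaces (link_facets v) \<rho> = {}" using v_not by (auto simp: cofaces_def)
      then show ?thesis by simp
    next
      case False
      then show ?thesis using card_cofaces_link_facets[OF False] \<rho> by simp
    qed
  qed (use fin members in auto)
  show "link_facets v \<noteq> {}"
    using facets_at_obtain[OF assms] by (auto simp: link_facets_def)
  fix B assume B: "B \<subseteq> link_facets v" "B \<noteq> {}" "mod2_cycle (d - 1) B"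
  define B' where "B' = {\<sigma>\<in>facets_at {v}. \<sigma> - {v} \<in> B}"
  have closed: "\<sigma>' \<in> B'" if \<rho>: "\<rho> \<in> \<Delta>" "v \<in> \<rho>" "Suc (card \<rho>) = d" and \<sigma>: "\<sigma> \<in> B'" "\<sigma> \<in> facets_at \<rho>"
    and \<sigma>': "\<sigma>' \<in> facets_at \<rho>" for \<rho> \<sigma> \<sigma>'
  proof -
    define \<mu> where "\<mu> = \<rho> - {v}"
    have \<mu>: "v \<notin> \<mu>" "insert v \<mu> = \<rho>" using \<rho>(2) by (auto simp: \<mu>_def)
    have card\<mu>: "Suc (Suc (card \<mu>)) = d"
      using \<rho> finite_face[OF \<rho>(1)] card_Suc_Diff1[of \<rho> v] by (simp add: \<mu>_def)
    have two: "card (cofaces (link_facets v) \<mu>) = 2" using card_cofaces_link_facets[OF \<mu>(1) card\<mu>] \<mu>(2) \<rho>(1) by simp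
    have finc: "finite (cofaces (link_facets v) \<mu>)" by (rule finite_cofaces[OF fin])
    have sub: "cofaces B \<mu> \<subseteq> cofaces (link_facets v) \<mu>" using B(1) by (auto simp: cofaces_def)
    have "\<sigma> - {v} \<in> cofaces B \<mu>" using \<sigma> by (auto simp: cofaces_def B'_def facets_at_def \<mu>_def)
    then have "cofaces B \<mu> \<noteq> {}" by blast
    then have "card (cofaces B \<mu>) > 0" using finite_subset[OF sub finc] by (simp add: card_gt_0_iff)
    moreover have "even (card (cofaces B \<mu>))" using B(3) card\<mu> by (simp add: mod2_cycle_def)
    moreover have "card (cofaces B \<mu>) \<le> 2" using card_mono[OF finc sub] two by simp
    ultimately have "card (cofaces B \<mu>) = 2" by presburger
    then have "cofaces B \<mu> = cofaces (link_facets v) \<mu>" using card_subset_eq[OF finc sub] two by simp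
    moreover have "\<sigma>' - {v} \<in> cofaces (link_facets v) \<mu>" unfolding cofaces_link_facets[OF \<mu>(1)] \<mu>(2) using \<sigma>' by blast
    ultimately have "\<sigma>' - {v} \<in> B" by (auto simp: cofaces_def)
    moreover have "\<sigma>' \<in> facets_at {v}" using \<sigma>' facets_at_mono[of "{v}" \<rho>] \<rho>(2) by auto
    ultimately show ?thesis by (simp add: B'_def)
  qed
  obtain \<tau> where \<tau>: "\<tau> \<in> B" using B(2) by blast
  then obtain \<sigma> where \<sigma>: "\<sigma> \<in> facets_at {v}" "\<tau> = \<sigma> - {v}" using B(1) by (auto simp: link_facets_def)
  have \<sigma>B: "\<sigma> \<in> B'" using \<sigma> \<tau> by (simp add: B'_def)
  have B'sub: "B' \<subseteq> facets_at {v}" by (auto simp: B'_def)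
  have all: "\<sigma>' \<in> B'" if "\<sigma>' \<in> facets_at {v}" for \<sigma>'
    by (rule strongly_connected[of B' v "{v}" \<sigma> \<sigma>', OF B'sub closed assms _ \<sigma>B \<sigma>(1) that]) simp_all
  have "link_facets v \<subseteq> B"
  proof
    fix \<rho> assume "\<rho> \<in> link_facets v"
    then obtain \<sigma>' where "\<sigma>' \<in> facets_at {v}" "\<rho> = \<sigma>' - {v}" by (auto simp: link_facets_def)
    then show "\<rho> \<in> B" using all[of \<sigma>'] by (simp add: B'_def)
  qed
  then show "B = link_facets v" using B(1) by blast
qed

lemma Union_link_facets:
  assumes "{v} \<in> \<Delta>"
  shows "\<Union>(facets_at {v}) = insert v (\<Union>(link_facets v))"
proof -
  obtain \<sigma> where "\<sigma> \<in> facets_at {v}" using facets_at_obtain[OF assms] .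
  then have "v \<in> \<Union>(facets_at {v})" by (auto simp: facets_at_def)
  then show ?thesis by (auto simp: link_facets_def)
qed

text \<open>One placement serves all links, so that the forms of different stars can be compared.
  The links are rigid in dimension d - 1, which is at least 3, and coning with \<open>v\<close>
  raises the dimension to \<open>d\<close>.\<close>

lemma stars_rigid:
  obtains t where "inj_on t (\<Union>\<Delta>)" "\<And>v. {v} \<in> \<Delta> \<Longrightarrow> rigid d t (facets_at {v})"
proof -
  define V where "V = {v. {v} \<in> \<Delta>}"
  have finU: "finite (\<Union>\<Delta>)" using finite_complex finite_face by blast
  have "V \<subseteq> \<Union>\<Delta>" by (auto simp: V_def)
  then have finV: "finite V" using finU finite_subset by blast
  have fin: "finite (\<Union>(link_facets v))" for v
    using finite_subset[OF _ finU, of "\<Union>(link_facets v)"] by (auto simp: link_facets_def facets_at_def)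
  have "\<exists>t. inj_on t (\<Union>\<Delta>) \<and> (\<forall>C\<in>link_facets ` V. inj_on t (\<Union>C) \<and> rigid (d - 1) t C)"
  proof (rule generically_rigid_common)
    show "finite (link_facets ` V)" using finV by simp
    show "finite (\<Union>\<Delta>)" by (rule finU)
    fix C assume "C \<in> link_facets ` V"
    then obtain v where v: "{v} \<in> \<Delta>" "C = link_facets v" by (auto simp: V_def)
    show "generically_rigid (d - 1) C"
      unfolding v(2) using d by (intro generically_rigid_mod2_circuit link_facets_circuit v(1)) simp
    show "finite (\<Union>C)" unfolding v(2) by (rule fin)
    obtain \<sigma> where \<sigma>: "\<sigma> \<in> facets_at {v}" using facets_at_obtain[OF v(1)] .
    show "\<exists>S. card S = d - 1 \<and> (\<forall>u\<in>S. \<forall>w\<in>S. joined C u w)"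
    proof (intro exI[of _ "\<sigma> - {v}"] conjI ballI)
      show "card (\<sigma> - {v}) = d - 1" using \<sigma> finite_face by (auto simp: facets_at_def)
      show "joined C u w" if "u \<in> \<sigma> - {v}" "w \<in> \<sigma> - {v}" for u w
        using that \<sigma> unfolding joined_def v(2) link_facets_def by (intro bexI[of _ "\<sigma> - {v}"] conjI imageI)
    qed
  qed
  then obtain t where t: "inj_on t (\<Union>\<Delta>)" "\<And>v. {v} \<in> \<Delta> \<Longrightarrow> rigid (d - 1) t (link_facets v)"
    by (auto simp: V_def)
  have "rigid d t (facets_at {v})" if v: "{v} \<in> \<Delta>" for v
  proof -
    have "rigid (Suc (d - 1)) t (facets_at {v})"
    proof (rule rigid_cone[OF t(2)[OF v], of v])
      show "v \<notin> \<Union>(link_facets v)" by (auto simp: link_facets_def)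
      have "insert v (\<Union>(link_facets v)) \<subseteq> \<Union>\<Delta>" unfolding Union_link_facets[OF v, symmetric] by (auto simp: facets_at_def)
      then show "inj_on t (insert v (\<Union>(link_facets v)))" by (rule inj_on_subset[OF t(1)])
      show "\<Union>(facets_at {v}) = insert v (\<Union>(link_facets v))" by (rule Union_link_facets[OF v])
      show "joined (facets_at {v}) v u" if "u \<in> \<Union>(link_facets v)" for u
        using that by (auto simp: joined_def link_facets_def facets_at_def)
      show "joined (facets_at {v}) u w" if "joined (link_facets v) u w" for u w
        using that by (auto simp: joined_def link_facets_def)
    qed
    then show ?thesis using d by simp
  qed
  with t(1) show thesis by (rule that)
qed

end

section \<open>Counting motions on a cover\<close>

context normal_pseudomanifold
begin

definition vertices :: "'a set" where
  "vertices = {v. {v} \<in> \<Delta>}"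

definition edges :: "('a \<times> 'a) set" where
  "edges = {(u, v). {u, v} \<in> \<Delta> \<and> u < v}"

lemma finite_vertices: "finite vertices"
proof (rule finite_subset)
  show "vertices \<subseteq> \<Union>\<Delta>" by (auto simp: vertices_def)
  show "finite (\<Union>\<Delta>)" using finite_complex finite_face by blast
qed

lemma edge_vertices: "{u, v} \<in> \<Delta> \<Longrightarrow> u \<in> vertices \<and> v \<in> vertices"
  using singleton_face by (auto simp: vertices_def)

lemma finite_edges: "finite edges"
  using finite_subset[of edges "vertices \<times> vertices"] edge_vertices finite_vertices
  by (auto simp: edges_def)

end

text \<open>\<open>lift w u\<close> is the neighbour of \<open>w\<close> over \<open>u\<close>, where \<open>u\<close> is a neighbour of \<open>p w\<close> or \<open>p w\<close> itself.\<close>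

locale pseudomanifold_cover = normal_pseudomanifold \<Delta> d
  for \<Delta> :: "'a::linorder set set" and d :: nat +
  fixes W :: "'w set" and p :: "'w \<Rightarrow> 'a" and lift :: "'w \<Rightarrow> 'a \<Rightarrow> 'w"
  assumes finite_W: "finite W"
    and p_face: "\<And>w. w \<in> W \<Longrightarrow> {p w} \<in> \<Delta>"
    and lift_self: "\<And>w. w \<in> W \<Longrightarrow> lift w (p w) = w"
    and lift_in: "\<And>w u. w \<in> W \<Longrightarrow> {p w, u} \<in> \<Delta> \<Longrightarrow> lift w u \<in> W \<and> p (lift w u) = u"
    and lift_lift: "\<And>w u v. w \<in> W \<Longrightarrow> {p w, u, v} \<in> \<Delta> \<Longrightarrow> lift (lift w u) v = lift w v"
    and connected_W: "\<And>w w'. w \<in> W \<Longrightarrow> w' \<in> W \<Longrightarrow> (w, w') \<in> {(w, lift w u) | w u. w \<in> W \<and> {p w, u} \<in> \<Delta>}\<^sup>*"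
begin

text \<open>\<open>lift w\<close> identifies the star of \<open>p w\<close> with the star of
  \<open>w\<close>, so each star of the cover has its own form \<open>b w\<close>. Neighbouring
  stars share the lift of a facet through \<open>p w\<close> and \<open>u\<close>, whose
  \<open>d\<close> vertices determine the form, and connectedness makes it the same
  everywhere.\<close>

lemma global_motion:
  assumes t: "inj_on t (\<Union>\<Delta>)" "\<And>v. {v} \<in> \<Delta> \<Longrightarrow> rigid d t (facets_at {v})"
    and deg: "\<And>w. w \<in> W \<Longrightarrow> degree (q w) \<le> d"
    and edge: "\<And>w u. w \<in> W \<Longrightarrow> {p w, u} \<in> \<Delta> \<Longrightarrow> poly (q w) (t u) + poly (q (lift w u)) (t (p w)) = 0"
  shows "\<exists>b. skew_family d b \<and> (\<forall>w\<in>W. q w = b (t (p w)))"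
proof -
  have local: "\<exists>b. skew_family d b \<and> (\<forall>u\<in>\<Union>(facets_at {p w}). q (lift w u) = b (t u))" if w: "w \<in> W" for w
  proof -
    have pf: "{p w, u, v} \<in> \<Delta>" if uv: "joined (facets_at {p w}) u v" for u v
    proof -
      obtain \<sigma> where \<sigma>: "\<sigma> \<in> facets_at {p w}" "u \<in> \<sigma>" "v \<in> \<sigma>" using uv by (auto simp: joined_def)
      then have "\<sigma> \<in> \<Delta>" "{p w, u, v} \<subseteq> \<sigma>" by (auto simp: facets_at_def)
      then show ?thesis by (rule face_subset)
    qed
    have pu: "{p w, u} \<in> \<Delta>" if "u \<in> \<Union>(facets_at {p w})" for u
      using pf[of u u] that unfolding joined_refl by simp
    have "motion d t (facets_at {p w}) (\<lambda>u. q (lift w u))"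
    proof (rule motionI)
      show "degree (q (lift w u)) \<le> d" if "u \<in> \<Union>(facets_at {p w})" for u
        using lift_in[OF w pu[OF that]] by (intro deg) simp
      fix u v assume uv: "joined (facets_at {p w}) u v"
      have f: "{p w, u, v} \<in> \<Delta>" by (rule pf[OF uv])
      have "{p w, u} \<in> \<Delta>" by (rule face_subset[OF f]) simp
      moreover have "{u, v} \<in> \<Delta>" by (rule face_subset[OF f]) simp
      ultimately have l: "lift w u \<in> W" "p (lift w u) = u" "{p (lift w u), v} \<in> \<Delta>" using lift_in[OF w] by auto
      show "poly (q (lift w u)) (t v) + poly (q (lift w v)) (t u) = 0"
        using edge[OF l(1,3)] unfolding l(2) lift_lift[OF w f] .
    qed
    with t(2)[OF p_face[OF w]] obtain b where "skew_family d b"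
      "\<And>u. u \<in> \<Union>(facets_at {p w}) \<Longrightarrow> q (lift w u) = b (t u)" by (rule rigidE) blast
    then show ?thesis by (intro exI[of _ b] conjI ballI)
  qed
  define b where "b w = (SOME b. skew_family d b \<and> (\<forall>u\<in>\<Union>(facets_at {p w}). q (lift w u) = b (t u)))" for w
  have b: "skew_family d (b w)" "\<forall>u\<in>\<Union>(facets_at {p w}). q (lift w u) = b w (t u)" if "w \<in> W" for w
    using someI_ex[OF local[OF that]] unfolding b_def by auto
  have b_lift: "b (lift w u) = b w" if w: "w \<in> W" "{p w, u} \<in> \<Delta>" for w u
  proof -
    have l: "lift w u \<in> W" "p (lift w u) = u" using lift_in[OF w] by auto
    obtain \<sigma> where \<sigma>: "\<sigma> \<in> facets_at {p w, u}" using facets_at_obtain[OF w(2)] .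
    have \<sigma>': "\<sigma> \<in> \<Delta>" "card \<sigma> = d" "p w \<in> \<sigma>" "u \<in> \<sigma>" using \<sigma> by (auto simp: facets_at_def)
    show ?thesis
    proof (rule skew_family_eqI[OF b(1)[OF l(1)] b(1)[OF w(1)]])
      show "finite \<sigma>" by (rule finite_face[OF \<sigma>'(1)])
      show "inj_on t \<sigma>" using \<sigma>'(1) by (intro inj_on_subset[OF t(1)]) auto
      show "d \<le> card \<sigma>" by (simp add: \<sigma>'(2))
      fix v assume v: "v \<in> \<sigma>"
      have "{p w, u, v} \<in> \<Delta>" using v \<sigma>' by (intro face_subset[OF \<sigma>'(1)]) auto
      then have "lift (lift w u) v = lift w v" by (rule lift_lift[OF w(1)])
      moreover have "v \<in> \<Union>(facets_at {p w})" "v \<in> \<Union>(facets_at {p (lift w u)})"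
        using v \<sigma>' l(2) by (auto simp: facets_at_def)
      ultimately show "b (lift w u) (t v) = b w (t v)" using b(2)[OF w(1)] b(2)[OF l(1)] by metis
    qed
  qed
  show ?thesis
  proof (cases "W = {}")
    case True
    then show ?thesis by (intro exI[of _ "\<lambda>_. 0"]) (simp add: skew_family_def)
  next
    case False
    then obtain w0 where w0: "w0 \<in> W" by blast
    have const: "b w = b w0" if "w \<in> W" for w
      using connected_W[OF w0 that]
    proof (induction rule: rtrancl_induct)
      case (step w w')
      then show ?case using b_lift by auto
    qed simp
    have "q w = b w0 (t (p w))" if w: "w \<in> W" for w
    proof -
      have "p w \<in> \<Union>(facets_at {p w})"
        using facets_at_obtain[OF p_face[OF w]] by (auto simp: facets_at_def)
      then show ?thesis using b(2)[OF w] lift_self[OF w] const[OF w] by force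
    qed
    then show ?thesis using b(1)[OF w0] by blast
  qed
qed

definition fibre :: "'a \<Rightarrow> 'w set" where
  "fibre v = {w\<in>W. p w = v}"

lemma finite_fibre: "finite (fibre v)"
  using finite_W by (simp add: fibre_def)

lemma lift_fibre_bij:
  assumes "{u, v} \<in> \<Delta>"
  shows "bij_betw (\<lambda>w. lift w v) (fibre u) (fibre v)"
proof (rule bij_betw_byWitness[where f' = "\<lambda>w. lift w u"])
  have "{v, u} \<in> \<Delta>" "{u, v, u} \<in> \<Delta>" "{v, u, v} \<in> \<Delta>" using assms by (simp_all add: insert_commute)
  then show "\<forall>w\<in>fibre u. lift (lift w v) u = w" "\<forall>w\<in>fibre v. lift (lift w u) v = w"
    "(\<lambda>w. lift w v) ` fibre u \<subseteq> fibre v" "(\<lambda>w. lift w u) ` fibre v \<subseteq> fibre u"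
    using lift_lift lift_self lift_in assms by (auto simp: fibre_def)
qed

lemma card_fibre_eq:
  assumes "{u} \<in> \<Delta>" "{v} \<in> \<Delta>"
  shows "card (fibre u) = card (fibre v)"
  using graph_connected[OF assms]
proof (induction rule: rtrancl_induct)
  case (step v w)
  then show ?case using bij_betw_same_card[OF lift_fibre_bij[of v w]] by simp
qed simp

text \<open>Rigidity leaves only trivial motions, and these are constant on the fibres. Hence no motion
  other than 0 sums to zero over every fibre, and the count of unknowns and equations gives the bound.\<close>

theorem edges_ge_of_cover:
  assumes v0: "{v0} \<in> \<Delta>" and two: "2 \<le> card (fibre v0)"
  shows "d * card vertices \<le> card edges"
proof (rule ccontr)
  assume less: "\<not> d * card vertices \<le> card edges"
  obtain t where t: "inj_on t (\<Union>\<Delta>)" "\<And>v. {v} \<in> \<Delta> \<Longrightarrow> rigid d t (facets_at {v})"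
    using stars_rigid by blast
  define n where "n = card (fibre v0)"
  have card_fibre: "card (fibre v) = n" if "v \<in> vertices" for v
    using card_fibre_eq[OF _ v0] that by (simp add: n_def vertices_def)
  define a where "a v = (SOME w. w \<in> fibre v)" for v
  have a: "a v \<in> fibre v" if "v \<in> vertices" for v
  proof -
    have "card (fibre v) \<noteq> 0" using card_fibre[OF that] two by (simp add: n_def)
    then have "fibre v \<noteq> {}" by auto
    then show ?thesis unfolding a_def by (rule some_in_eq[THEN iffD2])
  qed
  have pV: "p w \<in> vertices" if "w \<in> W" for w using p_face[OF that] by (simp add: vertices_def)
  \<comment> \<open>The value at one chosen point \<open>a v\<close> of each fibre is determined by
    the others, as the fibre sum is zero; each other point carries \<open>d\<close>
    coefficients.\<close>
  define I where "I = (SIGMA v:vertices. (fibre v - {a v}) \<times> {..<d})"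
  \<comment> \<open>With zero fibre sums, the equations over one edge add up to zero along the
    fibre, so the one at \<open>a u\<close> is omitted.\<close>
  define J where "J = (SIGMA e:edges. fibre (fst e) - {a (fst e)})"
  have cardR: "card (fibre v - {a v}) = n - 1" if "v \<in> vertices" for v
    using a[OF that] card_fibre[OF that] finite_fibre[of v] by (simp add: card_Diff_singleton)
  have finI: "finite I" unfolding I_def using finite_vertices finite_fibre by blast
  have finJ: "finite J" unfolding J_def using finite_edges finite_fibre by blast
  have "card I = (\<Sum>v\<in>vertices. (n - 1) * d)"
    unfolding I_def using finite_vertices finite_fibre cardR by (subst card_SigmaI) (auto simp: card_cartesian_product)
  then have cardI: "card I = card vertices * ((n - 1) * d)" by simp
  have "card J = (\<Sum>e\<in>edges. n - 1)"
  proof -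
    have "card (fibre (fst e) - {a (fst e)}) = n - 1" if "e \<in> edges" for e
      using that edge_vertices by (intro cardR) (auto simp: edges_def)
    then show ?thesis
      unfolding J_def using finite_edges finite_fibre by (subst card_SigmaI) auto
  qed
  then have cardJ: "card J = card edges * (n - 1)" by simp
  have "card edges * (n - 1) < (d * card vertices) * (n - 1)"
    using less two by (intro mult_strict_right_mono) (auto simp: n_def)
  then have "card J < card I" unfolding cardI cardJ by (simp add: ac_simps)
  \<comment> \<open>X^j (X - t_v) with j < d form a basis of the polynomials of degree at most
    \<open>d\<close> that vanish at t_v, so the self-equations hold from the start. \<open>B\<close>
    places such a polynomial on a fibre with sum zero.\<close>
  define N where "N v j = monom 1 j * [:- t v, 1:]" for v j
  define B where "B i w = (case i of (v, w0, j) \<Rightarrow>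
    if w = w0 then N v j else if w = a v then - N v j else 0)" for i w
  define M where "M j i = (case j of ((u, v), w) \<Rightarrow> poly (B i w) (t v) + poly (B i (lift w v)) (t u))" for j i
  obtain x where x: "\<And>j. j \<in> J \<Longrightarrow> (\<Sum>i\<in>I. M j i * x i) = 0" "\<exists>i\<in>I. x i \<noteq> 0"
    using underdetermined_system[OF finJ finI \<open>card J < card I\<close>, of M] by blast
  define q where "q w = (\<Sum>i\<in>I. smult (x i) (B i w))" for w
  have I_D: "v \<in> vertices" "w0 \<in> fibre v" "w0 \<noteq> a v" "j < d" if "(v, w0, j) \<in> I" for v w0 j
    using that by (auto simp: I_def)
  have degB: "degree (B i w) \<le> d" if i: "i \<in> I" for i w
  proof -
    obtain v w0 j where i': "i = (v, w0, j)" by (cases i)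
    have "degree (N v j) \<le> d"
      using I_D(4)[of v w0 j] i unfolding i' N_def
      by (intro order.trans[OF degree_mult_le]) (simp add: degree_monom_eq)
    then show ?thesis unfolding i' B_def by simp
  qed
  have degq: "degree (q w) \<le> d" for w
    unfolding q_def by (intro degree_sum_le finI order.trans[OF degree_smult_le] degB)
  have B_self: "poly (B i w) (t (p w)) = 0" if i: "i \<in> I" for i w
  proof -
    obtain v w0 j where i': "i = (v, w0, j)" by (cases i)
    have "p w0 = v" "p (a v) = v" using I_D[of v w0 j] a[of v] i i' by (auto simp: fibre_def)
    then show ?thesis unfolding i' B_def by (auto simp: N_def)
  qed
  have q_self: "poly (q w) (t (p w)) = 0" for w
    unfolding q_def poly_sum by (intro sum.neutral) (simp add: B_self)
  have B_sum: "(\<Sum>w\<in>fibre v. B i w) = 0" if i: "i \<in> I" "v \<in> vertices" for i v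
  proof -
    obtain v' w0 j where i': "i = (v', w0, j)" by (cases i)
    have iv: "v' \<in> vertices" "w0 \<in> fibre v'" "w0 \<noteq> a v'" using I_D[of v' w0 j] i i' by auto
    show ?thesis
    proof (cases "v' = v")
      case True
      have "(\<Sum>w\<in>fibre v. B i w) = (\<Sum>w\<in>{w0, a v}. B i w)"
        using iv True a[OF iv(1)] finite_fibre[of v]
        by (intro sum.mono_neutral_right) (auto simp: i' B_def)
      also have "\<dots> = 0" using iv True by (simp add: i' B_def)
      finally show ?thesis .
    next
      case False
      then have "w0 \<notin> fibre v" "a v' \<notin> fibre v" using iv a[OF iv(1)] by (auto simp: fibre_def)
      then show ?thesis by (intro sum.neutral) (auto simp: i' B_def)
    qed
  qed
  have q_sum: "(\<Sum>w\<in>fibre v. q w) = 0" if "v \<in> vertices" for v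
  proof -
    have "(\<Sum>w\<in>fibre v. q w) = (\<Sum>i\<in>I. \<Sum>w\<in>fibre v. smult (x i) (B i w))"
      unfolding q_def by (rule sum.swap)
    also have "\<dots> = (\<Sum>i\<in>I. smult (x i) (\<Sum>w\<in>fibre v. B i w))"
      by (intro sum.cong refl) (simp add: poly_eq_iff coeff_sum sum_distrib_left)
    also have "\<dots> = 0" using B_sum[OF _ that] by (intro sum.neutral) simp
    finally show ?thesis .
  qed
  have eq_edge: "poly (q w) (t v) + poly (q (lift w v)) (t u) = 0"
    if e: "(u, v) \<in> edges" and w: "w \<in> fibre u" for u v w
  proof -
    have uv: "{u, v} \<in> \<Delta>" "u \<in> vertices" "v \<in> vertices" using e edge_vertices by (auto simp: edges_def)
    have rest: "poly (q w) (t v) + poly (q (lift w v)) (t u) = 0" if "w \<in> fibre u - {a u}" for w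
    proof -
      have "((u, v), w) \<in> J" using that e by (simp add: J_def)
      from x(1)[OF this] show ?thesis
        by (simp add: M_def q_def poly_sum sum.distrib algebra_simps)
    qed
    show ?thesis
    proof (cases "w = a u")
      case True
      \<comment> \<open>The omitted equation: the sum over the fibre is zero, and so are all other
        terms.\<close>
      have "(\<Sum>w\<in>fibre u. poly (q w) (t v) + poly (q (lift w v)) (t u))
          = poly (\<Sum>w\<in>fibre u. q w) (t v) + poly (\<Sum>w\<in>fibre u. q (lift w v)) (t u)"
        by (simp add: poly_sum sum.distrib)
      also have "(\<Sum>w\<in>fibre u. q (lift w v)) = (\<Sum>w\<in>fibre v. q w)"
        by (rule sum.reindex_bij_betw[OF lift_fibre_bij[OF uv(1)]])
      finally have "(\<Sum>w\<in>fibre u. poly (q w) (t v) + poly (q (lift w v)) (t u)) = 0"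
        using q_sum uv(2,3) by simp
      also have "(\<Sum>w\<in>fibre u. poly (q w) (t v) + poly (q (lift w v)) (t u))
          = poly (q w) (t v) + poly (q (lift w v)) (t u)"
        using w rest True sum.remove[OF finite_fibre[of u] w, of "\<lambda>w. poly (q w) (t v) + poly (q (lift w v)) (t u)"]
        by (simp add: sum.neutral)
      finally show ?thesis .
    next
      case False
      then show ?thesis using rest w by simp
    qed
  qed
  have "\<exists>b. skew_family d b \<and> (\<forall>w\<in>W. q w = b (t (p w)))"
  proof (rule global_motion[OF t degq])
    fix w u assume w: "w \<in> W" "{p w, u} \<in> \<Delta>"
    have l: "lift w u \<in> W" "p (lift w u) = u" using lift_in[OF w] by auto
    consider "p w < u" | "u < p w" | "u = p w" by fastforce
    then show "poly (q w) (t u) + poly (q (lift w u)) (t (p w)) = 0"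
    proof cases
      case 1
      then show ?thesis using w by (intro eq_edge) (auto simp: edges_def fibre_def)
    next
      case 2
      have "lift (lift w u) (p w) = w" using lift_lift[OF w(1), of u "p w"] w lift_self by (simp add: insert_commute)
      moreover have "(u, p w) \<in> edges" using 2 w by (simp add: edges_def insert_commute)
      ultimately show ?thesis using eq_edge[of u "p w" "lift w u"] l by (simp add: fibre_def add.commute)
    next
      case 3
      then show ?thesis using lift_self[OF w(1)] q_self[of w] by simp
    qed
  qed
  then obtain b where b: "\<And>w. w \<in> W \<Longrightarrow> q w = b (t (p w))" by blast
  have q0: "q w = 0" if w: "w \<in> W" for w
  proof -
    have "(\<Sum>w'\<in>fibre (p w). q w') = (\<Sum>w'\<in>fibre (p w). q w)"
      using b w by (intro sum.cong refl) (auto simp: fibre_def)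
    then have "of_nat n * q w = 0" using q_sum[OF pV[OF w]] card_fibre[OF pV[OF w]] by simp
    moreover have "n \<noteq> 0" using two by (simp add: n_def)
    ultimately show ?thesis by simp
  qed
  obtain v w0 j where i: "(v, w0, j) \<in> I" "x (v, w0, j) \<noteq> 0" using x(2) by auto
  note iD = I_D[OF i(1)]
  have w0: "w0 \<in> W" using iD(2) by (simp add: fibre_def)
  \<comment> \<open>As \<open>w0\<close> is not a chosen point, only the basis vectors of
    \<open>w0\<close> itself are nonzero there, and the coefficients can be read off.\<close>
  have "q w0 = (\<Sum>i\<in>(\<lambda>j. (v, w0, j)) ` {..<d}. smult (x i) (B i w0))"
    unfolding q_def
  proof (intro sum.mono_neutral_right finI ballI)
    show "(\<lambda>j. (v, w0, j)) ` {..<d} \<subseteq> I" using iD by (auto simp: I_def)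
    fix i assume i: "i \<in> I - (\<lambda>j. (v, w0, j)) ` {..<d}"
    obtain v' w' j' where i': "i = (v', w', j')" by (cases i)
    have i'D: "v' \<in> vertices" "w' \<in> fibre v'" "w' \<noteq> a v'" "j' < d" using I_D[of v' w' j'] i i' by auto
    have "w' \<noteq> w0"
    proof
      assume "w' = w0"
      then have "v' = v" using i'D(2) iD(2) by (simp add: fibre_def)
      then show False using i i' i'D(4) \<open>w' = w0\<close> by auto
    qed
    moreover have "w0 \<noteq> a v'"
    proof
      assume "w0 = a v'"
      then have "v' = v" using a[OF i'D(1)] iD(2) by (simp add: fibre_def)
      then show False using iD(3) \<open>w0 = a v'\<close> by simp
    qed
    ultimately show "smult (x i) (B i w0) = 0" by (simp add: i' B_def)
  qed
  also have "\<dots> = (\<Sum>j<d. smult (x (v, w0, j)) (N v j))"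
    by (subst sum.reindex) (auto simp: inj_on_def B_def)
  also have "\<dots> = (\<Sum>j<d. monom (x (v, w0, j)) j) * [:- t v, 1:]"
    unfolding sum_distrib_right N_def by (intro sum.cong refl) (metis mult_smult_left smult_monom mult.right_neutral)
  finally have "(\<Sum>j<d. monom (x (v, w0, j)) j) * [:- t v, 1:] = 0" using q0[OF w0] by simp
  then have "(\<Sum>j<d. monom (x (v, w0, j)) j) = 0" unfolding mult_eq_0_iff by simp
  then have "coeff (\<Sum>j<d. monom (x (v, w0, j)) j) j = 0" by simp
  then have "x (v, w0, j) = 0" using iD(4) by (simp add: coeff_sum)
  with i(2) show False by simp
qed

end

context normal_pseudomanifold
begin

text \<open>A trivial motion vanishes if it vanishes at \<open>d\<close> vertices of a facet \<open>\<sigma>\<close>; as the edges of \<open>\<sigma>\<close> are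
  present, this costs \<open>(d choose 2) + d\<close> further equations.\<close>

theorem edges_ge:
  "d * card vertices \<le> card edges + ((d + 1) choose 2)"
proof (rule ccontr)
  assume less: "\<not> d * card vertices \<le> card edges + ((d + 1) choose 2)"
  obtain t where t: "inj_on t (\<Union>\<Delta>)" "\<And>v. {v} \<in> \<Delta> \<Longrightarrow> rigid d t (facets_at {v})"
    using stars_rigid by blast
  obtain v0 where v0: "v0 \<in> vertices"
  proof -
    have "vertices \<noteq> {}" using less by auto
    then show thesis using that by blast
  qed
  then obtain \<sigma> where \<sigma>': "\<sigma> \<in> facets_at {v0}" using facets_at_obtain by (auto simp: vertices_def)
  have \<sigma>: "\<sigma> \<in> \<Delta>" "card \<sigma> = d" "finite \<sigma>" using \<sigma>' finite_face by (auto simp: facets_at_def)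
  have \<sigma>V: "\<sigma> \<subseteq> vertices" using singleton_face[OF \<sigma>(1)] by (auto simp: vertices_def)
  have inj\<sigma>: "inj_on t \<sigma>" using \<sigma>(1) by (intro inj_on_subset[OF t(1)]) auto
  \<comment> \<open>The \<open>d\<close> roots t_v with \<open>v\<close> in \<sigma> do not force a
    polynomial of degree \<open>d\<close> to vanish; the spare parameter \<open>s\<close> supplies
    one more.\<close>
  have "\<exists>s. s \<notin> t ` \<sigma>" using \<sigma>(3) by (intro ex_new_if_finite infinite_UNIV_char_0) simp
  then obtain s where s: "s \<notin> t ` \<sigma>" by blast
  \<comment> \<open>Only u < v is imposed; the edge equation transfers the vanishing to the reversed
    pair. So the rows \<open>K2\<close> and \<open>K3\<close> number (d choose 2) + d = (d + 1
    choose 2).\<close>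
  define pairs where "pairs = {(u, v). u \<in> \<sigma> \<and> v \<in> \<sigma> \<and> u < v}"
  have fin_pairs: "finite pairs" using finite_subset[of pairs "\<sigma> \<times> \<sigma>"] \<sigma>(3) by (auto simp: pairs_def)
  have "card pairs = card {e. e \<subseteq> \<sigma> \<and> card e = 2}"
  proof (rule bij_betw_same_card[where f = "\<lambda>(u, v). {u, v}"], rule bij_betw_imageI)
    show "inj_on (\<lambda>(u, v). {u, v}) pairs" by (auto simp: inj_on_def pairs_def doubleton_eq_iff)
    show "(\<lambda>(u, v). {u, v}) ` pairs = {e. e \<subseteq> \<sigma> \<and> card e = 2}"
    proof (intro equalityI subsetI)
      fix e assume "e \<in> {e. e \<subseteq> \<sigma> \<and> card e = 2}"
      then obtain u v where e: "e = {u, v}" "u \<noteq> v" "u \<in> \<sigma>" "v \<in> \<sigma>" by (auto simp: card_2_iff)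
      then consider "(u, v) \<in> pairs" | "(v, u) \<in> pairs"
        using linorder_less_linear[of u v] by (auto simp: pairs_def)
      then show "e \<in> (\<lambda>(u, v). {u, v}) ` pairs"
        using e(1) by cases (auto intro: rev_image_eqI simp: insert_commute)
    qed (auto simp: pairs_def)
  qed
  then have card_pairs: "card pairs = d choose 2" using n_subsets[OF \<sigma>(3), of 2] \<sigma>(2) by simp
  define I where "I = vertices \<times> {..<d}"
  have finI: "finite I" using finite_vertices by (simp add: I_def)
  define K1 :: "(('a \<times> 'a) + ('a \<times> 'a) + 'a) set" where "K1 = Inl ` edges"
  define K2 :: "(('a \<times> 'a) + ('a \<times> 'a) + 'a) set" where "K2 = Inr ` Inl ` pairs"
  define K3 :: "(('a \<times> 'a) + ('a \<times> 'a) + 'a) set" where "K3 = Inr ` Inr ` \<sigma>"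
  define K where "K = K1 \<union> K2 \<union> K3"
  have finK: "finite K" using finite_edges fin_pairs \<sigma>(3) by (simp add: K_def K1_def K2_def K3_def)
  have "card K \<le> card K1 + card K2 + card K3"
    unfolding K_def using card_Un_le[of "K1 \<union> K2" K3] card_Un_le[of K1 K2] by linarith
  also have "\<dots> = card edges + card pairs + card \<sigma>"
    by (simp add: K1_def K2_def K3_def card_image)
  also have "\<dots> = card edges + ((d + 1) choose 2)"
    unfolding card_pairs \<sigma>(2) by (simp add: numeral_2_eq_2)
  also have "\<dots> < card I" using less by (simp add: I_def card_cartesian_product mult.commute)
  finally have "card K < card I" .
  define N where "N v j = monom 1 j * [:- t v, 1:]" for v j
  define B where "B i w = (if w = fst i then N (fst i) (snd i) else 0)" for i w
  define M where "M k i = (case k of Inl (u, v) \<Rightarrow> poly (B i u) (t v) + poly (B i v) (t u)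
    | Inr (Inl (u, v)) \<Rightarrow> poly (B i u) (t v) | Inr (Inr u) \<Rightarrow> poly (B i u) s)" for k i
  obtain x where x: "\<And>k. k \<in> K \<Longrightarrow> (\<Sum>i\<in>I. M k i * x i) = 0" "\<exists>i\<in>I. x i \<noteq> 0"
    using underdetermined_system[OF finK finI \<open>card K < card I\<close>, of M] by blast
  define q where "q w = (\<Sum>i\<in>I. smult (x i) (B i w))" for w
  have degq: "degree (q w) \<le> d" for w
    unfolding q_def
  proof (intro degree_sum_le finI order.trans[OF degree_smult_le])
    fix i assume "i \<in> I"
    then have "degree (N (fst i) (snd i)) \<le> d"
      unfolding N_def by (intro order.trans[OF degree_mult_le]) (auto simp: degree_monom_eq I_def)
    then show "degree (B i w) \<le> d" by (simp add: B_def)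
  qed
  have q_self: "poly (q w) (t w) = 0" for w
    unfolding q_def poly_sum by (intro sum.neutral) (simp add: B_def N_def)
  have row_edge: "poly (q u) (t v) + poly (q v) (t u) = 0" if "(u, v) \<in> edges" for u v
  proof -
    have "Inl (u, v) \<in> K" using that by (simp add: K_def K1_def K2_def K3_def)
    from x(1)[OF this] show ?thesis by (simp add: M_def q_def poly_sum sum.distrib algebra_simps)
  qed
  have row_pair: "poly (q u) (t v) = 0" if "(u, v) \<in> pairs" for u v
  proof -
    have "Inr (Inl (u, v)) \<in> K" using that by (simp add: K_def K1_def K2_def K3_def)
    from x(1)[OF this] show ?thesis by (simp add: M_def q_def poly_sum mult.commute)
  qed
  have row_pin: "poly (q u) s = 0" if "u \<in> \<sigma>" for u
  proof -
    have "Inr (Inr u) \<in> K" using that by (simp add: K_def K1_def K2_def K3_def)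
    from x(1)[OF this] show ?thesis by (simp add: M_def q_def poly_sum mult.commute)
  qed
  \<comment> \<open>The identity is a one-sheeted cover, which makes \<open>global_motion\<close>
    applicable to the complex itself.\<close>
  interpret id_cover: pseudomanifold_cover \<Delta> d vertices "\<lambda>v. v" "\<lambda>_ u. u"
  proof unfold_locales
    fix u v assume uv: "u \<in> vertices" "v \<in> vertices"
    have "{(a, b). {a, b} \<in> \<Delta>} \<subseteq> {(w, u) | w u. w \<in> vertices \<and> {w, u} \<in> \<Delta>}"
      using edge_vertices by blast
    from rtrancl_mono[OF this] show "(u, v) \<in> {(w, u) | w u. w \<in> vertices \<and> {w, u} \<in> \<Delta>}\<^sup>*"
      using graph_connected[of u v] uv by (auto simp: vertices_def)
  qed (use finite_vertices edge_vertices in \<open>auto simp: vertices_def\<close>)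
  have "\<exists>b. skew_family d b \<and> (\<forall>w\<in>vertices. q w = b (t w))"
  proof (rule id_cover.global_motion[OF t degq])
    fix w u assume wu: "w \<in> vertices" "{w, u} \<in> \<Delta>"
    consider "(w, u) \<in> edges" | "(u, w) \<in> edges" | "u = w"
      using wu by (fastforce simp: edges_def insert_commute)
    then show "poly (q w) (t u) + poly (q u) (t w) = 0"
    proof cases
      case 2
      then show ?thesis using row_edge[OF 2] by (simp add: add.commute)
    qed (simp_all add: row_edge q_self)
  qed
  then obtain b where b: "skew_family d b" "\<And>w. w \<in> vertices \<Longrightarrow> q w = b (t w)" by blast
  have q\<sigma>: "q u = 0" if u: "u \<in> \<sigma>" for u
  proof (rule poly_eq_0_if_roots[where A = "insert s (t ` \<sigma>)", OF degq])
    show "d < card (insert s (t ` \<sigma>))" using s \<sigma>(2,3) inj\<sigma> by (simp add: card_image)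
    fix r assume "r \<in> insert s (t ` \<sigma>)"
    then consider "r = s" | v where "v \<in> \<sigma>" "r = t v" by blast
    then show "poly (q u) r = 0"
    proof cases
      case (2 v)
      have uv: "{u, v} \<in> \<Delta>" using u 2(1) by (intro face_subset[OF \<sigma>(1)]) auto
      consider "u < v" | "v < u" | "u = v" by fastforce
      then show ?thesis
      proof cases
        case 1
        then show ?thesis using row_pair[of u v] u 2 by (simp add: pairs_def)
      next
        case less: 2
        then have "(v, u) \<in> pairs" "(v, u) \<in> edges" using u 2 uv by (simp_all add: pairs_def edges_def insert_commute)
        then show ?thesis using row_pair[of v u] row_edge[of v u] 2 by simp
      next
        case 3
        then show ?thesis using q_self 2 by simp
      qed
    qed (use row_pin[OF u] in simp)
  qed
  have "b = (\<lambda>_. 0)"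
  proof (rule skew_family_eqI[OF b(1) _ \<sigma>(3) inj\<sigma>])
    show "skew_family d (\<lambda>_. 0)" by (simp add: skew_family_def)
    show "b (t u) = 0" if "u \<in> \<sigma>" for u using b(2)[of u] q\<sigma>[OF that] \<sigma>V that by auto
  qed (simp add: \<sigma>(2))
  then have q0: "q w = 0" if "w \<in> vertices" for w using b(2)[OF that] by simp
  obtain v j where i: "v \<in> vertices" "j < d" "x (v, j) \<noteq> 0" using x(2) by (auto simp: I_def)
  have "q v = (\<Sum>i\<in>Pair v ` {..<d}. smult (x i) (B i v))"
    unfolding q_def using i(1) by (intro sum.mono_neutral_right finI) (auto simp: I_def B_def)
  also have "\<dots> = (\<Sum>j<d. smult (x (v, j)) (N v j))"
    by (subst sum.reindex) (auto simp: inj_on_def B_def)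
  also have "\<dots> = (\<Sum>j<d. monom (x (v, j)) j) * [:- t v, 1:]"
    unfolding sum_distrib_right N_def by (intro sum.cong refl) (metis mult_smult_left smult_monom mult.right_neutral)
  finally have "(\<Sum>j<d. monom (x (v, j)) j) * [:- t v, 1:] = 0" using q0[OF i(1)] by simp
  then have "(\<Sum>j<d. monom (x (v, j)) j) = 0" unfolding mult_eq_0_iff by simp
  then have "coeff (\<Sum>j<d. monom (x (v, j)) j) j = 0" by simp
  then have "x (v, j) = 0" using i(2) by (simp add: coeff_sum)
  with i(3) show False by simp
qed

end

section \<open>Homology manifolds are normal pseudomanifolds\<close>

lemma bdry_empty:
  assumes "\<And>w. {w} \<in> \<Delta> \<Longrightarrow> w \<in> V" "V \<subseteq> \<Union>\<Delta>" "finite (\<Union>\<Delta>)" "\<And>\<sigma>. c \<sigma> \<noteq> 0 \<Longrightarrow> \<sigma> \<in> \<Delta>"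
  shows "bdry \<Delta> c {} = (\<Sum>w\<in>V. c {w})"
  unfolding bdry_def using assms by (intro sum.mono_neutral_cong_right) auto

definition vertex_chain :: "'a \<Rightarrow> 'a set \<Rightarrow> 'k::field" where
  "vertex_chain u \<sigma> = (if \<sigma> = {u} then 1 else 0)"

lemma vertex_difference_cycle:
  assumes "abstract_complex \<Delta>" "{u} \<in> \<Delta>" "{v} \<in> \<Delta>"
  shows "vertex_chain u - vertex_chain v \<in> cycles \<Delta> 0"
proof -
  have fin: "finite (\<Union>\<Delta>)" using assms(1) by (auto simp: abstract_complex_def)
  have uv: "u \<in> \<Union>\<Delta>" "v \<in> \<Union>\<Delta>" using assms by auto
  have "(vertex_chain u - vertex_chain v :: 'a set \<Rightarrow> 'b) \<in> chains \<Delta> 0"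
    using assms by (auto simp: chains_def vertex_chain_def face_dim_def)
  moreover have "bdry \<Delta> (vertex_chain u - vertex_chain v :: 'a set \<Rightarrow> 'b) \<tau> = 0" for \<tau>
  proof (cases "\<tau> = {}")
    case True
    have "bdry \<Delta> (vertex_chain u - vertex_chain v :: 'a set \<Rightarrow> 'b) {}
        = (\<Sum>w\<in>\<Union>\<Delta>. (if w = u then 1 else 0) - (if w = v then 1 else 0))"
      unfolding bdry_def by (intro sum.cong) (auto simp: vertex_chain_def)
    also have "\<dots> = 0" using uv fin by (simp add: sum_subtractf)
    finally show ?thesis by (simp add: True)
  next
    case False
    have "(vertex_chain u - vertex_chain v :: 'a set \<Rightarrow> 'b) (insert w \<tau>) = 0" if "w \<in> \<Union>\<Delta> - \<tau>" for w
    proof -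
      have "insert w \<tau> \<noteq> {u}" "insert w \<tau> \<noteq> {v}" using False that by auto
      then show ?thesis by (simp add: vertex_chain_def)
    qed
    then show ?thesis unfolding bdry_def by (intro sum.neutral ballI) (simp only: mult_zero_right)
  qed
  ultimately show ?thesis by (auto simp: cycles_def)
qed

lemma bdry_zero: "bdry \<Delta> 0 = 0"
  by (rule ext) (simp add: bdry_def)

lemma zero_boundary: "0 \<in> boundaries \<Delta> i"
proof -
  have "0 \<in> chains \<Delta> (i + 1)" by (simp add: chains_def)
  then have "bdry \<Delta> 0 \<in> bdry \<Delta> ` chains \<Delta> (i + 1)" by (rule imageI)
  then show ?thesis by (simp add: boundaries_def bdry_zero)
qed

lemma zero_cycle: "0 \<in> cycles \<Delta> i"
  by (simp add: cycles_def chains_def bdry_zero)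

lemma coordinate_space_0: "coordinate_space 0 = {0}"
  unfolding coordinate_space_def by (auto simp: fun_eq_iff)

text \<open>A bijection with a one-point space puts every cycle into the coset of 0.\<close>

lemma homology_iso_0_boundary:
  assumes "homology_iso TYPE('k::field) \<Delta> i 0" "(z :: 'a::linorder set \<Rightarrow> 'k) \<in> cycles \<Delta> i"
  shows "z \<in> boundaries \<Delta> i"
proof -
  obtain \<phi> :: "('a set \<Rightarrow> 'k) set \<Rightarrow> nat \<Rightarrow> 'k" where \<phi>: "bij_betw \<phi> (homology \<Delta> i) (coordinate_space 0)"
    using assms(1) by (auto simp: homology_iso_def)
  have in_hom: "y +o boundaries \<Delta> i \<in> homology \<Delta> i" if "y \<in> cycles \<Delta> i" for y :: "'a set \<Rightarrow> 'k"
    using that by (simp add: homology_def)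
  have "\<phi> (y +o boundaries \<Delta> i) = 0" if "y \<in> cycles \<Delta> i" for y :: "'a set \<Rightarrow> 'k"
    using bij_betwE[OF \<phi>] in_hom[OF that] unfolding coordinate_space_0 by blast
  then have "z +o boundaries \<Delta> i = 0 +o boundaries \<Delta> i"
    using assms(2) zero_cycle in_hom bij_betw_imp_inj_on[OF \<phi>] by (metis inj_onD)
  moreover have "z \<in> z +o boundaries \<Delta> i" using set_plus_intro2[OF zero_boundary, of z] by simp
  ultimately show ?thesis by simp
qed

text \<open>If [u] - [v] bounds \<open>g\<close>, the coefficients of both sides are summed over the
  component \<open>A\<close> of \<open>u\<close>: edges inside \<open>A\<close> enter twice with
  opposite signs and no edge leaves \<open>A\<close>, so the boundary gives 0, whereas [u] - [v]
  gives 1.\<close>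

lemma graph_connected_if_homology_0:
  fixes \<Delta> :: "'a::linorder set set"
  assumes \<Delta>: "abstract_complex \<Delta>" and hom: "homology_iso TYPE('k::field) \<Delta> 0 0"
    and u: "{u} \<in> \<Delta>" and v: "{v} \<in> \<Delta>"
  shows "(u, v) \<in> {(a, b). {a, b} \<in> \<Delta>}\<^sup>*"
proof (rule ccontr)
  assume contra: "(u, v) \<notin> {(a, b). {a, b} \<in> \<Delta>}\<^sup>*"
  define A where "A = {w\<in>\<Union>\<Delta>. (u, w) \<in> {(a, b). {a, b} \<in> \<Delta>}\<^sup>*}"
  have fin: "finite (\<Union>\<Delta>)" using \<Delta> by (auto simp: abstract_complex_def)
  then have finA: "finite A" by (rule rev_finite_subset) (auto simp: A_def)
  have A: "u \<in> A" "v \<notin> A" using u contra by (auto simp: A_def)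
  have "(vertex_chain u - vertex_chain v :: 'a set \<Rightarrow> 'k) \<in> boundaries \<Delta> 0"
    by (rule homology_iso_0_boundary[OF hom vertex_difference_cycle[OF \<Delta> u v]])
  then obtain g :: "'a set \<Rightarrow> 'k" where g: "g \<in> chains \<Delta> 1" "bdry \<Delta> g = vertex_chain u - vertex_chain v"
    by (auto simp: boundaries_def)
  have g_out: "g {x, w} = 0" if "w \<in> A" "x \<in> \<Union>\<Delta> - A" for w x
  proof (rule ccontr)
    assume "g {x, w} \<noteq> 0"
    then have "(w, x) \<in> {(a, b). {a, b} \<in> \<Delta>}" using g(1) by (simp add: chains_def insert_commute)
    then have "x \<in> A" using that by (auto simp: A_def intro: rtrancl_into_rtrancl)
    then show False using that by simp
  qed
  have sgn: "(- 1) ^ card {y\<in>{w}. y < x} = (if w < x then - 1 else 1 :: 'k)" for w x :: 'a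
  proof -
    have "{y\<in>{w}. y < x} = (if w < x then {w} else {})" by auto
    then show ?thesis by simp
  qed
  have row: "bdry \<Delta> g {w} = (\<Sum>x\<in>{x\<in>A. x < w}. g {x, w}) - (\<Sum>x\<in>{x\<in>A. w < x}. g {x, w})"
    if w: "w \<in> A" for w
  proof -
    have "bdry \<Delta> g {w} = (\<Sum>x\<in>A - {w}. (if w < x then - 1 else 1) * g {x, w})"
      unfolding bdry_def sgn using fin g_out[OF w]
      by (intro sum.mono_neutral_right) (auto simp: A_def)
    also have "A - {w} = {x\<in>A. x < w} \<union> {x\<in>A. w < x}" by auto
    also have "(\<Sum>x\<in>{x\<in>A. x < w} \<union> {x\<in>A. w < x}. (if w < x then - 1 else 1) * g {x, w})
        = (\<Sum>x\<in>{x\<in>A. x < w}. (if w < x then - 1 else 1) * g {x, w})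
        + (\<Sum>x\<in>{x\<in>A. w < x}. (if w < x then - 1 else 1) * g {x, w})"
      using finA by (intro sum.union_disjoint) auto
    also have "(\<Sum>x\<in>{x\<in>A. x < w}. (if w < x then - 1 else 1) * g {x, w}) = (\<Sum>x\<in>{x\<in>A. x < w}. g {x, w})"
      by (intro sum.cong) auto
    also have "(\<Sum>x\<in>{x\<in>A. w < x}. (if w < x then - 1 else 1) * g {x, w}) = - (\<Sum>x\<in>{x\<in>A. w < x}. g {x, w})"
      unfolding sum_negf[symmetric] by (intro sum.cong) auto
    finally show ?thesis by simp
  qed
  have "(\<Sum>w\<in>A. \<Sum>x\<in>{x\<in>A. w < x}. g {x, w}) = (\<Sum>x\<in>A. \<Sum>w\<in>{w\<in>A. w < x}. g {x, w})"
    by (rule sum.swap_restrict[OF finA finA])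
  then have "(\<Sum>w\<in>A. bdry \<Delta> g {w}) = 0"
    by (simp add: row sum_subtractf insert_commute)
  moreover have "(\<Sum>w\<in>A. bdry \<Delta> g {w}) = (\<Sum>w\<in>A. (if w = u then 1 else 0) - (if w = v then 1 else 0))"
    unfolding g(2) by (intro sum.cong) (auto simp: vertex_chain_def)
  moreover have "\<dots> = 1" using A finA by (simp add: sum_subtractf)
  ultimately show False by simp
qed

lemma coordinate_space_1_eqI:
  assumes "v \<in> coordinate_space 1" "w \<in> coordinate_space 1" "v 0 = w 0"
  shows "v = w"
proof (rule ext)
  show "v j = w j" for j
    using assms by (cases j) (simp_all add: coordinate_space_def)
qed

text \<open>Without edges only 0 is a boundary, so the cycles, functions on the vertices with sum
  zero, form a line. A nonzero one needs two vertices, and a third vertex would produce two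
  independent ones.\<close>

lemma two_vertices_if_homology_0_1:
  fixes \<Delta> :: "'a::linorder set set"
  assumes \<Delta>: "abstract_complex \<Delta>" and card1: "\<And>\<sigma>. \<sigma> \<in> \<Delta> \<Longrightarrow> card \<sigma> \<le> 1"
    and hom: "homology_iso TYPE('k::field) \<Delta> 0 1"
  shows "card {w. {w} \<in> \<Delta>} = 2"
proof -
  define V where "V = {w. {w} \<in> \<Delta>}"
  have fin: "finite (\<Union>\<Delta>)" using \<Delta> by (auto simp: abstract_complex_def)
  have "V \<subseteq> \<Union>\<Delta>" by (auto simp: V_def)
  then have finV: "finite V" using fin finite_subset by blast
  have chains1: "c = 0" if "c \<in> chains \<Delta> (0 + 1)" for c :: "'a set \<Rightarrow> 'k"
  proof (rule ext, rule ccontr)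
    fix \<sigma> assume "c \<sigma> \<noteq> 0 \<sigma>"
    then have "\<sigma> \<in> \<Delta>" "card \<sigma> = 2" using that by (auto simp: chains_def face_dim_def)
    then show False using card1 by fastforce
  qed
  have bd: "boundaries \<Delta> 0 = {0 :: 'a set \<Rightarrow> 'k}"
  proof -
    have "chains \<Delta> (0 + 1) = {0 :: 'a set \<Rightarrow> 'k}" using chains1 by (auto simp: chains_def)
    then show ?thesis unfolding boundaries_def by (simp add: bdry_zero)
  qed
  obtain \<phi> :: "('a set \<Rightarrow> 'k) set \<Rightarrow> nat \<Rightarrow> 'k" where \<phi>: "bij_betw \<phi> (homology \<Delta> 0) (coordinate_space 1)"
    "\<And>a X. X \<in> homology \<Delta> 0 \<Longrightarrow> \<phi> (scale a ` X + boundaries \<Delta> 0) = scale a (\<phi> X)"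
    using hom by (auto simp: homology_iso_def)
  have H: "homology \<Delta> 0 = (\<lambda>z :: 'a set \<Rightarrow> 'k. {z}) ` cycles \<Delta> 0"
    unfolding homology_def bd by (intro image_cong) (auto simp: elt_set_plus_def)
  have cyc_sum: "(\<Sum>w\<in>V. z {w}) = 0" if "z \<in> cycles \<Delta> 0" for z :: "'a set \<Rightarrow> 'k"
  proof -
    have "bdry \<Delta> z {} = (\<Sum>w\<in>V. z {w})"
      using that \<open>V \<subseteq> \<Union>\<Delta>\<close> fin by (intro bdry_empty) (auto simp: V_def cycles_def chains_def)
    then show ?thesis using that by (simp add: cycles_def)
  qed
  have "\<exists>z\<in>cycles \<Delta> 0. z \<noteq> (0 :: 'a set \<Rightarrow> 'k)"
  proof (rule ccontr)
    assume "\<not> ?thesis"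
    then have "homology \<Delta> 0 \<subseteq> {{0 :: 'a set \<Rightarrow> 'k}}" unfolding H by auto
    then have "coordinate_space 1 \<subseteq> {\<phi> {0}}" using \<phi>(1) by (auto simp: bij_betw_def)
    moreover have "(\<lambda>_. 0) \<in> (coordinate_space 1 :: (nat \<Rightarrow> 'k) set)" "(\<lambda>j. if j = 0 then 1 else 0) \<in> (coordinate_space 1 :: (nat \<Rightarrow> 'k) set)"
      by (auto simp: coordinate_space_def)
    ultimately have "(\<lambda>_. 0) = \<phi> {0}" "(\<lambda>j :: nat. if j = 0 then 1 else 0 :: 'k) = \<phi> {0}" by blast+
    then have "(\<lambda>_. 0) = (\<lambda>j :: nat. if j = 0 then 1 else 0 :: 'k)" by (rule trans[OF _ sym])
    from fun_cong[OF this, of 0] show False by simp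
  qed
  then obtain z :: "'a set \<Rightarrow> 'k" where z: "z \<in> cycles \<Delta> 0" "z \<noteq> 0" by blast
  obtain \<sigma> where \<sigma>: "z \<sigma> \<noteq> 0" using z(2) by (auto simp: fun_eq_iff)
  then have "\<sigma> \<in> \<Delta>" "card \<sigma> = 1" using z(1) by (auto simp: cycles_def chains_def face_dim_def)
  then obtain a where a: "\<sigma> = {a}" "a \<in> V" by (auto simp: V_def card_1_singleton_iff)
  have "\<exists>b\<in>V. b \<noteq> a"
  proof (rule ccontr)
    assume "\<not> ?thesis"
    then have "V = {a}" using a(2) by blast
    then show False using cyc_sum[OF z(1)] \<sigma> a(1) by simp
  qed
  then obtain b where b: "b \<in> V" "b \<noteq> a" by blast
  have "V = {a, b}"
  proof (rule ccontr)
    assume "V \<noteq> {a, b}"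
    then obtain c where c: "c \<in> V" "c \<noteq> a" "c \<noteq> b" using a b by blast
    define z1 where "z1 = (vertex_chain a - vertex_chain b :: 'a set \<Rightarrow> 'k)"
    define z2 where "z2 = (vertex_chain a - vertex_chain c :: 'a set \<Rightarrow> 'k)"
    have z12: "z1 \<in> cycles \<Delta> 0" "z2 \<in> cycles \<Delta> 0"
      unfolding z1_def z2_def using a b c by (intro vertex_difference_cycle \<Delta>; simp add: V_def)+
    have Z: "{z1} \<in> homology \<Delta> 0" "{z2} \<in> homology \<Delta> 0" using z12 by (simp_all add: H)
    have sc: "{scale r y} \<in> homology \<Delta> 0" "\<phi> {scale r y} = scale r (\<phi> {y})" if "y \<in> cycles \<Delta> 0" for r y
    proof -
      have "bdry \<Delta> (scale r y) = scale r (bdry \<Delta> y)"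
        by (auto simp: bdry_def scale_def sum_distrib_left mult_ac)
      then have "scale r y \<in> cycles \<Delta> 0"
        using that by (auto simp: cycles_def chains_def scale_def)
      then show "{scale r y} \<in> homology \<Delta> 0" by (simp add: H)
      have "scale r ` {y} + boundaries \<Delta> 0 = {scale r y}" by (simp add: bd set_plus_def)
      then show "\<phi> {scale r y} = scale r (\<phi> {y})" using \<phi>(2)[of "{y}" r] that by (simp add: H)
    qed
    \<comment> \<open>Cross-multiplication: \<open>scale r z1\<close> and \<open>scale s z2\<close>
      have the same image under \<phi>, hence are equal, and their coefficients at \<open>b\<close>
      and \<open>c\<close> give r = s = 0.\<close>
    define r where "r = \<phi> {z2} 0"
    define s where "s = \<phi> {z1} 0"
    have in1: "\<phi> X \<in> coordinate_space 1" if "X \<in> homology \<Delta> 0" for X using bij_betwE[OF \<phi>(1)] that by blast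
    have "\<phi> {scale r z1} = \<phi> {scale s z2}"
      using sc[OF z12(1), of r] sc[OF z12(2), of s] by (intro coordinate_space_1_eqI in1) (simp_all add: scale_def r_def s_def)
    then have "{scale r z1} = {scale s z2}"
      using sc(1)[OF z12(1), of r] sc(1)[OF z12(2), of s] bij_betw_imp_inj_on[OF \<phi>(1)] by (metis inj_onD)
    then have eq: "scale r z1 = scale s z2" by simp
    have "r = 0" using fun_cong[OF eq, of "{b}"] b c by (simp add: scale_def z1_def z2_def vertex_chain_def)
    moreover have "s = 0" using fun_cong[OF eq, of "{c}"] b c by (simp add: scale_def z1_def z2_def vertex_chain_def)
    ultimately have "\<phi> {z1} = \<phi> {z2}" using Z by (intro coordinate_space_1_eqI in1) (simp_all add: r_def s_def)
    then have "{z1} = {z2}" using Z bij_betw_imp_inj_on[OF \<phi>(1)] by (metis inj_onD)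
    then have "z1 = z2" by simp
    from fun_cong[OF this, of "{b}"] show False using b c by (simp add: z1_def z2_def vertex_chain_def)
  qed
  then show ?thesis using b(2) unfolding V_def by simp
qed

lemma abstract_complex_link:
  assumes "abstract_complex \<Delta>" "\<rho> \<in> \<Delta>"
  shows "abstract_complex (link \<Delta> \<rho>)"
proof -
  have sub: "\<tau> \<in> \<Delta>" if "\<sigma> \<in> \<Delta>" "\<tau> \<subseteq> \<sigma>" for \<sigma> \<tau> using assms(1) that unfolding abstract_complex_def by blast
  have "\<tau> \<in> link \<Delta> \<rho>" if "\<sigma> \<in> link \<Delta> \<rho>" "\<tau> \<subseteq> \<sigma>" for \<sigma> \<tau>
  proof -
    have "\<sigma> \<in> \<Delta>" "\<sigma> \<inter> \<rho> = {}" "\<sigma> \<union> \<rho> \<in> \<Delta>" using that(1) by (auto simp: link_def)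
    moreover have "\<tau> \<union> \<rho> \<in> \<Delta>" by (rule sub[OF \<open>\<sigma> \<union> \<rho> \<in> \<Delta>\<close>]) (use that(2) in auto)
    ultimately show ?thesis using sub[OF \<open>\<sigma> \<in> \<Delta>\<close> that(2)] that(2) by (auto simp: link_def)
  qed
  moreover have "finite (link \<Delta> \<rho>)"
    using assms(1) by (auto simp: abstract_complex_def link_def)
  moreover have "{} \<in> link \<Delta> \<rho>" using assms by (simp add: abstract_complex_def link_def)
  moreover have "finite \<sigma>" if "\<sigma> \<in> link \<Delta> \<rho>" for \<sigma>
    using assms(1) that by (simp add: abstract_complex_def link_def)
  ultimately show ?thesis unfolding abstract_complex_def by blast
qed

definition vertex_point :: "'a \<Rightarrow> 'a \<Rightarrow> real" where
  "vertex_point v w = (if w = v then 1 else 0)"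

lemma vertex_point_support: "{w. vertex_point v w \<noteq> 0} = {v}"
  by (auto simp: vertex_point_def)

lemma vertex_point_realization: "{v} \<in> \<Delta> \<Longrightarrow> vertex_point v \<in> realization \<Delta>"
  unfolding realization_def mem_Collect_eq vertex_point_support by (simp add: vertex_point_def)

text \<open>The barycentric weight on the component of \<open>u\<close> is continuous, and it takes
  only the values 0 and 1 because the support of a point is a face and lies in one
  component.\<close>

lemma graph_connected_if_realization_connected:
  assumes \<Delta>: "abstract_complex \<Delta>" and conn: "connected (realization \<Delta>)"
    and u: "{u} \<in> \<Delta>" and v: "{v} \<in> \<Delta>"
  shows "(u, v) \<in> {(a, b). {a, b} \<in> \<Delta>}\<^sup>*"
proof (rule ccontr)
  assume contra: "(u, v) \<notin> {(a, b). {a, b} \<in> \<Delta>}\<^sup>*"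
  define A where "A = {w\<in>\<Union>\<Delta>. (u, w) \<in> {(a, b). {a, b} \<in> \<Delta>}\<^sup>*}"
  have fin: "finite (\<Union>\<Delta>)" using \<Delta> by (auto simp: abstract_complex_def)
  then have finA: "finite A" by (rule rev_finite_subset) (auto simp: A_def)
  have A: "u \<in> A" "v \<notin> A" using u contra by (auto simp: A_def)
  define f where "f x = (\<Sum>w\<in>A. x w)" for x :: "'a \<Rightarrow> real"
  have "continuous_on (realization \<Delta>) f"
    unfolding f_def by (intro continuous_on_sum continuous_on_subset[OF continuous_on_product_coordinates]) simp
  then have conn_f: "connected (f ` realization \<Delta>)" by (rule connected_continuous_image[OF _ conn])
  have val: "f x \<in> {0, 1}" if x: "x \<in> realization \<Delta>" for x
  proof -
    define S where "S = {w. x w \<noteq> 0}"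
    have S: "S \<in> \<Delta>" "(\<Sum>w\<in>S. x w) = 1" using x by (auto simp: realization_def S_def)
    have finS: "finite S" using \<Delta> S(1) by (simp add: abstract_complex_def)
    show ?thesis
    proof (cases "S \<inter> A = {}")
      case True
      then have "f x = 0" unfolding f_def by (intro sum.neutral) (auto simp: S_def)
      then show ?thesis by simp
    next
      case False
      then obtain w where w: "w \<in> S" "w \<in> A" by blast
      have "S \<subseteq> A"
      proof
        fix w' assume w': "w' \<in> S"
        have "{w, w'} \<in> \<Delta>" using \<Delta> S(1) w(1) w' unfolding abstract_complex_def by (metis empty_subsetI insert_subset)
        then show "w' \<in> A" using w(2) w' S(1) by (auto simp: A_def intro: rtrancl_into_rtrancl)
      qed
      then have "f x = (\<Sum>w\<in>S. x w)" unfolding f_def by (intro sum.mono_neutral_right finA) (auto simp: S_def)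
      then show ?thesis using S(2) by simp
    qed
  qed
  have "f (vertex_point u) = 1" "f (vertex_point v) = 0"
    using A finA by (simp_all add: f_def vertex_point_def)
  then have "0 \<in> f ` realization \<Delta>" "1 \<in> f ` realization \<Delta>"
    using vertex_point_realization[OF u] vertex_point_realization[OF v] by (metis imageI)+
  then have "1 / 2 \<in> f ` realization \<Delta>"
    using connectedD_interval[OF conn_f, of 0 1 "1 / 2"] by simp
  then show False using val by force
qed

text \<open>The empty boundary excludes links with the homology of a ball. The link of a ridge then
  has the homology of a 0-sphere, hence two vertices; for links of higher dimension the reduced
  homology in degree 0 vanishes, and they are connected.\<close>

lemma closed_homology_manifold_normal:
  fixes \<Delta> :: "'a::linorder set set"
  assumes mfd: "closed_homology_manifold TYPE('k::field) d \<Delta>" and conn: "connected (realization \<Delta>)"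
    and pure: "pure_of_dim (int d - 1) \<Delta>" and d: "4 \<le> d"
  shows "normal_pseudomanifold \<Delta> d"
proof -
  have \<Delta>: "abstract_complex \<Delta>" using mfd by (simp add: closed_homology_manifold_def homology_manifold_def)
  then have fin\<Delta>: "finite \<Delta>" and fin: "\<And>\<sigma>. \<sigma> \<in> \<Delta> \<Longrightarrow> finite \<sigma>" by (simp_all add: abstract_complex_def)
  have sub: "\<tau> \<in> \<Delta>" if "\<sigma> \<in> \<Delta>" "\<tau> \<subseteq> \<sigma>" for \<sigma> \<tau> using \<Delta> that unfolding abstract_complex_def by blast
  have sphere: "homology_iso TYPE('k) (link \<Delta> \<rho>) i (if i = int d - int (card \<rho>) - 1 then 1 else 0)"
    if "\<rho> \<in> \<Delta>" "\<rho> \<noteq> {}" for \<rho> i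
  proof -
    have "\<not> homology_iso TYPE('k) (link \<Delta> \<rho>) (int d - int (card \<rho>) - 1) 0"
      using mfd that(1) unfolding closed_homology_manifold_def manifold_boundary_def by blast
    then have "\<not> has_ball_homology TYPE('k) (link \<Delta> \<rho>)" by (auto simp: has_ball_homology_def)
    then have "has_sphere_homology TYPE('k) (int d - int (card \<rho>) - 1) (link \<Delta> \<rho>)"
      using mfd that unfolding closed_homology_manifold_def homology_manifold_def by blast
    then show ?thesis by (simp add: has_sphere_homology_def)
  qed
  have facet: "\<exists>\<sigma>\<in>\<Delta>. \<rho> \<subseteq> \<sigma> \<and> card \<sigma> = d" if \<rho>: "\<rho> \<in> \<Delta>" for \<rho>
  proof -
    obtain \<sigma> where \<sigma>: "\<sigma> \<in> \<Delta>" "\<rho> \<subseteq> \<sigma>" "\<And>\<tau>. \<tau> \<in> \<Delta> \<Longrightarrow> \<sigma> \<subseteq> \<tau> \<Longrightarrow> \<sigma> = \<tau>"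
      using finite_has_maximal2[OF fin\<Delta> \<rho>] by blast
    then have "\<sigma> \<in> facets \<Delta>" by (auto simp: facets_def)
    then have "face_dim \<sigma> = int d - 1" using pure by (simp add: pure_of_dim_def)
    then show ?thesis using \<sigma> by (auto simp: face_dim_def)
  qed
  show ?thesis
  proof
    show "card {\<sigma>\<in>\<Delta>. card \<sigma> = d \<and> \<rho> \<subseteq> \<sigma>} = 2" if \<rho>: "\<rho> \<in> \<Delta>" "Suc (card \<rho>) = d" for \<rho>
    proof -
      have ne: "\<rho> \<noteq> {}" using \<rho>(2) d by auto
      have "card {w. {w} \<in> link \<Delta> \<rho>} = 2"
      proof (rule two_vertices_if_homology_0_1[where 'k = 'k])
        show "abstract_complex (link \<Delta> \<rho>)" by (rule abstract_complex_link[OF \<Delta> \<rho>(1)])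
        have "0 = int d - int (card \<rho>) - 1" using \<rho>(2) by linarith
        then show "homology_iso TYPE('k) (link \<Delta> \<rho>) 0 1" using sphere[OF \<rho>(1) ne, of 0] by simp
        fix \<tau> assume "\<tau> \<in> link \<Delta> \<rho>"
        then have \<tau>: "\<tau> \<in> \<Delta>" "\<tau> \<inter> \<rho> = {}" "\<tau> \<union> \<rho> \<in> \<Delta>" by (auto simp: link_def)
        obtain \<sigma> where \<sigma>: "\<sigma> \<in> \<Delta>" "\<tau> \<union> \<rho> \<subseteq> \<sigma>" "card \<sigma> = d" using facet[OF \<tau>(3)] by blast
        have "card (\<tau> \<union> \<rho>) \<le> d" using card_mono[OF fin[OF \<sigma>(1)] \<sigma>(2)] \<sigma>(3) by simp
        then show "card \<tau> \<le> 1" using card_Un_disjoint[OF fin[OF \<tau>(1)] fin[OF \<rho>(1)] \<tau>(2)] \<rho>(2) by linarith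
      qed
      also have "card {w. {w} \<in> link \<Delta> \<rho>} = card {\<sigma>\<in>\<Delta>. card \<sigma> = d \<and> \<rho> \<subseteq> \<sigma>}"
      proof (rule bij_betw_same_card[where f = "\<lambda>w. insert w \<rho>"], rule bij_betw_imageI)
        show "inj_on (\<lambda>w. insert w \<rho>) {w. {w} \<in> link \<Delta> \<rho>}"
          by (auto simp: inj_on_def link_def)
        show "(\<lambda>w. insert w \<rho>) ` {w. {w} \<in> link \<Delta> \<rho>} = {\<sigma>\<in>\<Delta>. card \<sigma> = d \<and> \<rho> \<subseteq> \<sigma>}"
        proof (intro equalityI subsetI)
          fix \<sigma> assume "\<sigma> \<in> (\<lambda>w. insert w \<rho>) ` {w. {w} \<in> link \<Delta> \<rho>}"
          then show "\<sigma> \<in> {\<sigma>\<in>\<Delta>. card \<sigma> = d \<and> \<rho> \<subseteq> \<sigma>}"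
            using \<rho>(2) fin[OF \<rho>(1)] by (auto simp: link_def)
        next
          fix \<sigma> assume "\<sigma> \<in> {\<sigma>\<in>\<Delta>. card \<sigma> = d \<and> \<rho> \<subseteq> \<sigma>}"
          then have \<sigma>: "\<sigma> \<in> \<Delta>" "card \<sigma> = d" "\<rho> \<subseteq> \<sigma>" by auto
          then have "card (\<sigma> - \<rho>) = 1" using \<rho>(2) fin[OF \<rho>(1)] by (simp add: card_Diff_subset)
          then obtain w where w: "\<sigma> - \<rho> = {w}" by (auto simp: card_1_singleton_iff)
          then have eq: "\<sigma> = insert w \<rho>" "w \<notin> \<rho>" using \<sigma>(3) by auto
          have "{w} \<in> \<Delta>" using \<sigma>(1) eq(1) by (auto intro: sub)
          then have "{w} \<in> link \<Delta> \<rho>" using \<sigma>(1) eq by (simp add: link_def)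
          then show "\<sigma> \<in> (\<lambda>w. insert w \<rho>) ` {w. {w} \<in> link \<Delta> \<rho>}" using eq(1) by blast
        qed
      qed
      finally show ?thesis .
    qed
    show "(u, v) \<in> {(a, b). {a, b} \<in> link \<Delta> \<rho>}\<^sup>*"
      if \<rho>: "\<rho> \<in> \<Delta>" "\<rho> \<noteq> {}" "card \<rho> + 2 \<le> d" and uv: "{u} \<in> link \<Delta> \<rho>" "{v} \<in> link \<Delta> \<rho>" for \<rho> u v
    proof (rule graph_connected_if_homology_0[where 'k = 'k, OF abstract_complex_link[OF \<Delta> \<rho>(1)] _ uv])
      have "0 \<noteq> int d - int (card \<rho>) - 1" using \<rho>(3) by linarith
      then show "homology_iso TYPE('k) (link \<Delta> \<rho>) 0 0" using sphere[OF \<rho>(1,2), of 0] by simp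
    qed
    show "(u, v) \<in> {(a, b). {a, b} \<in> \<Delta>}\<^sup>*" if "{u} \<in> \<Delta>" "{v} \<in> \<Delta>" for u v
      by (rule graph_connected_if_realization_connected[OF \<Delta> conn that])
  qed (use \<Delta> d facet in auto)
qed

section \<open>The cosets of a subgroup of the fundamental group\<close>

text \<open>The parameter interval is convex, so \<open>f\<close> and \<open>g\<close> are homotopic
  by straight lines, and \<open>p\<close> pushes the homotopy forward. The laws for subpaths,
  constant paths and reversal below come from this.\<close>

lemma homotopic_paths_compose_interval:
  assumes p: "path p" "path_image p \<subseteq> S"
    and f: "path f" "path_image f \<subseteq> {0..1::real}" and g: "path g" "path_image g \<subseteq> {0..1}"
    and eq: "pathstart g = pathstart f" "pathfinish g = pathfinish f"
  shows "homotopic_paths S (p \<circ> f) (p \<circ> g)"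
proof -
  have "homotopic_paths {0..1} f g"
  proof (rule homotopic_paths_linear[OF f(1) g(1) eq])
    fix s :: real assume "s \<in> {0..1}"
    then have "f s \<in> {0..1}" "g s \<in> {0..1}"
      using f(2) g(2) unfolding path_image_def image_subset_iff by blast+
    then show "closed_segment (f s) (g s) \<subseteq> {0..1}" by (rule closed_segment_subset) simp
  qed
  then show ?thesis
    by (rule homotopic_paths_continuous_image) (use p in \<open>auto simp: path_def path_image_def\<close>)
qed

definition const_path :: "'b \<Rightarrow> real \<Rightarrow> 'b" where
  "const_path y = (\<lambda>_. y)"

text \<open>The case \<open>a > b\<close> is allowed: \<open>sub_path p 1 0\<close> is the reversed
  path and \<open>sub_path p a a\<close> a constant one, so \<open>homotopic_sub_paths_join\<close>
  covers the unit laws and the inverse law at once.\<close>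

definition sub_path :: "(real \<Rightarrow> 'b) \<Rightarrow> real \<Rightarrow> real \<Rightarrow> real \<Rightarrow> 'b" where
  "sub_path p a b = p \<circ> linepath a b"

lemma const_path: "path (const_path y)" "pathstart (const_path y) = y" "pathfinish (const_path y) = y"
  "path_image (const_path y) = {y}"
  by (auto simp: const_path_def path_def pathstart_def pathfinish_def path_image_def)

lemma linepath_image_unit: "a \<in> {0..1} \<Longrightarrow> b \<in> {0..1} \<Longrightarrow> path_image (linepath a b) \<subseteq> {0..1::real}"
  unfolding path_image_linepath by (rule closed_segment_subset) auto

lemma sub_path:
  assumes "path p" "a \<in> {0..1}" "b \<in> {0..1}"
  shows "path (sub_path p a b)" "pathstart (sub_path p a b) = p a" "pathfinish (sub_path p a b) = p b"
    "path_image (sub_path p a b) = p ` closed_segment a b"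
proof -
  show "path (sub_path p a b)"
    unfolding sub_path_def
    by (rule path_continuous_image) (use assms linepath_image_unit[OF assms(2,3)] in \<open>auto simp: path_def intro: continuous_on_subset\<close>)
  show "pathstart (sub_path p a b) = p a" "pathfinish (sub_path p a b) = p b"
    by (simp_all add: sub_path_def pathstart_compose pathfinish_compose)
  show "path_image (sub_path p a b) = p ` closed_segment a b"
    by (simp add: sub_path_def path_image_compose)
qed

lemma sub_path_0_1: "sub_path p 0 1 = p"
  by (auto simp: sub_path_def linepath_def)

lemma homotopic_sub_paths_join:
  assumes p: "path p" "path_image p \<subseteq> S" and abc: "a \<in> {0..1}" "b \<in> {0..1}" "c \<in> {0..1}"
  shows "homotopic_paths S (sub_path p a b +++ sub_path p b c) (sub_path p a c)"
proof -
  have "homotopic_paths S (p \<circ> (linepath a b +++ linepath b c)) (p \<circ> linepath a c)"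
  proof (rule homotopic_paths_compose_interval[OF p])
    show "path_image (linepath a b +++ linepath b c) \<subseteq> {0..1}"
      using path_image_join_subset linepath_image_unit abc by blast
  qed (use abc linepath_image_unit in auto)
  then show ?thesis by (simp add: path_compose_join sub_path_def)
qed

lemma homotopic_join_const:
  assumes "path p" "path_image p \<subseteq> S" "pathfinish p = y"
  shows "homotopic_paths S (p +++ const_path y) p"
proof -
  have "homotopic_paths S (sub_path p 0 1 +++ sub_path p 1 1) (sub_path p 0 1)"
    by (rule homotopic_sub_paths_join[OF assms(1,2)]) auto
  moreover have "sub_path p 1 1 = const_path y"
    using assms(3) by (auto simp: sub_path_def const_path_def pathfinish_def linepath_def)
  ultimately show ?thesis by (simp add: sub_path_0_1)
qed

lemma homotopic_const_join:
  assumes "path p" "path_image p \<subseteq> S" "pathstart p = y"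
  shows "homotopic_paths S (const_path y +++ p) p"
proof -
  have "homotopic_paths S (sub_path p 0 0 +++ sub_path p 0 1) (sub_path p 0 1)"
    by (rule homotopic_sub_paths_join[OF assms(1,2)]) auto
  moreover have "sub_path p 0 0 = const_path y"
    using assms(3) by (auto simp: sub_path_def const_path_def pathstart_def linepath_def)
  ultimately show ?thesis by (simp add: sub_path_0_1)
qed

lemma homotopic_join_reversepath:
  assumes "path p" "path_image p \<subseteq> S" "pathstart p = y"
  shows "homotopic_paths S (p +++ reversepath p) (const_path y)"
proof -
  have "homotopic_paths S (sub_path p 0 1 +++ sub_path p 1 0) (sub_path p 0 0)"
    by (rule homotopic_sub_paths_join[OF assms(1,2)]) auto
  moreover have "sub_path p 0 0 = const_path y"
    using assms(3) by (auto simp: sub_path_def const_path_def pathstart_def linepath_def)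
  moreover have "sub_path p 1 0 = reversepath p"
    by (auto simp: sub_path_def reversepath_def linepath_def algebra_simps)
  ultimately show ?thesis by (simp add: sub_path_0_1)
qed

definition paths_between :: "'b::topological_space set \<Rightarrow> 'b \<Rightarrow> 'b \<Rightarrow> (real \<Rightarrow> 'b) set" where
  "paths_between S y z = {p. path p \<and> path_image p \<subseteq> S \<and> pathstart p = y \<and> pathfinish p = z}"

lemma paths_between_join: "p \<in> paths_between S a b \<Longrightarrow> q \<in> paths_between S b c \<Longrightarrow> p +++ q \<in> paths_between S a c"
  using path_image_join_subset[of p q] by (auto simp: paths_between_def)

lemma paths_between_reverse: "p \<in> paths_between S a b \<Longrightarrow> reversepath p \<in> paths_between S b a"
  by (simp add: paths_between_def)

lemma paths_between_const: "a \<in> S \<Longrightarrow> const_path a \<in> paths_between S a a"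
  by (simp add: paths_between_def const_path)

lemma paths_between_homotopic:
  "homotopic_paths S p q \<Longrightarrow> p \<in> paths_between S a b \<Longrightarrow> q \<in> paths_between S a b"
  using homotopic_paths_imp_path homotopic_paths_imp_subset homotopic_paths_imp_pathstart homotopic_paths_imp_pathfinish
  unfolding paths_between_def by (metis (mono_tags, lifting) mem_Collect_eq)

lemma homotopic_assoc:
  assumes "p \<in> paths_between S a b" "q \<in> paths_between S b c" "r \<in> paths_between S c e"
  shows "homotopic_paths S ((p +++ q) +++ r) (p +++ (q +++ r))"
  using assms unfolding paths_between_def
  by (intro homotopic_paths_sym[OF homotopic_paths_assoc]) simp_all

lemma homotopic_join:
  assumes "homotopic_paths S p p'" "homotopic_paths S q q'" "p \<in> paths_between S a b" "q \<in> paths_between S b c"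
  shows "homotopic_paths S (p +++ q) (p' +++ q')"
  using assms by (intro homotopic_paths_join) (simp_all add: paths_between_def)

lemma homotopic_refl: "p \<in> paths_between S a b \<Longrightarrow> homotopic_paths S p p"
  by (simp add: paths_between_def)

lemma homotopic_cancel:
  assumes p: "p \<in> paths_between S a b" and q: "q \<in> paths_between S b c"
  shows "homotopic_paths S ((p +++ q) +++ reversepath q) p"
proof -
  have q': "reversepath q \<in> paths_between S c b" by (rule paths_between_reverse[OF q])
  have "homotopic_paths S ((p +++ q) +++ reversepath q) (p +++ (q +++ reversepath q))"
    by (rule homotopic_assoc[OF p q q'])
  also have "homotopic_paths S (p +++ (q +++ reversepath q)) (p +++ const_path b)"
    using q by (intro homotopic_join[OF homotopic_refl[OF p] _ p paths_between_join[OF q q']] homotopic_join_reversepath)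
      (simp_all add: paths_between_def)
  also have "homotopic_paths S (p +++ const_path b) p"
    using p by (intro homotopic_join_const) (simp_all add: paths_between_def)
  finally show ?thesis .
qed

lemma homotopic_cancel':
  assumes p: "p \<in> paths_between S a b" and q: "q \<in> paths_between S c b"
  shows "homotopic_paths S ((p +++ reversepath q) +++ q) p"
  using homotopic_cancel[OF p paths_between_reverse[OF q]] by simp

lemma homotopy_class_eq_iff:
  "p \<in> paths_between S a b \<Longrightarrow> homotopy_class S p = homotopy_class S q \<longleftrightarrow> homotopic_paths S p q"
proof
  assume p: "p \<in> paths_between S a b" and "homotopy_class S p = homotopy_class S q"
  moreover have "p \<in> homotopy_class S p" using homotopic_refl[OF p] by (simp add: homotopy_class_def)
  ultimately show "homotopic_paths S p q" by (simp add: homotopy_class_def homotopic_paths_sym)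
next
  assume "homotopic_paths S p q"
  then show "homotopy_class S p = homotopy_class S q"
    unfolding homotopy_class_def using homotopic_paths_trans homotopic_paths_sym by blast
qed

section \<open>The fundamental group and classes of paths modulo a subgroup\<close>

context
  fixes S :: "'b::topological_space set" and x :: 'b
  assumes x: "x \<in> S"
begin

abbreviation "\<pi>\<^sub>1 \<equiv> fundamental_group S x"

lemma carrier_fundamental_group: "carrier \<pi>\<^sub>1 = homotopy_class S ` paths_between S x x"
  by (simp add: fundamental_group_def loops_at_def paths_between_def)

text \<open>The union in the definition runs over equal sets, because joining respects
  homotopy.\<close>

lemma fundamental_group_mult:
  assumes p: "p \<in> paths_between S x x" and q: "q \<in> paths_between S x x"
  shows "homotopy_class S p \<otimes>\<^bsub>\<pi>\<^sub>1\<^esub> homotopy_class S q = homotopy_class S (p +++ q)"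
proof -
  have eq: "homotopy_class S (p' +++ q') = homotopy_class S (p +++ q)"
    if "p' \<in> homotopy_class S p" "q' \<in> homotopy_class S q" for p' q'
  proof -
    have "homotopic_paths S (p +++ q) (p' +++ q')"
      using that by (intro homotopic_join[OF _ _ p q]) (simp_all add: homotopy_class_def)
    then have "homotopy_class S (p +++ q) = homotopy_class S (p' +++ q')"
      using homotopy_class_eq_iff[OF paths_between_join[OF p q]] by blast
    then show ?thesis by simp
  qed
  have ne: "p \<in> homotopy_class S p" "q \<in> homotopy_class S q"
    using homotopic_refl[OF p] homotopic_refl[OF q] by (simp_all add: homotopy_class_def)
  have "(\<Union>p'\<in>homotopy_class S p. \<Union>q'\<in>homotopy_class S q. homotopy_class S (p' +++ q')) = homotopy_class S (p +++ q)"
    by (intro UN_constant_eq[OF ne(1)] UN_constant_eq[OF ne(2)] eq ballI)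
  then show ?thesis by (simp add: fundamental_group_def)
qed

lemma fundamental_group_one: "\<one>\<^bsub>\<pi>\<^sub>1\<^esub> = homotopy_class S (const_path x)"
  by (simp add: fundamental_group_def const_path_def)

lemma group_fundamental_group: "group \<pi>\<^sub>1"
proof (rule groupI)
  show "\<one>\<^bsub>\<pi>\<^sub>1\<^esub> \<in> carrier \<pi>\<^sub>1"
    unfolding carrier_fundamental_group fundamental_group_one using paths_between_const[OF x] by blast
  fix A assume "A \<in> carrier \<pi>\<^sub>1"
  then obtain p where p: "p \<in> paths_between S x x" "A = homotopy_class S p"
    unfolding carrier_fundamental_group by blast
  have "homotopic_paths S (const_path x +++ p) p"
    using p(1) by (intro homotopic_const_join) (simp_all add: paths_between_def)
  then show "\<one>\<^bsub>\<pi>\<^sub>1\<^esub> \<otimes>\<^bsub>\<pi>\<^sub>1\<^esub> A = A"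
    unfolding p(2) fundamental_group_one fundamental_group_mult[OF paths_between_const[OF x] p(1)]
    using homotopy_class_eq_iff[OF paths_between_join[OF paths_between_const[OF x] p(1)]] by blast
  have p': "reversepath p \<in> paths_between S x x" by (rule paths_between_reverse[OF p(1)])
  have "homotopic_paths S (reversepath p +++ p) (const_path x)"
    using homotopic_join_reversepath[of "reversepath p" S x] p' by (simp add: paths_between_def)
  then have "homotopy_class S (reversepath p) \<otimes>\<^bsub>\<pi>\<^sub>1\<^esub> A = \<one>\<^bsub>\<pi>\<^sub>1\<^esub>"
    unfolding p(2) fundamental_group_one fundamental_group_mult[OF p' p(1)]
    using homotopy_class_eq_iff[OF paths_between_join[OF p' p(1)]] by blast
  then show "\<exists>B\<in>carrier \<pi>\<^sub>1. B \<otimes>\<^bsub>\<pi>\<^sub>1\<^esub> A = \<one>\<^bsub>\<pi>\<^sub>1\<^esub>"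
    using p' unfolding carrier_fundamental_group by blast
  fix B assume "B \<in> carrier \<pi>\<^sub>1"
  then obtain q where q: "q \<in> paths_between S x x" "B = homotopy_class S q"
    unfolding carrier_fundamental_group by blast
  show "A \<otimes>\<^bsub>\<pi>\<^sub>1\<^esub> B \<in> carrier \<pi>\<^sub>1"
    unfolding p(2) q(2) fundamental_group_mult[OF p(1) q(1)] carrier_fundamental_group
    using paths_between_join[OF p(1) q(1)] by blast
  fix C assume "C \<in> carrier \<pi>\<^sub>1"
  then obtain r where r: "r \<in> paths_between S x x" "C = homotopy_class S r"
    unfolding carrier_fundamental_group by blast
  note pq = paths_between_join[OF p(1) q(1)] and qr = paths_between_join[OF q(1) r(1)]
  show "A \<otimes>\<^bsub>\<pi>\<^sub>1\<^esub> B \<otimes>\<^bsub>\<pi>\<^sub>1\<^esub> C = A \<otimes>\<^bsub>\<pi>\<^sub>1\<^esub> (B \<otimes>\<^bsub>\<pi>\<^sub>1\<^esub> C)"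
    unfolding p(2) q(2) r(2) fundamental_group_mult[OF p(1) q(1)] fundamental_group_mult[OF q(1) r(1)]
      fundamental_group_mult[OF pq r(1)] fundamental_group_mult[OF p(1) qr]
    using homotopy_class_eq_iff[OF paths_between_join[OF pq r(1)]] homotopic_assoc[OF p(1) q(1) r(1)] by blast
qed

lemma fundamental_group_inv:
  assumes p: "p \<in> paths_between S x x"
  shows "inv\<^bsub>\<pi>\<^sub>1\<^esub> (homotopy_class S p) = homotopy_class S (reversepath p)"
proof (rule group.inv_equality[OF group_fundamental_group])
  have p': "reversepath p \<in> paths_between S x x" by (rule paths_between_reverse[OF p])
  have "homotopic_paths S (reversepath p +++ p) (const_path x)"
    using homotopic_join_reversepath[of "reversepath p" S x] p' by (simp add: paths_between_def)
  then show "homotopy_class S (reversepath p) \<otimes>\<^bsub>\<pi>\<^sub>1\<^esub> homotopy_class S p = \<one>\<^bsub>\<pi>\<^sub>1\<^esub>"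
    unfolding fundamental_group_one fundamental_group_mult[OF p' p]
    using homotopy_class_eq_iff[OF paths_between_join[OF p' p]] by blast
  show "homotopy_class S p \<in> carrier \<pi>\<^sub>1" "homotopy_class S (reversepath p) \<in> carrier \<pi>\<^sub>1"
    using p p' unfolding carrier_fundamental_group by blast+
qed

text \<open>In the cover that belongs to \<open>H\<close>, the points over \<open>y\<close> are the
  paths from \<open>x\<close> to \<open>y\<close> modulo this relation.\<close>

definition same_coset :: "(real \<Rightarrow> 'b) set set \<Rightarrow> (real \<Rightarrow> 'b) \<Rightarrow> (real \<Rightarrow> 'b) \<Rightarrow> bool" where
  "same_coset H p q \<longleftrightarrow> homotopy_class S (p +++ reversepath q) \<in> H"

context
  fixes H assumes H: "subgroup H \<pi>\<^sub>1"
begin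

lemma same_coset_homotopic:
  assumes p: "p \<in> paths_between S x y" and "homotopic_paths S p q"
  shows "same_coset H p q"
proof -
  have q: "q \<in> paths_between S x y" by (rule paths_between_homotopic[OF assms(2,1)])
  have "homotopic_paths S (p +++ reversepath q) (q +++ reversepath q)"
    by (rule homotopic_join[OF assms(2) homotopic_refl[OF paths_between_reverse[OF q]] p paths_between_reverse[OF q]])
  also have "homotopic_paths S (q +++ reversepath q) (const_path x)"
    using q by (intro homotopic_join_reversepath) (simp_all add: paths_between_def)
  finally have "homotopy_class S (p +++ reversepath q) = \<one>\<^bsub>\<pi>\<^sub>1\<^esub>"
    unfolding fundamental_group_one
    using homotopy_class_eq_iff[OF paths_between_join[OF p paths_between_reverse[OF q]]] by blast
  then show ?thesis using subgroup.one_closed[OF H] by (simp add: same_coset_def)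
qed

lemma same_coset_refl: "p \<in> paths_between S x y \<Longrightarrow> same_coset H p p"
  by (rule same_coset_homotopic[OF _ homotopic_refl])

lemma same_coset_sym:
  assumes p: "p \<in> paths_between S x y" and q: "q \<in> paths_between S x y" and "same_coset H p q"
  shows "same_coset H q p"
proof -
  have "inv\<^bsub>\<pi>\<^sub>1\<^esub> (homotopy_class S (p +++ reversepath q)) = homotopy_class S (q +++ reversepath p)"
    using p q fundamental_group_inv[OF paths_between_join[OF p paths_between_reverse[OF q]]]
    by (simp add: reversepath_joinpaths paths_between_def)
  then show ?thesis using assms(3) subgroup.m_inv_closed[OF H] by (metis same_coset_def)
qed

lemma same_coset_trans:
  assumes p: "p \<in> paths_between S x y" and q: "q \<in> paths_between S x y" and r: "r \<in> paths_between S x y"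
    and "same_coset H p q" "same_coset H q r"
  shows "same_coset H p r"
proof -
  note q' = paths_between_reverse[OF q] and r' = paths_between_reverse[OF r]
  note pq' = paths_between_join[OF p q'] and qr' = paths_between_join[OF q r']
  have "homotopic_paths S (((p +++ reversepath q) +++ q) +++ reversepath r) (p +++ reversepath r)"
    by (rule homotopic_join[OF homotopic_cancel'[OF p q] homotopic_refl[OF r'] paths_between_join[OF pq' q] r'])
  then have "homotopic_paths S ((p +++ reversepath q) +++ (q +++ reversepath r)) (p +++ reversepath r)"
    using homotopic_paths_trans[OF homotopic_paths_sym[OF homotopic_assoc[OF pq' q r']]] by blast
  then have "homotopy_class S (p +++ reversepath q) \<otimes>\<^bsub>\<pi>\<^sub>1\<^esub> homotopy_class S (q +++ reversepath r) = homotopy_class S (p +++ reversepath r)"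
    unfolding fundamental_group_mult[OF pq' qr'] homotopy_class_eq_iff[OF paths_between_join[OF pq' qr']] .
  then show ?thesis using assms(4,5) subgroup.m_closed[OF H] by (metis same_coset_def)
qed

text \<open>Prolonging both paths by \<open>r\<close> does not change the class of
  \<open>p +++ reversepath q\<close>; this makes lifting along an edge well defined.\<close>

lemma same_coset_join:
  assumes p: "p \<in> paths_between S x y" and q: "q \<in> paths_between S x y" and r: "r \<in> paths_between S y z"
    and "same_coset H p q"
  shows "same_coset H (p +++ r) (q +++ r)"
proof -
  note q' = paths_between_reverse[OF q] and r' = paths_between_reverse[OF r]
  have rev: "reversepath (q +++ r) = reversepath r +++ reversepath q"
    using q r by (intro reversepath_joinpaths) (simp add: paths_between_def)
  have "homotopic_paths S ((p +++ r) +++ (reversepath r +++ reversepath q)) (((p +++ r) +++ reversepath r) +++ reversepath q)"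
    by (rule homotopic_paths_sym[OF homotopic_assoc[OF paths_between_join[OF p r] r' q']])
  also have "homotopic_paths S (((p +++ r) +++ reversepath r) +++ reversepath q) (p +++ reversepath q)"
    by (rule homotopic_join[OF homotopic_cancel[OF p r] homotopic_refl[OF q'] paths_between_join[OF paths_between_join[OF p r] r'] q'])
  finally have "homotopy_class S ((p +++ r) +++ reversepath (q +++ r)) = homotopy_class S (p +++ reversepath q)"
    unfolding rev
    using homotopy_class_eq_iff[OF paths_between_join[OF paths_between_join[OF p r] paths_between_join[OF r' q']]] by blast
  then show ?thesis using assms(4) by (simp add: same_coset_def)
qed

definition path_coset :: "'b \<Rightarrow> (real \<Rightarrow> 'b) \<Rightarrow> (real \<Rightarrow> 'b) set" where
  "path_coset y p = {q \<in> paths_between S x y. same_coset H p q}"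

lemma path_coset_eq_iff:
  assumes p: "p \<in> paths_between S x y" and q: "q \<in> paths_between S x y"
  shows "path_coset y p = path_coset y q \<longleftrightarrow> same_coset H p q"
proof
  assume "path_coset y p = path_coset y q"
  moreover have "q \<in> path_coset y q" using q same_coset_refl[OF q] by (simp add: path_coset_def)
  ultimately show "same_coset H p q" by (auto simp: path_coset_def)
next
  assume pq: "same_coset H p q"
  have qp: "same_coset H q p" by (rule same_coset_sym[OF p q pq])
  have "same_coset H p r \<longleftrightarrow> same_coset H q r" if "r \<in> paths_between S x y" for r
    using same_coset_trans[OF q p that qp] same_coset_trans[OF p q that pq] by blast
  then show "path_coset y p = path_coset y q" unfolding path_coset_def by (intro Collect_cong conj_cong refl)
qed

text \<open>A fixed path \<open>\<gamma>\<close> closes every path to \<open>y\<close> up to a loop,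
  and two paths are equivalent exactly when these loops lie in the same right coset. The map on
  loops is constant on each class, which is why \<open>the_elem\<close> of its image makes
  sense.\<close>

lemma card_path_cosets:
  assumes g: "\<gamma> \<in> paths_between S x y"
  shows "bij_betw (\<lambda>X. the_elem ((\<lambda>p. H #>\<^bsub>\<pi>\<^sub>1\<^esub> homotopy_class S (p +++ reversepath \<gamma>)) ` X))
    (path_coset y ` paths_between S x y) (rcosets\<^bsub>\<pi>\<^sub>1\<^esub> H)"
proof -
  interpret G: group \<pi>\<^sub>1 by (rule group_fundamental_group)
  interpret H: subgroup H \<pi>\<^sub>1 by (rule H)
  define \<Phi> where "\<Phi> p = H #>\<^bsub>\<pi>\<^sub>1\<^esub> homotopy_class S (p +++ reversepath \<gamma>)" for p
  note g' = paths_between_reverse[OF g]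
  have car: "homotopy_class S (p +++ reversepath \<gamma>) \<in> carrier \<pi>\<^sub>1" if "p \<in> paths_between S x y" for p
    unfolding carrier_fundamental_group using paths_between_join[OF that g'] by blast
  have same: "\<Phi> p = \<Phi> q \<longleftrightarrow> same_coset H p q" if p: "p \<in> paths_between S x y" and q: "q \<in> paths_between S x y" for p q
  proof -
    note pg = paths_between_join[OF p g'] and qg = paths_between_join[OF q g'] and q' = paths_between_reverse[OF q]
    have rev: "reversepath (q +++ reversepath \<gamma>) = \<gamma> +++ reversepath q"
      using q g by (simp add: reversepath_joinpaths paths_between_def)
    note gq = paths_between_join[OF g q']
    have "homotopic_paths S (((p +++ reversepath \<gamma>) +++ \<gamma>) +++ reversepath q) (p +++ reversepath q)"
      by (rule homotopic_join[OF homotopic_cancel'[OF p g] homotopic_refl[OF q'] paths_between_join[OF pg g] q'])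
    then have "homotopic_paths S ((p +++ reversepath \<gamma>) +++ (\<gamma> +++ reversepath q)) (p +++ reversepath q)"
      using homotopic_paths_trans[OF homotopic_paths_sym[OF homotopic_assoc[OF pg g q']]] by blast
    then have "homotopy_class S (p +++ reversepath \<gamma>) \<otimes>\<^bsub>\<pi>\<^sub>1\<^esub> inv\<^bsub>\<pi>\<^sub>1\<^esub> homotopy_class S (q +++ reversepath \<gamma>)
        = homotopy_class S (p +++ reversepath q)"
      unfolding fundamental_group_inv[OF qg] rev fundamental_group_mult[OF pg gq]
        homotopy_class_eq_iff[OF paths_between_join[OF pg gq]] .
    moreover have "\<Phi> p = \<Phi> q \<longleftrightarrow> homotopy_class S (p +++ reversepath \<gamma>) \<otimes>\<^bsub>\<pi>\<^sub>1\<^esub> inv\<^bsub>\<pi>\<^sub>1\<^esub> homotopy_class S (q +++ reversepath \<gamma>) \<in> H"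
    proof
      assume "\<Phi> p = \<Phi> q"
      then have "homotopy_class S (p +++ reversepath \<gamma>) \<in> H #>\<^bsub>\<pi>\<^sub>1\<^esub> homotopy_class S (q +++ reversepath \<gamma>)"
        using G.rcos_self[OF car[OF p] H] by (simp add: \<Phi>_def)
      then show "homotopy_class S (p +++ reversepath \<gamma>) \<otimes>\<^bsub>\<pi>\<^sub>1\<^esub> inv\<^bsub>\<pi>\<^sub>1\<^esub> homotopy_class S (q +++ reversepath \<gamma>) \<in> H"
        using H.rcos_module_imp[OF group_fundamental_group car[OF q]] by blast
    next
      assume "homotopy_class S (p +++ reversepath \<gamma>) \<otimes>\<^bsub>\<pi>\<^sub>1\<^esub> inv\<^bsub>\<pi>\<^sub>1\<^esub> homotopy_class S (q +++ reversepath \<gamma>) \<in> H"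
      then have "homotopy_class S (p +++ reversepath \<gamma>) \<in> H #>\<^bsub>\<pi>\<^sub>1\<^esub> homotopy_class S (q +++ reversepath \<gamma>)"
        using H.rcos_module_rev[OF group_fundamental_group car[OF q] car[OF p]] by blast
      then show "\<Phi> p = \<Phi> q"
        using G.repr_independence[OF _ car[OF q] H] by (simp add: \<Phi>_def)
    qed
    ultimately show ?thesis by (simp add: same_coset_def)
  qed
  have elem: "the_elem (\<Phi> ` path_coset y p) = \<Phi> p" if p: "p \<in> paths_between S x y" for p
  proof -
    have "\<Phi> ` path_coset y p = {\<Phi> p}"
      using same[OF p] p same_coset_refl[OF p] by (auto simp: path_coset_def)
    then show ?thesis by simp
  qed
  have "bij_betw (\<lambda>X. the_elem (\<Phi> ` X)) (path_coset y ` paths_between S x y) (rcosets\<^bsub>\<pi>\<^sub>1\<^esub> H)"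
  proof (rule bij_betw_imageI)
    show "inj_on (\<lambda>X. the_elem (\<Phi> ` X)) (path_coset y ` paths_between S x y)"
    proof (rule inj_onI, elim imageE)
      fix X Y p q assume p: "X = path_coset y p" "p \<in> paths_between S x y" and q: "Y = path_coset y q" "q \<in> paths_between S x y"
        and eq: "the_elem (\<Phi> ` X) = the_elem (\<Phi> ` Y)"
      have "\<Phi> p = \<Phi> q" using eq unfolding p(1) q(1) elem[OF p(2)] elem[OF q(2)] .
      then show "X = Y" unfolding p(1) q(1) path_coset_eq_iff[OF p(2) q(2)] same[OF p(2) q(2)] .
    qed
    have "(\<lambda>X. the_elem (\<Phi> ` X)) ` path_coset y ` paths_between S x y = \<Phi> ` paths_between S x y"
      using elem by (auto simp: image_iff)
    also have "\<dots> = rcosets\<^bsub>\<pi>\<^sub>1\<^esub> H"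
    proof (intro equalityI subsetI)
      fix X assume "X \<in> \<Phi> ` paths_between S x y"
      then show "X \<in> rcosets\<^bsub>\<pi>\<^sub>1\<^esub> H" using car by (auto simp: RCOSETS_def \<Phi>_def)
    next
      fix X assume "X \<in> rcosets\<^bsub>\<pi>\<^sub>1\<^esub> H"
      then obtain l where l: "l \<in> paths_between S x x" "X = H #>\<^bsub>\<pi>\<^sub>1\<^esub> homotopy_class S l"
        unfolding RCOSETS_def carrier_fundamental_group by blast
      have "homotopy_class S ((l +++ \<gamma>) +++ reversepath \<gamma>) = homotopy_class S l"
        unfolding homotopy_class_eq_iff[OF paths_between_join[OF paths_between_join[OF l(1) g] g']]
        by (rule homotopic_cancel[OF l(1) g])
      then have "X = \<Phi> (l +++ \<gamma>)" by (simp add: \<Phi>_def l(2))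
      then show "X \<in> \<Phi> ` paths_between S x y" using paths_between_join[OF l(1) g] by blast
    qed
    finally show "(\<lambda>X. the_elem (\<Phi> ` X)) ` path_coset y ` paths_between S x y = rcosets\<^bsub>\<pi>\<^sub>1\<^esub> H" .
  qed
  then show ?thesis unfolding \<Phi>_def .
qed

end

end

section \<open>Covers from the fundamental group\<close>

text \<open>The straight-line contraction to \<open>v\<close>: the point \<open>y\<close> at
  \<open>r = 0\<close>, the vertex at \<open>r = 1\<close>.\<close>

definition star_homotopy :: "'a \<Rightarrow> real \<Rightarrow> ('a \<Rightarrow> real) \<Rightarrow> 'a \<Rightarrow> real" where
  "star_homotopy v r y = (\<lambda>w. (1 - r) * y w + r * vertex_point v w)"

text \<open>The union of the closed simplices that contain \<open>v\<close>. The open star is not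
  named; it is the condition \<open>y v \<noteq> 0\<close>.\<close>

definition closed_star :: "'a set set \<Rightarrow> 'a \<Rightarrow> ('a \<Rightarrow> real) set" where
  "closed_star \<Delta> v = {y \<in> realization \<Delta>. insert v {w. y w \<noteq> 0} \<in> \<Delta>}"

definition segment_path :: "'a \<Rightarrow> 'a \<Rightarrow> real \<Rightarrow> 'a \<Rightarrow> real" where
  "segment_path u v = (\<lambda>s. star_homotopy v s (vertex_point u))"

text \<open>The parameter is reversed so that the path runs outwards, from the vertex
  \<open>v\<close> to \<open>y\<close>.\<close>

definition spoke :: "'a \<Rightarrow> ('a \<Rightarrow> real) \<Rightarrow> real \<Rightarrow> 'a \<Rightarrow> real" where
  "spoke v y = (\<lambda>s. star_homotopy v (1 - s) y)"

lemma star_homotopy_0: "star_homotopy v 0 y = y"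
  and star_homotopy_1: "star_homotopy v 1 y = vertex_point v"
  by (simp_all add: star_homotopy_def)

lemma star_homotopy_vertex: "star_homotopy v r (vertex_point v) = vertex_point v"
  by (rule ext) (simp add: star_homotopy_def algebra_simps)

lemma star_homotopy_support: "{w. star_homotopy v r y w \<noteq> 0} \<subseteq> insert v {w. y w \<noteq> 0}"
  by (auto simp: star_homotopy_def vertex_point_def)

lemma star_homotopy_closed_star:
  assumes \<Delta>: "abstract_complex \<Delta>" and y: "y \<in> closed_star \<Delta> v" and r: "r \<in> {0..1}"
  shows "star_homotopy v r y \<in> realization \<Delta>"
proof -
  define T where "T = insert v {w. y w \<noteq> 0}"
  have T: "T \<in> \<Delta>" using y by (simp add: closed_star_def T_def)
  then have finT: "finite T" using \<Delta> by (simp add: abstract_complex_def)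
  have y': "\<And>w. 0 \<le> y w" "(\<Sum>w\<in>{w. y w \<noteq> 0}. y w) = 1" using y by (simp_all add: closed_star_def realization_def)
  have sum_y: "(\<Sum>w\<in>T. y w) = 1"
    unfolding y'(2)[symmetric] using finT by (intro sum.mono_neutral_right) (auto simp: T_def)
  have sum_v: "(\<Sum>w\<in>T. vertex_point v w) = 1"
    using finT by (simp add: vertex_point_def T_def)
  have sub: "{w. star_homotopy v r y w \<noteq> 0} \<subseteq> T" unfolding T_def by (rule star_homotopy_support)
  have "(\<Sum>w\<in>{w. star_homotopy v r y w \<noteq> 0}. star_homotopy v r y w) = (\<Sum>w\<in>T. star_homotopy v r y w)"
    using finT sub by (intro sum.mono_neutral_left) auto
  also have "\<dots> = (1 - r) * (\<Sum>w\<in>T. y w) + r * (\<Sum>w\<in>T. vertex_point v w)"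
    by (simp add: star_homotopy_def sum.distrib sum_distrib_left)
  also have "\<dots> = 1" by (simp add: sum_y sum_v)
  finally have "(\<Sum>w\<in>{w. star_homotopy v r y w \<noteq> 0}. star_homotopy v r y w) = 1" .
  moreover have "{w. star_homotopy v r y w \<noteq> 0} \<in> \<Delta>"
    using \<Delta> T sub unfolding abstract_complex_def by blast
  moreover have "0 \<le> star_homotopy v r y w" for w
    using y'(1)[of w] r by (auto simp: star_homotopy_def vertex_point_def)
  ultimately show ?thesis by (simp add: realization_def)
qed

lemma continuous_on_star_homotopy:
  assumes "continuous_on A f" "continuous_on A g"
  shows "continuous_on A (\<lambda>z. star_homotopy v (f z) (g z))"
proof (rule continuous_on_coordinatewise_then_product)
  fix w
  have "continuous_on A (\<lambda>z. g z w)"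
    using continuous_on_product_then_coordinatewise[OF assms(2)] .
  then show "continuous_on A (\<lambda>z. star_homotopy v (f z) (g z) w)"
    unfolding star_homotopy_def by (intro continuous_intros assms(1))
qed

text \<open>Both paths are the bottom side of a square in the closed star; pushing the bottom side over the
  square to the other three sides gives a path that depends only on the end points.\<close>

lemma homotopic_in_closed_star:
  assumes \<Delta>: "abstract_complex \<Delta>"
    and p: "path p" "path_image p \<subseteq> closed_star \<Delta> v" and q: "path q" "path_image q \<subseteq> closed_star \<Delta> v"
    and ends: "pathstart q = pathstart p" "pathfinish q = pathfinish p"
  shows "homotopic_paths (realization \<Delta>) p q"
proof -
  \<comment> \<open>In the square the first coordinate is the time of the path, the second the time
    of the contraction to \<open>v\<close>.\<close>
  define bottom where "bottom = linepath (0 :: real, 0 :: real) (1, 0)"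
  define around where "around =
    linepath (0 :: real, 0 :: real) (0, 1) +++ (linepath (0, 1) (1, 1) +++ linepath (1, 1) (1, 0))"
  define Q where "Q = {0..1::real} \<times> {0..1::real}"
  have conv: "convex Q" by (simp add: Q_def convex_Times)
  have seg: "closed_segment a b \<subseteq> Q" if "a \<in> Q" "b \<in> Q" for a b
    using that conv by (rule closed_segment_subset)
  have path_around: "path around" unfolding around_def by simp
  have around_Q: "path_image around \<subseteq> Q"
  proof -
    have "path_image around \<subseteq> path_image (linepath (0 :: real, 0 :: real) (0, 1)) \<union>
        (path_image (linepath (0, 1) (1, 1)) \<union> path_image (linepath (1, 1) (1, 0)))"
      unfolding around_def using path_image_join_subset by blast
    moreover have "path_image (linepath (0 :: real, 0 :: real) (0, 1)) \<subseteq> Q"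
      "path_image (linepath (0 :: real, 1 :: real) (1, 1)) \<subseteq> Q" "path_image (linepath (1 :: real, 1 :: real) (1, 0)) \<subseteq> Q"
      unfolding path_image_linepath by (rule seg; simp add: Q_def)+
    ultimately show ?thesis by blast
  qed
  have bottom_Q: "path_image bottom \<subseteq> Q" unfolding bottom_def path_image_linepath by (rule seg) (simp_all add: Q_def)
  have homQ: "homotopic_paths Q bottom around"
  proof (rule homotopic_paths_linear)
    show "path bottom" "path around" by (simp_all add: bottom_def path_around)
    show "pathstart around = pathstart bottom" "pathfinish around = pathfinish bottom"
      by (simp_all add: bottom_def around_def)
    fix s :: real assume "s \<in> {0..1}"
    then have "bottom s \<in> Q" "around s \<in> Q" using bottom_Q around_Q unfolding path_image_def by blast+
    then show "closed_segment (bottom s) (around s) \<subseteq> Q" by (rule seg)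
  qed
  \<comment> \<open>The image of the other three sides: in to \<open>v\<close>, a rest at
    \<open>v\<close>, and out to the end point.\<close>
  define rim where "rim a b = (\<lambda>r. star_homotopy v r a) +++ ((\<lambda>_. vertex_point v) +++ (\<lambda>r. star_homotopy v (1 - r) b))"
    for a b :: "'a \<Rightarrow> real"
  have key: "homotopic_paths (realization \<Delta>) p (rim (pathstart p) (pathfinish p))"
    if p: "path p" "path_image p \<subseteq> closed_star \<Delta> v" for p :: "real \<Rightarrow> 'a \<Rightarrow> real"
  proof -
    define F where "F z = star_homotopy v (snd z) (p (fst z))" for z :: "real \<times> real"
    have "continuous_on Q F"
      unfolding F_def
    proof (intro continuous_on_star_homotopy continuous_on_compose2[where f = fst and g = p and t = "{0..1}"])
      show "continuous_on {0..1} p" using p(1) by (simp add: path_def)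
    qed (auto simp: Q_def intro: continuous_intros)
    moreover have "F \<in> Q \<rightarrow> realization \<Delta>"
    proof
      fix z assume z: "z \<in> Q"
      then have "p (fst z) \<in> closed_star \<Delta> v" using p(2) by (auto simp: Q_def path_image_def)
      then show "F z \<in> realization \<Delta>"
        unfolding F_def using z by (intro star_homotopy_closed_star[OF \<Delta>]) (auto simp: Q_def)
    qed
    ultimately have "homotopic_paths (realization \<Delta>) (F \<circ> bottom) (F \<circ> around)"
      by (rule homotopic_paths_continuous_image[OF homQ])
    moreover have "F \<circ> bottom = p"
      by (rule ext) (simp add: F_def bottom_def linepath_def star_homotopy_0)
    moreover have "F \<circ> around = rim (pathstart p) (pathfinish p)"
      unfolding around_def rim_def path_compose_join
      by (intro arg_cong2[where f = "(+++)"] ext)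
        (simp_all add: F_def linepath_def star_homotopy_1 pathstart_def pathfinish_def)
    ultimately show ?thesis by simp
  qed
  show ?thesis
    using key[OF p] key[OF q] unfolding ends by (metis homotopic_paths_sym homotopic_paths_trans)
qed

lemma path_segment_path: "path (segment_path u v)"
  unfolding path_def segment_path_def by (intro continuous_on_star_homotopy continuous_intros)

lemma path_spoke: "path (spoke v y)"
  unfolding path_def spoke_def by (intro continuous_on_star_homotopy continuous_intros)

lemma segment_path_ends: "pathstart (segment_path u v) = vertex_point u" "pathfinish (segment_path u v) = vertex_point v"
  by (simp_all add: pathstart_def pathfinish_def segment_path_def star_homotopy_0 star_homotopy_1)

lemma spoke_ends: "pathstart (spoke v y) = vertex_point v" "pathfinish (spoke v y) = y"
  by (simp_all add: pathstart_def pathfinish_def spoke_def star_homotopy_0 star_homotopy_1)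

lemma segment_path_const: "segment_path v v = const_path (vertex_point v)"
  by (rule ext) (simp add: segment_path_def star_homotopy_vertex const_path_def)

lemma spoke_const: "spoke v (vertex_point v) = const_path (vertex_point v)"
  by (rule ext) (simp add: spoke_def star_homotopy_vertex const_path_def)

lemma closed_star_homotopyI:
  assumes \<Delta>: "abstract_complex \<Delta>" and y: "y \<in> realization \<Delta>" and r: "r \<in> {0..1}"
    and f: "insert w (insert v {z. y z \<noteq> 0}) \<in> \<Delta>"
  shows "star_homotopy v r y \<in> closed_star \<Delta> w"
proof -
  have sub: "\<tau> \<in> \<Delta>" if "\<tau> \<subseteq> insert w (insert v {z. y z \<noteq> 0})" for \<tau>
    using \<Delta> f that unfolding abstract_complex_def by blast
  have "y \<in> closed_star \<Delta> v" using y sub[of "insert v {z. y z \<noteq> 0}"] by (auto simp: closed_star_def)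
  then have "star_homotopy v r y \<in> realization \<Delta>" by (rule star_homotopy_closed_star[OF \<Delta> _ r])
  moreover have "insert w {z. star_homotopy v r y z \<noteq> 0} \<in> \<Delta>"
    by (rule sub) (use star_homotopy_support[of v r y] in blast)
  ultimately show ?thesis by (simp add: closed_star_def)
qed

lemma segment_path_image:
  assumes \<Delta>: "abstract_complex \<Delta>" and f: "{u, v, w} \<in> \<Delta>"
  shows "path_image (segment_path u v) \<subseteq> closed_star \<Delta> w"
proof -
  have "{u} \<in> \<Delta>" using \<Delta> f unfolding abstract_complex_def by (metis insert_subset empty_subsetI insertI1)
  then have "vertex_point u \<in> realization \<Delta>" by (rule vertex_point_realization)
  then show ?thesis
    using f by (auto simp: path_image_def segment_path_def vertex_point_support insert_commute intro!: closed_star_homotopyI[OF \<Delta>])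
qed

lemma spoke_image:
  assumes \<Delta>: "abstract_complex \<Delta>" and y: "y \<in> realization \<Delta>" "y v \<noteq> 0" "y w \<noteq> 0"
  shows "path_image (spoke v y) \<subseteq> closed_star \<Delta> w"
proof -
  have "insert w (insert v {z. y z \<noteq> 0}) = {z. y z \<noteq> 0}" using y by auto
  moreover have "{z. y z \<noteq> 0} \<in> \<Delta>" using y(1) by (simp add: realization_def)
  ultimately show ?thesis
    using y(1) by (auto simp: path_image_def spoke_def intro!: closed_star_homotopyI[OF \<Delta>])
qed

lemma closed_star_subset: "closed_star \<Delta> v \<subseteq> realization \<Delta>"
  by (auto simp: closed_star_def)

lemma open_star_closed_star: "y \<in> realization \<Delta> \<Longrightarrow> y v \<noteq> 0 \<Longrightarrow> y \<in> closed_star \<Delta> v"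
  by (simp add: closed_star_def realization_def insert_absorb)

context normal_pseudomanifold
begin

lemma open_star_edge:
  assumes "y \<in> realization \<Delta>" "y u \<noteq> 0" "y v \<noteq> 0"
  shows "{u, v} \<in> \<Delta>"
proof -
  have "{w. y w \<noteq> 0} \<in> \<Delta>" using assms(1) by (simp add: realization_def)
  then show ?thesis by (rule face_subset) (use assms in auto)
qed

lemma realization_support:
  assumes "y \<in> realization \<Delta>"
  obtains v where "y v \<noteq> 0"
proof -
  have "(\<Sum>v\<in>{v. y v \<noteq> 0}. y v) = 1" using assms by (simp add: realization_def)
  then have "{v. y v \<noteq> 0} \<noteq> {}" by (metis sum.empty zero_neq_one)
  then show thesis using that by blast
qed

end

section \<open>The cover that belongs to a subgroup of finite index\<close>

text \<open>Only the points above the vertices are formed: a vertex together with a class of paths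
  to it. Finite index makes the fibres finite.\<close>

locale coset_cover = normal_pseudomanifold \<Delta> d
  for \<Delta> :: "'a::linorder set set" and d :: nat +
  fixes x :: "'a \<Rightarrow> real" and H
  assumes x: "x \<in> realization \<Delta>"
    and H: "subgroup H (fundamental_group (realization \<Delta>) x)"
    and finite_index: "finite (rcosets\<^bsub>fundamental_group (realization \<Delta>) x\<^esub> H)"
begin

abbreviation "S \<equiv> realization \<Delta>"
abbreviation "paths_to v \<equiv> paths_between S x (vertex_point v)"
abbreviation "coset v p \<equiv> path_coset S x H (vertex_point v) p"

definition W :: "('a \<times> (real \<Rightarrow> 'a \<Rightarrow> real) set) set" where
  "W = {(v, coset v p) | v p. {v} \<in> \<Delta> \<and> p \<in> paths_to v}"

text \<open>Quantifying over the representatives \<open>q\<close> makes this depend on the class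
  alone; \<open>lift_coset\<close> evaluates it on a chosen representative.\<close>

definition lift where
  "lift w u = (u, {r \<in> paths_to u. \<exists>q\<in>snd w. same_coset S H (q +++ segment_path (fst w) u) r})"

lemma segment_paths_between: "{u, v} \<in> \<Delta> \<Longrightarrow> segment_path u v \<in> paths_between S (vertex_point u) (vertex_point v)"
  using segment_path_image[OF complex, of u v v] closed_star_subset[of \<Delta> v]
  by (auto simp: paths_between_def path_segment_path segment_path_ends)

lemma coset_self: "p \<in> paths_to v \<Longrightarrow> p \<in> coset v p"
  using same_coset_refl[OF x H] by (simp add: path_coset_def[OF x H])

lemma lift_coset:
  assumes vu: "{v, u} \<in> \<Delta>" and p: "p \<in> paths_to v"
  shows "lift (v, coset v p) u = (u, coset u (p +++ segment_path v u))"
proof -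
  note seg = segment_paths_between[OF vu]
  have "(\<exists>q\<in>coset v p. same_coset S H (q +++ segment_path v u) r) \<longleftrightarrow> same_coset S H (p +++ segment_path v u) r"
    if r: "r \<in> paths_to u" for r
  proof
    assume "\<exists>q\<in>coset v p. same_coset S H (q +++ segment_path v u) r"
    then obtain q where q: "q \<in> paths_to v" "same_coset S H p q" "same_coset S H (q +++ segment_path v u) r"
      by (auto simp: path_coset_def[OF x H])
    then show "same_coset S H (p +++ segment_path v u) r"
      using same_coset_trans[OF x H paths_between_join[OF p seg] paths_between_join[OF q(1) seg] r
        same_coset_join[OF x H p q(1) seg q(2)]] by blast
  next
    assume "same_coset S H (p +++ segment_path v u) r"
    then show "\<exists>q\<in>coset v p. same_coset S H (q +++ segment_path v u) r" using coset_self[OF p] by blast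
  qed
  then show ?thesis unfolding lift_def path_coset_def[OF x H] fst_conv snd_conv by auto
qed

lemma coset_homotopic: "p \<in> paths_to v \<Longrightarrow> homotopic_paths S p q \<Longrightarrow> coset v p = coset v q"
  using path_coset_eq_iff[OF x H _ paths_between_homotopic] same_coset_homotopic[OF x H] by blast

definition E where
  "E = {(w, lift w u) | w u. w \<in> W \<and> {fst w, u} \<in> \<Delta>}"

lemma lift_self: 
  assumes "w \<in> W" shows "lift w (fst w) = w"
proof -
  obtain v p where w: "w = (v, coset v p)" "{v} \<in> \<Delta>" "p \<in> paths_to v" using assms by (auto simp: W_def)
  have vv: "{v, v} \<in> \<Delta>" using w(2) by simp
  have "homotopic_paths S (p +++ segment_path v v) p"
    unfolding segment_path_const using w(3) by (intro homotopic_join_const) (simp_all add: paths_between_def)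
  then have "coset v (p +++ segment_path v v) = coset v p"
    by (rule coset_homotopic[OF paths_between_join[OF w(3) segment_paths_between[OF vv]]])
  then show ?thesis unfolding w(1) fst_conv lift_coset[OF vv w(3)] by simp
qed

lemma lift_in:
  assumes "w \<in> W" "{fst w, u} \<in> \<Delta>" shows "lift w u \<in> W \<and> fst (lift w u) = u"
proof -
  obtain v p where w: "w = (v, coset v p)" "{v} \<in> \<Delta>" "p \<in> paths_to v" using assms by (auto simp: W_def)
  have vu: "{v, u} \<in> \<Delta>" using assms(2) w(1) by simp
  have "{u} \<in> \<Delta>" by (rule singleton_face[OF vu]) simp
  then show ?thesis
    unfolding w(1) lift_coset[OF vu w(3)] W_def
    using paths_between_join[OF w(3) segment_paths_between[OF vu]] by auto
qed

text \<open>In a triangle, the detour through \<open>u\<close> and the direct edge both lie in the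
  closed star of \<open>u\<close>, so they are homotopic.\<close>

lemma lift_lift:
  assumes "w \<in> W" "{fst w, u, u'} \<in> \<Delta>" shows "lift (lift w u) u' = lift w u'"
proof -
  obtain v p where w: "w = (v, coset v p)" "{v} \<in> \<Delta>" "p \<in> paths_to v" using assms by (auto simp: W_def)
  have vuu: "{v, u, u'} \<in> \<Delta>" using assms(2) w(1) by simp
  have f: "{v, u} \<in> \<Delta>" "{u, u'} \<in> \<Delta>" "{v, u'} \<in> \<Delta>" by (rule face_subset[OF vuu]; auto)+
  note s1 = segment_paths_between[OF f(1)] and s2 = segment_paths_between[OF f(2)] and s3 = segment_paths_between[OF f(3)]
  note s12 = paths_between_join[OF s1 s2]
  have "path_image (segment_path v u +++ segment_path u u') \<subseteq> closed_star \<Delta> u"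
    using path_image_join_subset[of "segment_path v u" "segment_path u u'"] segment_path_image[OF complex, of v u u]
      segment_path_image[OF complex, of u u' u] f by (auto simp: insert_commute)
  moreover have "path_image (segment_path v u') \<subseteq> closed_star \<Delta> u"
    using vuu by (intro segment_path_image[OF complex]) (simp add: insert_commute)
  ultimately have "homotopic_paths S (segment_path v u +++ segment_path u u') (segment_path v u')"
    using s12 s3 by (intro homotopic_in_closed_star[OF complex, of _ u]) (simp_all add: paths_between_def)
  then have "homotopic_paths S (p +++ (segment_path v u +++ segment_path u u')) (p +++ segment_path v u')"
    by (rule homotopic_join[OF homotopic_refl[OF w(3)] _ w(3) s12])
  then have "homotopic_paths S ((p +++ segment_path v u) +++ segment_path u u') (p +++ segment_path v u')"
    by (rule homotopic_paths_trans[OF homotopic_assoc[OF w(3) s1 s2]])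
  then have "coset u' ((p +++ segment_path v u) +++ segment_path u u') = coset u' (p +++ segment_path v u')"
    by (rule coset_homotopic[OF paths_between_join[OF paths_between_join[OF w(3) s1] s2]])
  then show ?thesis
    unfolding w(1) lift_coset[OF f(1) w(3)] lift_coset[OF f(2) paths_between_join[OF w(3) s1]] lift_coset[OF f(3) w(3)] by simp
qed

lemma finite_W: "finite W"
proof -
  have "W \<subseteq> (SIGMA v:vertices. (\<lambda>p. coset v p) ` paths_to v)" by (auto simp: W_def vertices_def)
  moreover have "finite ((\<lambda>p. coset v p) ` paths_to v)" for v
  proof (cases "paths_to v = {}")
    case False
    then obtain \<gamma> where "\<gamma> \<in> paths_to v" by blast
    from bij_betw_finite[OF card_path_cosets[OF x H this]] show ?thesis using finite_index by simp
  qed simp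
  ultimately show ?thesis using finite_vertices by (meson finite_SigmaI finite_subset)
qed

lemma sym_E: "sym E"
proof (rule symI)
  fix w w' assume "(w, w') \<in> E"
  then obtain u where u: "w \<in> W" "{fst w, u} \<in> \<Delta>" "w' = lift w u" by (auto simp: E_def)
  have "{fst w, u, fst w} \<in> \<Delta>" using u(2) by (simp add: insert_commute)
  then have "lift w' (fst w) = w" using lift_lift[OF u(1)] lift_self[OF u(1)] u(3) by simp
  moreover have "w' \<in> W" "{fst w', fst w} \<in> \<Delta>" using lift_in[OF u(1,2)] u(2,3) by (auto simp: insert_commute)
  ultimately show "(w', w) \<in> E" unfolding E_def by (metis (mono_tags, lifting) mem_Collect_eq)
qed

text \<open>Every path from \<open>x\<close> is tracked by an edge path, hence all of the cover is reached from one vertex.\<close>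

lemma reachable:
  assumes v0: "x v0 \<noteq> 0" and v: "p \<in> paths_to v" "{v} \<in> \<Delta>"
  shows "((v0, coset v0 (reversepath (spoke v0 x))), (v, coset v p)) \<in> E\<^sup>*"
proof -
  have p: "path p" "path_image p \<subseteq> S" "p 0 = x" "p 1 = vertex_point v"
    using v(1) by (auto simp: paths_between_def pathstart_def pathfinish_def)
  have pS: "p s \<in> S" if "s \<in> {0..1}" for s using p(2) that by (auto simp: path_image_def)
  define w0 where "w0 = (v0, coset v0 (reversepath (spoke v0 x)))"
  have spoke_to: "spoke w y \<in> paths_between S (vertex_point w) y" if "y \<in> S" "y w \<noteq> 0" for w y
    using spoke_image[OF complex that that(2)] closed_star_subset[of \<Delta> w]
    by (auto simp: paths_between_def path_spoke spoke_ends)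
  have sub: "sub_path p a b \<in> paths_between S (p a) (p b)" if "a \<in> {0..1}" "b \<in> {0..1}" for a b
  proof -
    have "closed_segment a b \<subseteq> {0..1}" using that by (rule closed_segment_subset) simp
    then show ?thesis using sub_path[OF p(1) that] pS by (auto simp: paths_between_def)
  qed
  \<comment> \<open>Up to time \<open>s\<close> the path is homotopic to a path \<open>q\<close>
    with a class already reached, followed by a spoke from a vertex whose open star contains
    p(s).\<close>
  define P where "P s \<longleftrightarrow> (\<exists>w q. p s w \<noteq> 0 \<and> q \<in> paths_to w \<and> (w0, (w, coset w q)) \<in> E\<^sup>* \<and>
    homotopic_paths S (q +++ spoke w (p s)) (sub_path p 0 s))" for s
  have "P 1"
  proof (rule connected_induction_simple[where S = "{0..1}" and a = 0 and b = 1 and P = P])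
    have r: "reversepath (spoke v0 x) \<in> paths_to v0" by (rule paths_between_reverse[OF spoke_to[OF x v0]])
    have "homotopic_paths S (reversepath (spoke v0 x) +++ spoke v0 x) (const_path x)"
      using homotopic_join_reversepath[of "reversepath (spoke v0 x)" S x] r by (simp add: paths_between_def)
    moreover have "sub_path p 0 0 = const_path x"
      by (rule ext) (simp add: sub_path_def const_path_def linepath_def p(3))
    ultimately show "P 0" using r v0 unfolding P_def w0_def p(3) by (metis rtrancl.rtrancl_refl)
  next
    fix s0 :: real assume s0: "s0 \<in> {0..1}"
    obtain w where w: "p s0 w \<noteq> 0" using realization_support[OF pS[OF s0]] .
    have "continuous_on {0..1} (\<lambda>s. p s w)"
      using p(1) unfolding path_def by (rule continuous_on_product_then_coordinatewise)
    then have "openin (top_of_set {0..1}) ({0..1} \<inter> (\<lambda>s. p s w) -` (- {0}))"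
      by (rule continuous_openin_preimage_gen) auto
    moreover have "s0 \<in> {0..1} \<inter> (\<lambda>s. p s w) -` (- {0})" using s0 w by simp
    ultimately obtain \<epsilon> where \<epsilon>: "\<epsilon> > 0" "ball s0 \<epsilon> \<inter> {0..1} \<subseteq> {0..1} \<inter> (\<lambda>s. p s w) -` (- {0})"
      unfolding openin_contains_ball by blast
    \<comment> \<open>An interval around \<open>s0\<close> during which the path stays in the open
      star of the single vertex \<open>w\<close>.\<close>
    define T where "T = ball s0 \<epsilon> \<inter> {0..1}"
    have T_w: "p s w \<noteq> 0" if "s \<in> T" for s using \<epsilon>(2) that by (auto simp: T_def)
    have T01: "T \<subseteq> {0..1}" by (simp add: T_def)
    have "convex T" unfolding T_def by (intro convex_Int) auto
    have "P b" if a: "a \<in> T" "P a" and b: "b \<in> T" for a b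
    proof -
      have a01: "a \<in> {0..1}" and b01: "b \<in> {0..1}" using a b T01 by auto
      obtain u q where u: "p a u \<noteq> 0" "q \<in> paths_to u" "(w0, (u, coset u q)) \<in> E\<^sup>*"
        "homotopic_paths S (q +++ spoke u (p a)) (sub_path p 0 a)"
        using a(2) unfolding P_def by blast
      have uw: "{u, w} \<in> \<Delta>" by (rule open_star_edge[OF pS[OF a01] u(1) T_w[OF a(1)]])
      have u\<Delta>: "{u} \<in> \<Delta>" by (rule singleton_face[OF uw]) simp
      note seg = segment_paths_between[OF uw]
      note sp_a = spoke_to[OF pS[OF a01] u(1)] and sp_b = spoke_to[OF pS[OF b01] T_w[OF b]]
      note ab = sub[OF a01 b01] and oa = sub[OF _ a01, of 0]
      have "(u, coset u q) \<in> W" using u\<Delta> u(2) by (auto simp: W_def)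
      then have "((u, coset u q), (w, coset w (q +++ segment_path u w))) \<in> E"
        unfolding E_def using lift_coset[OF uw u(2)] uw by force
      then have reach: "(w0, (w, coset w (q +++ segment_path u w))) \<in> E\<^sup>*" using u(3) by (rule rtrancl_into_rtrancl[rotated])
      have seg_ab: "closed_segment a b \<subseteq> T" using a(1) b \<open>convex T\<close> by (rule closed_segment_subset)
      have im_ab: "path_image (sub_path p a b) \<subseteq> closed_star \<Delta> w"
        unfolding sub_path(4)[OF p(1) a01 b01]
        using subsetD[OF seg_ab] subsetD[OF T01] by (intro image_subsetI open_star_closed_star pS T_w) simp_all
      \<comment> \<open>Both routes from \<open>u\<close> to p(b), along the edge to
        \<open>w\<close> and along the path itself, stay in the closed star of
        \<open>w\<close>.\<close>
      have "homotopic_paths S (segment_path u w +++ spoke w (p b)) (spoke u (p a) +++ sub_path p a b)"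
      proof (rule homotopic_in_closed_star[OF complex])
        show "path (segment_path u w +++ spoke w (p b))" "path (spoke u (p a) +++ sub_path p a b)"
          "pathstart (spoke u (p a) +++ sub_path p a b) = pathstart (segment_path u w +++ spoke w (p b))"
          "pathfinish (spoke u (p a) +++ sub_path p a b) = pathfinish (segment_path u w +++ spoke w (p b))"
          using paths_between_join[OF seg sp_b] paths_between_join[OF sp_a ab] by (simp_all add: paths_between_def)
        show "path_image (segment_path u w +++ spoke w (p b)) \<subseteq> closed_star \<Delta> w"
          using path_image_join_subset[of "segment_path u w" "spoke w (p b)"] segment_path_image[OF complex, of u w w] uw
            spoke_image[OF complex pS[OF b01] T_w[OF b] T_w[OF b]] by auto
        show "path_image (spoke u (p a) +++ sub_path p a b) \<subseteq> closed_star \<Delta> w"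
          using path_image_join_subset[of "spoke u (p a)" "sub_path p a b"]
            spoke_image[OF complex pS[OF a01] u(1) T_w[OF a(1)]] im_ab by auto
      qed
      then have "homotopic_paths S (q +++ (segment_path u w +++ spoke w (p b))) (q +++ (spoke u (p a) +++ sub_path p a b))"
        by (rule homotopic_join[OF homotopic_refl[OF u(2)] _ u(2) paths_between_join[OF seg sp_b]])
      then have "homotopic_paths S ((q +++ segment_path u w) +++ spoke w (p b)) (q +++ (spoke u (p a) +++ sub_path p a b))"
        by (rule homotopic_paths_trans[OF homotopic_assoc[OF u(2) seg sp_b]])
      also have "homotopic_paths S (q +++ (spoke u (p a) +++ sub_path p a b)) ((q +++ spoke u (p a)) +++ sub_path p a b)"
        by (rule homotopic_paths_sym[OF homotopic_assoc[OF u(2) sp_a ab]])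
      also have "homotopic_paths S ((q +++ spoke u (p a)) +++ sub_path p a b) (sub_path p 0 a +++ sub_path p a b)"
        by (rule homotopic_join[OF u(4) homotopic_refl[OF ab] paths_between_join[OF u(2) sp_a] ab])
      also have "homotopic_paths S (sub_path p 0 a +++ sub_path p a b) (sub_path p 0 b)"
        using a01 b01 by (intro homotopic_sub_paths_join p) simp_all
      finally show "P b"
        unfolding P_def using T_w[OF b] paths_between_join[OF u(2) seg] reach by blast
    qed
    moreover have "openin (top_of_set {0..1}) T" unfolding T_def Int_commute[of "ball s0 \<epsilon>"] by (rule openin_open_Int) simp
    moreover have "s0 \<in> T" using s0 \<epsilon>(1) by (simp add: T_def)
    ultimately show "\<exists>T. openin (top_of_set {0..1}) T \<and> s0 \<in> T \<and> (\<forall>a\<in>T. \<forall>b\<in>T. P a \<longrightarrow> P b)" by blast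
  qed auto
  then obtain w q where wq: "vertex_point v w \<noteq> 0" "q \<in> paths_to w" "(w0, (w, coset w q)) \<in> E\<^sup>*"
    "homotopic_paths S (q +++ spoke w (vertex_point v)) p"
    unfolding P_def p(4) sub_path_0_1 by blast
  have "w = v" using wq(1) by (simp add: vertex_point_def split: if_splits)
  have "homotopic_paths S q (q +++ const_path (vertex_point v))"
    using wq(2) unfolding \<open>w = v\<close> by (intro homotopic_paths_sym[OF homotopic_join_const]) (simp_all add: paths_between_def)
  then have "homotopic_paths S q p"
    using wq(4) unfolding \<open>w = v\<close> spoke_const by (rule homotopic_paths_trans)
  then have "coset v q = coset v p" using coset_homotopic wq(2) unfolding \<open>w = v\<close> by blast
  then show ?thesis using wq(3) unfolding w0_def \<open>w = v\<close> by simp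
qed

lemma connected_W:
  assumes "w \<in> W" "w' \<in> W"
  shows "(w, w') \<in> E\<^sup>*"
proof -
  obtain v0 where v0: "x v0 \<noteq> 0" using realization_support[OF x] .
  define w0 where "w0 = (v0, coset v0 (reversepath (spoke v0 x)))"
  have reach: "(w0, w) \<in> E\<^sup>*" if "w \<in> W" for w
    using that reachable[OF v0] by (auto simp: W_def w0_def)
  have "(w, w0) \<in> E\<^sup>*" using reach[OF assms(1)] sym_rtrancl[OF sym_E] by (auto dest: symD)
  then show ?thesis using reach[OF assms(2)] by (rule rtrancl_trans)
qed

sublocale pseudomanifold_cover \<Delta> d W fst lift
proof unfold_locales
  show "finite W" by (rule finite_W)
  show "{fst w} \<in> \<Delta>" if "w \<in> W" for w using that by (auto simp: W_def)
qed (use lift_self lift_in lift_lift connected_W[unfolded E_def] in blast)+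

text \<open>The base point may lie inside a simplex. A vertex \<open>v0\<close> of its carrier is
  reached by the reversed spoke, which supplies the path that \<open>card_path_cosets\<close> asks
  for.\<close>

lemma card_fibre:
  assumes "x v0 \<noteq> 0"
  shows "card (fibre v0) = card (rcosets\<^bsub>fundamental_group S x\<^esub> H)" "{v0} \<in> \<Delta>"
proof -
  show v0: "{v0} \<in> \<Delta>" using open_star_edge[OF x assms assms] by simp
  have g: "reversepath (spoke v0 x) \<in> paths_to v0"
    using spoke_image[OF complex x assms assms] closed_star_subset[of \<Delta> v0]
    by (auto simp: paths_between_def path_spoke spoke_ends)
  have "fibre v0 = Pair v0 ` (\<lambda>p. coset v0 p) ` paths_to v0" unfolding fibre_def using v0 by (auto simp: W_def)
  then have "card (fibre v0) = card ((\<lambda>p. coset v0 p) ` paths_to v0)" by (simp add: card_image inj_on_def)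
  also have "\<dots> = card (rcosets\<^bsub>fundamental_group S x\<^esub> H)" by (rule bij_betw_same_card[OF card_path_cosets[OF x H g]])
  finally show "card (fibre v0) = card (rcosets\<^bsub>fundamental_group S x\<^esub> H)" .
qed

end

theorem (in normal_pseudomanifold) edges_ge_of_subgroup:
  assumes "x \<in> realization \<Delta>" "subgroup H (fundamental_group (realization \<Delta>) x)"
    and "2 \<le> card (rcosets\<^bsub>fundamental_group (realization \<Delta>) x\<^esub> H)"
  shows "d * card vertices \<le> card edges"
proof -
  interpret coset_cover \<Delta> d x H
    using assms normal_pseudomanifold_axioms
    by (intro coset_cover.intro coset_cover_axioms.intro) (auto intro: card_ge_0_finite)
  obtain v0 where v0: "x v0 \<noteq> 0" using realization_support[OF x] .
  show ?thesis using edges_ge_of_cover[OF card_fibre(2)[OF v0]] card_fibre(1)[OF v0] assms(3) by simp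
qed

section \<open>Covers from the first Betti number\<close>

lemma bdry_add: "bdry \<Delta> (c + c') = bdry \<Delta> c + bdry \<Delta> c'"
  by (rule ext) (simp add: bdry_def sum.distrib algebra_simps)

lemma bdry_scale: "bdry \<Delta> (scale a c) = scale a (bdry \<Delta> c)"
  by (rule ext) (simp add: bdry_def scale_def sum_distrib_left mult.left_commute)

lemma chains_add: "c \<in> chains \<Delta> i \<Longrightarrow> c' \<in> chains \<Delta> i \<Longrightarrow> c + c' \<in> chains \<Delta> i"
  unfolding chains_def plus_fun_def mem_Collect_eq by (metis add_0)

lemma chains_scale: "c \<in> chains \<Delta> i \<Longrightarrow> scale a c \<in> chains \<Delta> i"
  unfolding chains_def scale_def by simp

global_interpretation scale: vector_space "scale :: 'k::field \<Rightarrow> ('b \<Rightarrow> 'k) \<Rightarrow> 'b \<Rightarrow> 'k"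
  by unfold_locales (simp_all add: scale_def fun_eq_iff algebra_simps)

global_interpretation scale: vector_space_pair "scale :: 'k::field \<Rightarrow> ('b \<Rightarrow> 'k) \<Rightarrow> 'b \<Rightarrow> 'k" "(*) :: 'k \<Rightarrow> 'k \<Rightarrow> 'k"
  by unfold_locales (simp_all add: algebra_simps)

lemma subspace_boundaries: "scale.subspace (boundaries \<Delta> i :: ('a::linorder set \<Rightarrow> 'k::field) set)"
proof (rule scale.subspaceI)
  show "0 \<in> (boundaries \<Delta> i :: ('a set \<Rightarrow> 'k) set)" by (rule zero_boundary)
  fix y :: "'a set \<Rightarrow> 'k" assume "y \<in> boundaries \<Delta> i"
  then obtain c where c: "c \<in> chains \<Delta> (i + 1)" "y = bdry \<Delta> c" by (auto simp: boundaries_def)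
  show "scale a y \<in> boundaries \<Delta> i" for a
    unfolding boundaries_def c(2) bdry_scale[symmetric] by (rule imageI[OF chains_scale[OF c(1)]])
  fix y' :: "'a set \<Rightarrow> 'k" assume "y' \<in> boundaries \<Delta> i"
  then obtain c' where c': "c' \<in> chains \<Delta> (i + 1)" "y' = bdry \<Delta> c'" by (auto simp: boundaries_def)
  show "y + y' \<in> boundaries \<Delta> i"
    unfolding boundaries_def c(2) c'(2) bdry_add[symmetric] by (rule imageI[OF chains_add[OF c(1) c'(1)]])
qed

lemma homology_trivial:
  assumes "cycles \<Delta> i \<subseteq> (boundaries \<Delta> i :: ('a::linorder set \<Rightarrow> 'k::field) set)"
  shows "homology \<Delta> i = {boundaries \<Delta> i :: ('a set \<Rightarrow> 'k) set}"
proof -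
  have "z +o boundaries \<Delta> i = (boundaries \<Delta> i :: ('a set \<Rightarrow> 'k) set)" if "z \<in> cycles \<Delta> i" for z
  proof (intro equalityI subsetI)
    have z: "z \<in> boundaries \<Delta> i" using assms that by blast
    fix y :: "'a set \<Rightarrow> 'k"
    show "y \<in> boundaries \<Delta> i" if "y \<in> z +o boundaries \<Delta> i"
      using that scale.subspace_add[OF subspace_boundaries z] by (auto simp: elt_set_plus_def)
    show "y \<in> z +o boundaries \<Delta> i" if "y \<in> boundaries \<Delta> i"
      using set_plus_intro2[OF scale.subspace_diff[OF subspace_boundaries that z], of z] by simp
  qed
  then show ?thesis unfolding homology_def using zero_cycle[of \<Delta> i, where 'b = 'k] by auto
qed

text \<open>\<open>betti\<close> is a definite description, evaluated here in the trivial case only;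
  the contrapositive turns a positive Betti number into a cycle that is not a boundary.\<close>

lemma betti_trivial:
  fixes \<Delta> :: "'a::linorder set set"
  assumes "cycles \<Delta> i \<subseteq> (boundaries \<Delta> i :: ('a set \<Rightarrow> 'k::field) set)"
  shows "betti TYPE('k) \<Delta> i = 0"
  unfolding betti_def
proof (rule the_equality)
  note hom = homology_trivial[OF assms]
  have "bij_betw (\<lambda>_. 0) (homology \<Delta> i :: ('a set \<Rightarrow> 'k) set set) (coordinate_space 0 :: (nat \<Rightarrow> 'k) set)"
    unfolding hom coordinate_space_0 by (simp add: bij_betw_def)
  then show "homology_iso TYPE('k) \<Delta> i 0"
    unfolding homology_iso_def by (intro exI[of _ "\<lambda>_. 0"]) (simp add: scale_def fun_eq_iff)
  fix n assume "homology_iso TYPE('k) \<Delta> i n"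
  then obtain \<phi> :: "('a set \<Rightarrow> 'k) set \<Rightarrow> nat \<Rightarrow> 'k" where "bij_betw \<phi> (homology \<Delta> i) (coordinate_space n)"
    by (auto simp: homology_iso_def)
  then have single: "coordinate_space n = {\<phi> (boundaries \<Delta> i)}" unfolding hom by (simp add: bij_betw_def)
  show "n = 0"
  proof (rule ccontr)
    assume "n \<noteq> 0"
    then have "(\<lambda>_. 0 :: 'k) \<in> coordinate_space n" "(\<lambda>j. if j = 0 then 1 else 0 :: 'k) \<in> coordinate_space n"
      by (auto simp: coordinate_space_def)
    then have "(\<lambda>_. 0 :: 'k) = \<phi> (boundaries \<Delta> i)" "(\<lambda>j. if j = 0 then 1 else 0 :: 'k) = \<phi> (boundaries \<Delta> i)"
      unfolding single by simp_all
    then have "(\<lambda>_ :: nat. 0 :: 'k) = (\<lambda>j. if j = 0 then 1 else 0)" by (rule trans[OF _ sym])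
    from fun_cong[OF this, of 0] show False by simp
  qed
qed

text \<open>The passage from homology to cohomology: a functional that kills the boundaries is a
  cocycle, and the value 1 on the cycle \<open>z\<close> keeps it from being a coboundary.\<close>

lemma separating_functional:
  fixes z :: "'b \<Rightarrow> 'k::field"
  assumes B: "scale.subspace B" and z: "z \<notin> B"
  obtains g where "Vector_Spaces.linear scale (*) g" "g z = 1" "\<And>y. y \<in> B \<Longrightarrow> g y = 0"
proof -
  obtain Bs where Bs: "Bs \<subseteq> B" "scale.independent Bs" "B \<subseteq> scale.span Bs"
    using scale.maximal_independent_subset by blast
  have "scale.span Bs = B" using Bs(3) scale.span_minimal[OF Bs(1) B] by blast
  then have "scale.independent (insert z Bs)" using z Bs(2) by (simp add: scale.independent_insert)
  then obtain g where g: "Vector_Spaces.linear scale (*) g" "\<forall>y\<in>insert z Bs. g y = (if y = z then 1 else 0)"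
    using scale.linear_independent_extend[of "insert z Bs" "\<lambda>y. if y = z then 1 else 0"] by blast
  have "g y = 0" if "y \<in> Bs" for y
    using g(2) that z Bs(1) by auto
  then have "g y = 0" if "y \<in> B" for y
    using scale.linear_eq_0_on_span[OF g(1), of Bs y] that Bs(3) by blast
  moreover have "g z = 1" using g(2) by simp
  ultimately show thesis using that g(1) by blast
qed

definition face_chain :: "'a set \<Rightarrow> 'a set \<Rightarrow> 'k::field" where
  "face_chain \<sigma> \<tau> = (if \<tau> = \<sigma> then 1 else 0)"

section \<open>From a cycle that is not a boundary to a nontrivial cocycle\<close>

context normal_pseudomanifold
begin

lemma edges_bij: "bij_betw (\<lambda>(u, v). {u, v}) edges {\<sigma>\<in>\<Delta>. card \<sigma> = 2}"
proof (rule bij_betw_imageI)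
  show "inj_on (\<lambda>(u, v). {u, v}) edges" by (auto simp: inj_on_def edges_def doubleton_eq_iff)
  show "(\<lambda>(u, v). {u, v}) ` edges = {\<sigma>\<in>\<Delta>. card \<sigma> = 2}"
  proof (intro equalityI subsetI)
    fix \<sigma> assume "\<sigma> \<in> {\<sigma>\<in>\<Delta>. card \<sigma> = 2}"
    then obtain u v where e: "\<sigma> = {u, v}" "u \<noteq> v" "\<sigma> \<in> \<Delta>" by (auto simp: card_2_iff)
    then consider "(u, v) \<in> edges" | "(v, u) \<in> edges"
      using linorder_less_linear[of u v] by (auto simp: edges_def insert_commute)
    then show "\<sigma> \<in> (\<lambda>(u, v). {u, v}) ` edges"
    proof cases
      case 1
      then show ?thesis using e(1) by (intro image_eqI[of _ _ "(u, v)"]) simp_all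
    next
      case 2
      then show ?thesis using e(1) by (intro image_eqI[of _ _ "(v, u)"]) (simp_all add: insert_commute)
    qed
  qed (auto simp: edges_def)
qed

lemma chain_1_expand:
  fixes z :: "'a set \<Rightarrow> 'k::field"
  assumes "z \<in> chains \<Delta> 1"
  shows "z = (\<Sum>(u, v)\<in>edges. scale (z {u, v}) (face_chain {u, v}))"
proof (rule ext)
  fix \<tau>
  have apply_sum: "(\<Sum>i\<in>A. f i) \<tau> = (\<Sum>i\<in>A. f i \<tau>)" for A and f :: "'a set \<Rightarrow> 'a set \<Rightarrow> 'k"
    by (induction A rule: infinite_finite_induct) simp_all
  have "(\<Sum>(u, v)\<in>edges. scale (z {u, v}) (face_chain {u, v} :: 'a set \<Rightarrow> 'k))
      = (\<Sum>\<sigma>\<in>{\<sigma>\<in>\<Delta>. card \<sigma> = 2}. scale (z \<sigma>) (face_chain \<sigma>))"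
    by (subst sum.reindex_bij_betw[OF edges_bij, symmetric]) (simp add: split_def)
  then have "(\<Sum>(u, v)\<in>edges. scale (z {u, v}) (face_chain {u, v})) \<tau>
      = (\<Sum>\<sigma>\<in>{\<sigma>\<in>\<Delta>. card \<sigma> = 2}. if \<tau> = \<sigma> then z \<sigma> else 0)"
    by (auto simp: apply_sum scale_def face_chain_def intro!: sum.cong)
  also have "\<dots> = z \<tau>"
    using finite_complex assms by (auto simp: chains_def face_dim_def)
  finally show "z \<tau> = (\<Sum>(u, v)\<in>edges. scale (z {u, v}) (face_chain {u, v})) \<tau>" ..
qed

lemma bdry_vertex:
  fixes z :: "'a set \<Rightarrow> 'k::field"
  assumes z: "z \<in> chains \<Delta> 1" and v: "v \<in> vertices"
  shows "bdry \<Delta> z {v} = (\<Sum>x\<in>{x\<in>vertices. (x, v) \<in> edges}. z {x, v}) - (\<Sum>x\<in>{x\<in>vertices. (v, x) \<in> edges}. z {v, x})"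
proof -
  have U: "\<Union>\<Delta> = vertices" using singleton_face by (auto simp: vertices_def)
  have sgn: "(- 1) ^ card {y\<in>{v}. y < x} = (if v < x then - 1 else 1 :: 'k)" for x
  proof -
    have "{y\<in>{v}. y < x} = (if v < x then {v} else {})" by auto
    then show ?thesis by simp
  qed
  have "bdry \<Delta> z {v} = (\<Sum>x\<in>vertices - {v}. (if v < x then - 1 else 1) * z {x, v})"
    unfolding bdry_def sgn U by simp
  also have "\<dots> = (\<Sum>x\<in>{x\<in>vertices. (x, v) \<in> edges} \<union> {x\<in>vertices. (v, x) \<in> edges}. (if v < x then - 1 else 1) * z {x, v})"
  proof (rule sum.mono_neutral_right)
    show "\<forall>x\<in>vertices - {v} - ({x\<in>vertices. (x, v) \<in> edges} \<union> {x\<in>vertices. (v, x) \<in> edges}). (if v < x then - 1 else 1) * z {x, v} = 0"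
    proof
      fix x assume "x \<in> vertices - {v} - ({x\<in>vertices. (x, v) \<in> edges} \<union> {x\<in>vertices. (v, x) \<in> edges})"
      then have "{x, v} \<notin> \<Delta>" using linorder_less_linear[of x v] by (auto simp: edges_def insert_commute)
      then have "z {x, v} = 0" using z by (auto simp: chains_def)
      then show "(if v < x then - 1 else 1) * z {x, v} = 0" by simp
    qed
  qed (auto simp: finite_vertices edges_def)
  also have "\<dots> = (\<Sum>x\<in>{x\<in>vertices. (x, v) \<in> edges}. (if v < x then - 1 else 1) * z {x, v})
      + (\<Sum>x\<in>{x\<in>vertices. (v, x) \<in> edges}. (if v < x then - 1 else 1) * z {x, v})"
    using finite_vertices by (intro sum.union_disjoint) (auto simp: edges_def)
  also have "(\<Sum>x\<in>{x\<in>vertices. (x, v) \<in> edges}. (if v < x then - 1 else 1) * z {x, v}) = (\<Sum>x\<in>{x\<in>vertices. (x, v) \<in> edges}. z {x, v})"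
    by (intro sum.cong) (auto simp: edges_def)
  also have "(\<Sum>x\<in>{x\<in>vertices. (v, x) \<in> edges}. (if v < x then - 1 else 1) * z {x, v}) = - (\<Sum>x\<in>{x\<in>vertices. (v, x) \<in> edges}. z {v, x})"
    unfolding sum_negf[symmetric] by (intro sum.cong) (auto simp: edges_def insert_commute)
  finally show ?thesis by simp
qed

text \<open>Summation by parts: the sum is the pairing of \<open>b\<close> with the boundary of
  \<open>z\<close>.\<close>

lemma cycle_coboundary:
  fixes z :: "'a set \<Rightarrow> 'k::field"
  assumes z: "z \<in> cycles \<Delta> 1"
  shows "(\<Sum>(u, v)\<in>edges. z {u, v} * (b v - b u)) = 0"
proof -
  have chain: "z \<in> chains \<Delta> 1" and cyc: "\<And>\<tau>. bdry \<Delta> z \<tau> = 0" using z by (auto simp: cycles_def fun_eq_iff)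
  have e: "edges \<subseteq> vertices \<times> vertices" using edge_vertices by (auto simp: edges_def)
  have 1: "(\<Sum>(u, v)\<in>edges. z {u, v} * b v) = (\<Sum>v\<in>vertices. b v * (\<Sum>u\<in>{u\<in>vertices. (u, v) \<in> edges}. z {u, v}))"
  proof -
    have "(\<Sum>v\<in>vertices. b v * (\<Sum>u\<in>{u\<in>vertices. (u, v) \<in> edges}. z {u, v}))
        = (\<Sum>v\<in>vertices. \<Sum>u\<in>{u\<in>vertices. (u, v) \<in> edges}. z {u, v} * b v)"
      by (simp add: sum_distrib_left mult.commute)
    also have "\<dots> = (\<Sum>u\<in>vertices. \<Sum>v\<in>{v\<in>vertices. (u, v) \<in> edges}. z {u, v} * b v)"
      by (rule sum.swap_restrict[OF finite_vertices finite_vertices])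
    also have "\<dots> = (\<Sum>(u, v)\<in>(SIGMA u:vertices. {v\<in>vertices. (u, v) \<in> edges}). z {u, v} * b v)"
      using finite_vertices by (intro sum.Sigma) auto
    also have "(SIGMA u:vertices. {v\<in>vertices. (u, v) \<in> edges}) = edges" using e by auto
    finally show ?thesis ..
  qed
  have 2: "(\<Sum>(u, v)\<in>edges. z {u, v} * b u) = (\<Sum>u\<in>vertices. b u * (\<Sum>v\<in>{v\<in>vertices. (u, v) \<in> edges}. z {u, v}))"
  proof -
    have "(\<Sum>u\<in>vertices. b u * (\<Sum>v\<in>{v\<in>vertices. (u, v) \<in> edges}. z {u, v}))
        = (\<Sum>u\<in>vertices. \<Sum>v\<in>{v\<in>vertices. (u, v) \<in> edges}. z {u, v} * b u)"
      by (simp add: sum_distrib_left mult.commute)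
    also have "\<dots> = (\<Sum>(u, v)\<in>(SIGMA u:vertices. {v\<in>vertices. (u, v) \<in> edges}). z {u, v} * b u)"
      using finite_vertices by (intro sum.Sigma) auto
    also have "(SIGMA u:vertices. {v\<in>vertices. (u, v) \<in> edges}) = edges" using e by auto
    finally show ?thesis ..
  qed
  have "(\<Sum>(u, v)\<in>edges. z {u, v} * (b v - b u)) = (\<Sum>(u, v)\<in>edges. z {u, v} * b v) - (\<Sum>(u, v)\<in>edges. z {u, v} * b u)"
    by (simp add: split_def right_diff_distrib sum_subtractf)
  also have "\<dots> = (\<Sum>v\<in>vertices. b v * bdry \<Delta> z {v})"
    unfolding 1 2 sum_subtractf[symmetric] by (intro sum.cong refl) (simp add: bdry_vertex[OF chain] right_diff_distrib)
  also have "\<dots> = 0" by (simp add: cyc)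
  finally show ?thesis .
qed

lemma bdry_triangle:
  assumes "{u, v, w} \<in> \<Delta>" "u < v" "v < w"
  shows "bdry \<Delta> (face_chain {u, v, w} :: 'a set \<Rightarrow> 'k::field) = face_chain {v, w} - face_chain {u, w} + face_chain {u, v}"
proof (rule ext)
  fix \<tau> :: "'a set"
  have U: "{u, v, w} \<subseteq> \<Union>\<Delta>" using assms(1) by blast
  have finU: "finite (\<Union>\<Delta>)" using finite_complex finite_face by blast
  have ne: "u \<noteq> v" "v \<noteq> w" "u \<noteq> w" using assms by auto
  have "bdry \<Delta> (face_chain {u, v, w} :: 'a set \<Rightarrow> 'k) \<tau> = (\<Sum>x\<in>{u, v, w}. if x \<notin> \<tau> \<and> insert x \<tau> = {u, v, w}
      then (- 1) ^ card {y\<in>\<tau>. y < x} else 0)"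
    unfolding bdry_def using U finU
    by (intro sum.mono_neutral_cong) (auto simp: face_chain_def)
  also have "\<dots> = (if \<tau> = {v, w} then 1 else 0) - (if \<tau> = {u, w} then 1 else 0) + (if \<tau> = {u, v} then 1 else 0)"
  proof -
    have i: "x \<notin> \<tau> \<and> insert x \<tau> = {u, v, w} \<longleftrightarrow> \<tau> = {u, v, w} - {x}" if "x \<in> {u, v, w}" for x
      using that by auto
    have d: "{u, v, w} - {u} = {v, w}" "{u, v, w} - {v} = {u, w}" "{u, v, w} - {w} = {u, v}" using ne by auto
    have c: "{y\<in>{v, w}. y < u} = {}" "{y\<in>{u, w}. y < v} = {u}" "{y\<in>{u, v}. y < w} = {u, v}"
      using assms(2,3) by auto
    define T where "T x = (if \<tau> = {u, v, w} - {x} then (- 1) ^ card {y\<in>{u, v, w} - {x}. y < x} else 0 :: 'k)" for x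
    have T: "T u = (if \<tau> = {v, w} then 1 else 0)" "T v = - (if \<tau> = {u, w} then 1 else 0)" "T w = (if \<tau> = {u, v} then 1 else 0)"
      unfolding T_def d c using ne(1) by simp_all
    have "(\<Sum>x\<in>{u, v, w}. if x \<notin> \<tau> \<and> insert x \<tau> = {u, v, w} then (- 1) ^ card {y\<in>\<tau>. y < x} else 0 :: 'k)
        = (\<Sum>x\<in>{u, v, w}. T x)"
      unfolding T_def using i by (intro sum.cong) auto
    also have "\<dots> = (if \<tau> = {v, w} then 1 else 0) - (if \<tau> = {u, w} then 1 else 0) + (if \<tau> = {u, v} then 1 else 0)"
      using ne by (simp add: T)
    finally show ?thesis .
  qed
  finally show "bdry \<Delta> (face_chain {u, v, w} :: 'a set \<Rightarrow> 'k) \<tau> = (face_chain {v, w} - face_chain {u, w} + face_chain {u, v}) \<tau>"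
    by (simp add: face_chain_def)
qed

text \<open>The separating functional is read on oriented edges. It is antisymmetric by definition,
  so the identity for increasing triples extends to all orders and to triples with repetitions. Were
  it the coboundary of \<open>b\<close>, \<open>cycle_coboundary\<close> would give g(z) =
  0.\<close>

lemma nontrivial_cocycle:
  assumes "betti TYPE('k::field) \<Delta> 1 > 0"
  obtains \<omega> :: "'a \<Rightarrow> 'a \<Rightarrow> 'k::field" where "\<And>u v w. {u, v, w} \<in> \<Delta> \<Longrightarrow> \<omega> u v + \<omega> v w = \<omega> u w"
    "\<And>b. \<exists>u v. {u, v} \<in> \<Delta> \<and> \<omega> u v \<noteq> b v - b u"
proof -
  have "\<not> cycles \<Delta> 1 \<subseteq> (boundaries \<Delta> 1 :: ('a set \<Rightarrow> 'k) set)" using betti_trivial assms by fastforce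
  then obtain z :: "'a set \<Rightarrow> 'k" where z: "z \<in> cycles \<Delta> 1" "z \<notin> boundaries \<Delta> 1" by blast
  obtain g where g: "Vector_Spaces.linear scale (*) g" "g z = 1" "\<And>y. y \<in> boundaries \<Delta> 1 \<Longrightarrow> g y = 0"
    by (rule separating_functional[OF subspace_boundaries z(2)]) blast
  interpret g: Vector_Spaces.linear "scale :: 'k \<Rightarrow> ('a set \<Rightarrow> 'k) \<Rightarrow> 'a set \<Rightarrow> 'k" "(*) :: 'k \<Rightarrow> 'k \<Rightarrow> 'k" g by (rule g(1))
  define \<omega> where "\<omega> u v = (if u < v then g (face_chain {u, v}) else if v < u then - g (face_chain {u, v}) else 0)" for u v
  have anti: "\<omega> v u = - \<omega> u v" for u v by (auto simp: \<omega>_def insert_commute)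
  have mono: "\<omega> u v + \<omega> v w = \<omega> u w" if f: "{u, v, w} \<in> \<Delta>" "u < v" "v < w" for u v w
  proof -
    have "u \<noteq> v" "v \<noteq> w" "u \<noteq> w" using f by auto
    then have "card {u, v, w} = 3" by simp
    then have "face_chain {u, v, w} \<in> (chains \<Delta> (1 + 1) :: ('a set \<Rightarrow> 'k) set)"
      using f(1) by (auto simp: chains_def face_chain_def face_dim_def)
    then have "bdry \<Delta> (face_chain {u, v, w} :: 'a set \<Rightarrow> 'k) \<in> boundaries \<Delta> 1" by (simp add: boundaries_def)
    from g(3)[OF this] have "g (face_chain {v, w} - face_chain {u, w} + face_chain {u, v}) = 0"
      unfolding bdry_triangle[OF f] .
    then have "g (face_chain {v, w}) - g (face_chain {u, w}) + g (face_chain {u, v}) = 0"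
      by (simp add: g.add g.diff)
    moreover have "u < w" using f by simp
    ultimately show ?thesis using f by (simp add: \<omega>_def algebra_simps)
  qed
  have self: "\<omega> u u = 0" for u by (simp add: \<omega>_def)
  show thesis
  proof (rule that[of \<omega>])
    fix u v w assume f: "{u, v, w} \<in> \<Delta>"
    have perm: "{u, w, v} = {u, v, w}" "{v, u, w} = {u, v, w}" "{v, w, u} = {u, v, w}" "{w, u, v} = {u, v, w}" "{w, v, u} = {u, v, w}"
      by auto
    consider "u = v" | "v = w" | "u = w" | "u < v" "v < w" | "u < w" "w < v" | "v < u" "u < w" | "v < w" "w < u"
      | "w < u" "u < v" | "w < v" "v < u" by fastforce
    then show "\<omega> u v + \<omega> v w = \<omega> u w"
    proof cases
      case 4 then show ?thesis using mono f by blast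
    next
      case 5 then show ?thesis using mono[of u w v] f perm anti[of w v] by (simp add: algebra_simps)
    next
      case 6 then show ?thesis using mono[of v u w] f perm anti[of u v] by (simp add: algebra_simps)
    next
      case 7 then show ?thesis using mono[of v w u] f perm anti[of u v] anti[of u w] by (simp add: algebra_simps)
    next
      case 8 then show ?thesis using mono[of w u v] f perm anti[of v w] anti[of u w] by (simp add: algebra_simps)
    next
      case 9 then show ?thesis using mono[of w v u] f perm anti[of u v] anti[of v w] anti[of u w] by (simp add: algebra_simps)
    qed (use anti[of u v] self in auto)
  next
    fix b :: "'a \<Rightarrow> 'k"
    show "\<exists>u v. {u, v} \<in> \<Delta> \<and> \<omega> u v \<noteq> b v - b u"
    proof (rule ccontr)
      assume "\<not> ?thesis"
      then have cob: "\<omega> u v = b v - b u" if "{u, v} \<in> \<Delta>" for u v using that by blast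
      have "z = (\<Sum>(u, v)\<in>edges. scale (z {u, v}) (face_chain {u, v}))"
        using z(1) by (intro chain_1_expand) (simp add: cycles_def)
      then have "g z = g (\<Sum>(u, v)\<in>edges. scale (z {u, v}) (face_chain {u, v}))" by simp
      also have "\<dots> = (\<Sum>(u, v)\<in>edges. z {u, v} * g (face_chain {u, v}))"
        by (simp add: g.sum split_def g.scale)
      also have "\<dots> = (\<Sum>(u, v)\<in>edges. z {u, v} * (b v - b u))"
      proof (intro sum.cong refl, clarify)
        fix u v assume "(u, v) \<in> edges"
        then have "{u, v} \<in> \<Delta>" "\<omega> u v = g (face_chain {u, v})" by (auto simp: edges_def \<omega>_def)
        moreover from this(1) have "\<omega> u v = b v - b u" by (rule cob)
        ultimately have "g (face_chain {u, v}) = b v - b u" by simp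
        then show "z {u, v} * g (face_chain {u, v}) = z {u, v} * (b v - b u)" by simp
      qed
      also have "\<dots> = 0" by (rule cycle_coboundary[OF z(1)])
      finally show False using g(2) by simp
    qed
  qed
qed

end

text \<open>A linear subspace over the prime field.\<close>

definition prime_subspace :: "'k::field set \<Rightarrow> bool" where
  "prime_subspace N \<longleftrightarrow> 0 \<in> N \<and> (\<forall>x\<in>N. \<forall>y\<in>N. x - y \<in> N) \<and>
     (\<forall>x. \<forall>j :: int. (of_int j :: 'k) \<noteq> 0 \<longrightarrow> of_int j * x \<in> N \<longrightarrow> x \<in> N)"

lemma prime_subspace_diff: "prime_subspace N \<Longrightarrow> x \<in> N \<Longrightarrow> y \<in> N \<Longrightarrow> x - y \<in> N"
  by (simp add: prime_subspace_def)

lemma prime_subspace_0: "prime_subspace N \<Longrightarrow> 0 \<in> N"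
  by (simp add: prime_subspace_def)

lemma prime_subspace_divide:
  fixes N :: "'k::field set"
  assumes "prime_subspace N" "(of_int j :: 'k) \<noteq> 0" "of_int j * x \<in> N"
  shows "x \<in> N"
  using assms(1)[unfolded prime_subspace_def, THEN conjunct2, THEN conjunct2, rule_format, OF assms(2,3)] .

lemma prime_subspace_uminus: "prime_subspace N \<Longrightarrow> x \<in> N \<Longrightarrow> - x \<in> N"
  using prime_subspace_diff[of N 0 x] prime_subspace_0[of N] by simp

lemma prime_subspace_add: "prime_subspace N \<Longrightarrow> x \<in> N \<Longrightarrow> y \<in> N \<Longrightarrow> x + y \<in> N"
  using prime_subspace_diff[of N x "- y"] prime_subspace_uminus[of N y] by simp

lemma prime_subspace_mult:
  assumes N: "prime_subspace N" and x: "x \<in> N"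
  shows "of_int k * x \<in> N"
proof (induction k rule: int_induct[where k = 0])
  case base
  show ?case by (simp add: prime_subspace_0[OF N])
next
  case (step1 i)
  then show ?case using prime_subspace_add[OF N step1(2) x] by (simp add: algebra_simps)
next
  case (step2 i)
  then show ?case using prime_subspace_diff[OF N step2(2) x] by (simp add: algebra_simps)
qed

section \<open>Coordinates over the prime field\<close>

text \<open>Maximality makes the quotient by \<open>N\<close> a line over the prime field, spanned
  by \<open>a\<close>; in this way cochains with values in the field will become integral
  ones.\<close>

lemma maximal_prime_subspace:
  fixes a :: "'k::field"
  assumes "a \<noteq> 0"
  obtains N where "prime_subspace N" "a \<notin> N" "\<And>M. prime_subspace M \<Longrightarrow> a \<notin> M \<Longrightarrow> N \<subseteq> M \<Longrightarrow> M = N"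
proof -
  define F where "F = {N. prime_subspace N \<and> a \<notin> N}"
  have "prime_subspace {0 :: 'k}" by (simp add: prime_subspace_def)
  then have "{0} \<in> F" using assms by (simp add: F_def)
  then have "F \<noteq> {}" by blast
  have chain: "\<Union>C \<in> F" if C: "C \<noteq> {}" "subset.chain F C" for C
  proof -
    have CF: "C \<subseteq> F" and total: "\<And>X Y. X \<in> C \<Longrightarrow> Y \<in> C \<Longrightarrow> X \<subseteq> Y \<or> Y \<subseteq> X"
      using C(2) by (auto simp: subset_chain_def)
    have N: "prime_subspace X" "a \<notin> X" if "X \<in> C" for X using CF that by (auto simp: F_def)
    have "prime_subspace (\<Union>C)"
      unfolding prime_subspace_def
    proof (intro conjI ballI allI impI)
      obtain X where "X \<in> C" using C(1) by blast
      then show "0 \<in> \<Union>C" using prime_subspace_0[OF N(1)] by blast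
    next
      fix x y assume "x \<in> \<Union>C" "y \<in> \<Union>C"
      then obtain X Y where XY: "X \<in> C" "x \<in> X" "Y \<in> C" "y \<in> Y" by blast
      consider "X \<subseteq> Y" | "Y \<subseteq> X" using total XY by blast
      then show "x - y \<in> \<Union>C"
      proof cases
        case 1
        then have "x - y \<in> Y" using XY by (intro prime_subspace_diff N) auto
        then show ?thesis using XY by blast
      next
        case 2
        then have "x - y \<in> X" using XY by (intro prime_subspace_diff N) auto
        then show ?thesis using XY by blast
      qed
    next
      fix x and j :: int assume j: "(of_int j :: 'k) \<noteq> 0" "of_int j * x \<in> \<Union>C"
      then obtain X where "X \<in> C" "of_int j * x \<in> X" by blast
      then show "x \<in> \<Union>C" using prime_subspace_divide[OF N(1) j(1)] by blast
    qed
    moreover have "a \<notin> \<Union>C" using N(2) by blast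
    ultimately show ?thesis by (simp add: F_def)
  qed
  obtain N where N: "N \<in> F" "\<forall>X\<in>F. N \<subseteq> X \<longrightarrow> X = N"
    using subset_Zorn_nonempty[OF \<open>F \<noteq> {}\<close> chain] by blast
  have "prime_subspace N" "a \<notin> N" using N(1) by (simp_all add: F_def)
  moreover have "M = N" if "prime_subspace M" "a \<notin> M" "N \<subseteq> M" for M
    using N(2) that by (simp add: F_def)
  ultimately show thesis by (rule that)
qed

text \<open>For \<open>x\<close> outside \<open>N\<close>, the span of \<open>N\<close> and
  \<open>x\<close> over the prime field contains \<open>a\<close> by maximality; solving the
  relation for \<open>x\<close> gives its coordinate j / i. With numerator and denominator kept as
  integers, the prime field itself is never formed.\<close>

lemma prime_field_coordinate:
  fixes a :: "'k::field"
  assumes N: "prime_subspace N" and aN: "a \<notin> N"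
    and max: "\<And>M. prime_subspace M \<Longrightarrow> a \<notin> M \<Longrightarrow> N \<subseteq> M \<Longrightarrow> M = N"
  shows "\<exists>i j :: int. (of_int i :: 'k) \<noteq> 0 \<and> of_int i * x - of_int j * a \<in> N"
proof (cases "x \<in> N")
  case True
  then show ?thesis by (intro exI[of _ 1] exI[of _ 0]) simp
next
  case False
  \<comment> \<open>The span of \<open>N\<close> and \<open>x\<close> over the prime field, with
    denominators cleared.\<close>
  define M where "M = {y. \<exists>i j :: int. (of_int i :: 'k) \<noteq> 0 \<and> of_int i * y - of_int j * x \<in> N}"
  have M_I: "y \<in> M" if "(of_int i :: 'k) \<noteq> 0" "of_int i * y - of_int j * x \<in> N" for i j y
    using that by (auto simp: M_def)
  have "prime_subspace M"
    unfolding prime_subspace_def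
  proof (intro conjI ballI allI impI)
    show "0 \<in> M" by (rule M_I[of 1 _ 0]) (simp_all add: prime_subspace_0[OF N])
  next
    fix y1 y2 assume "y1 \<in> M" "y2 \<in> M"
    then obtain i1 j1 i2 j2 where ij: "(of_int i1 :: 'k) \<noteq> 0" "of_int i1 * y1 - of_int j1 * x \<in> N"
      "(of_int i2 :: 'k) \<noteq> 0" "of_int i2 * y2 - of_int j2 * x \<in> N" unfolding M_def by blast
    have "of_int i2 * (of_int i1 * y1 - of_int j1 * x) - of_int i1 * (of_int i2 * y2 - of_int j2 * x) \<in> N"
      by (rule prime_subspace_diff[OF N prime_subspace_mult[OF N ij(2)] prime_subspace_mult[OF N ij(4)]])
    also have "of_int i2 * (of_int i1 * y1 - of_int j1 * x) - of_int i1 * (of_int i2 * y2 - of_int j2 * x)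
        = of_int (i1 * i2) * (y1 - y2) - of_int (i2 * j1 - i1 * j2) * x"
      by (simp add: algebra_simps)
    finally show "y1 - y2 \<in> M" using ij by (intro M_I[of "i1 * i2" _ "i2 * j1 - i1 * j2"]) auto
  next
    fix y and m :: int assume m: "(of_int m :: 'k) \<noteq> 0" "of_int m * y \<in> M"
    then obtain i j where ij: "(of_int i :: 'k) \<noteq> 0" "of_int i * (of_int m * y) - of_int j * x \<in> N"
      unfolding M_def by blast
    then show "y \<in> M" using m(1) by (intro M_I[of "i * m" _ j]) (auto simp: mult.assoc)
  qed
  moreover have "N \<subseteq> M" using M_I[of 1 _ 0] by auto
  moreover have "x \<in> M" by (rule M_I[of 1 _ 1]) (simp_all add: prime_subspace_0[OF N])
  ultimately have "a \<in> M" using max[of M] False by blast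
  then obtain i j where ij: "(of_int i :: 'k) \<noteq> 0" "of_int i * a - of_int j * x \<in> N" unfolding M_def by blast
  have "(of_int j :: 'k) \<noteq> 0"
  proof
    assume "(of_int j :: 'k) = 0"
    then have "of_int i * a \<in> N" using ij(2) by simp
    then show False using prime_subspace_divide[OF N ij(1)] aN by blast
  qed
  moreover have "of_int j * x - of_int i * a \<in> N" using prime_subspace_uminus[OF N ij(2)] by simp
  ultimately show ?thesis by blast
qed

text \<open>One denominator serves all of \<open>X\<close>: at each step the old and the new one are
  multiplied and the numerators scaled accordingly.\<close>

lemma prime_field_coordinates:
  fixes a :: "'k::field"
  assumes N: "prime_subspace N" and aN: "a \<notin> N"
    and max: "\<And>M. prime_subspace M \<Longrightarrow> a \<notin> M \<Longrightarrow> N \<subseteq> M \<Longrightarrow> M = N" and "finite X"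
  shows "\<exists>(i :: int) J. (of_int i :: 'k) \<noteq> 0 \<and> (\<forall>x\<in>X. of_int i * x - of_int (J x) * a \<in> N)"
  using assms(4)
proof (induction X rule: finite_induct)
  case empty
  show ?case by (intro exI[of _ 1]) simp
next
  case (insert x X)
  then obtain i J where iJ: "(of_int i :: 'k) \<noteq> 0" "\<And>y. y \<in> X \<Longrightarrow> of_int i * y - of_int (J y) * a \<in> N" by blast
  obtain i' j' where ij: "(of_int i' :: 'k) \<noteq> 0" "of_int i' * x - of_int j' * a \<in> N"
    using prime_field_coordinate[OF N aN max] by blast
  define J' where "J' y = (if y = x then i * j' else i' * J y)" for y
  have "of_int (i * i') * y - of_int (J' y) * a \<in> N" if "y \<in> insert x X" for y
  proof (cases "y = x")
    case True
    then show ?thesis using prime_subspace_mult[OF N ij(2), of i] by (simp add: J'_def algebra_simps)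
  next
    case False
    then have "y \<in> X" using that by simp
    then show ?thesis using prime_subspace_mult[OF N iJ(2), of y i'] False by (simp add: J'_def algebra_simps)
  qed
  moreover have "(of_int (i * i') :: 'k) \<noteq> 0" using iJ(1) ij(1) by simp
  ultimately show ?case by blast
qed

text \<open>In characteristic zero any prime larger than |m| will do, because
  \<open>of_int n = 0\<close> forces n = 0; otherwise the prime is the characteristic.\<close>

lemma exists_prime_modulus:
  assumes "(of_int m :: 'k::field) \<noteq> 0"
  obtains p :: int where "prime p" "\<not> p dvd m" "\<And>n. (of_int n :: 'k) = 0 \<Longrightarrow> p dvd n"
proof (cases "CHAR('k) = 0")
  case True
  have m: "m \<noteq> 0" using assms by auto
  obtain q :: nat where q: "prime q" "nat \<bar>m\<bar> < q" using bigger_prime by blast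
  have "\<not> int q dvd m"
  proof
    assume "int q dvd m"
    from dvd_imp_le_int[OF m this] have "int q \<le> \<bar>m\<bar>" by simp
    then show False using q(2) by linarith
  qed
  moreover have "int q dvd n" if "(of_int n :: 'k) = 0" for n
    using that True by (simp add: of_int_eq_0_iff_char_dvd)
  ultimately show thesis using that[of "int q"] q(1) by simp
next
  case False
  then have "prime CHAR('k)" by (intro prime_CHAR_semidom) simp
  then show thesis using that[of "int CHAR('k)"] assms by (simp add: of_int_eq_0_iff_char_dvd)
qed

context normal_pseudomanifold
begin

text \<open>The \<open>p\<close>-sheeted cover of an integral 1-cochain that is a cocycle modulo \<open>p\<close>. Two walks to the
  same vertex on which the cochain takes different values modulo \<open>p\<close> make it connected.\<close>

inductive walk :: "('a \<Rightarrow> 'a \<Rightarrow> 'g::ab_group_add) \<Rightarrow> 'a \<Rightarrow> 'a \<Rightarrow> 'g \<Rightarrow> bool" for c v0 where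
  start: "walk c v0 v0 0"
| step: "walk c v0 v a \<Longrightarrow> {v, u} \<in> \<Delta> \<Longrightarrow> walk c v0 u (a + c v u)"

lemma walk_exists:
  assumes "{v0} \<in> \<Delta>" "{v} \<in> \<Delta>"
  shows "\<exists>a. walk c v0 v a"
  using graph_connected[OF assms]
proof (induction rule: rtrancl_induct)
  case base
  show ?case using walk.start by blast
next
  case (step v u)
  then show ?case using walk.step by blast
qed

lemma edges_ge_of_cochain:
  fixes c :: "'a \<Rightarrow> 'a \<Rightarrow> int"
  assumes p: "prime p" and coc: "\<And>u v w. {u, v, w} \<in> \<Delta> \<Longrightarrow> p dvd c u v + c v w - c u w"
    and walks: "{v0} \<in> \<Delta>" "walk c v0 v1 m" "walk c v0 v1 m'" "\<not> p dvd m - m'"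
  shows "d * card vertices \<le> card edges"
proof -
  have p1: "1 < p" using p prime_gt_1_int by blast
  define W where "W = vertices \<times> {0..<p}"
  define lift where "lift w u = (u, (snd w + c (fst w) u) mod p)" for w u
  define E where "E = {(w, lift w u) | w u. w \<in> W \<and> {fst w, u} \<in> \<Delta>}"
  have self: "p dvd c u u" if "{u} \<in> \<Delta>" for u using coc[of u u u] that by simp
  have finW: "finite W" using finite_vertices by (simp add: W_def)
  have lift_self: "lift w (fst w) = w" if "w \<in> W" for w
  proof -
    obtain v a where wa: "w = (v, a)" by (cases w)
    then have w: "w = (v, a)" "{v} \<in> \<Delta>" "0 \<le> a" "a < p" using that by (auto simp: W_def vertices_def)
    have "(a + c v v) mod p = a mod p" using self[OF w(2)] by (metis add.right_neutral dvd_imp_mod_0 mod_add_right_eq)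
    then show ?thesis using w by (simp add: lift_def)
  qed
  have lift_in: "lift w u \<in> W \<and> fst (lift w u) = u" if "w \<in> W" "{fst w, u} \<in> \<Delta>" for w u
    using edge_vertices[OF that(2)] p1 by (simp add: lift_def W_def)
  have lift_lift: "lift (lift w u) v = lift w v" if "w \<in> W" "{fst w, u, v} \<in> \<Delta>" for w u v
  proof -
    have "p dvd c (fst w) u + c u v - c (fst w) v" by (rule coc[OF that(2)])
    then have "p dvd (snd w + c (fst w) u + c u v) - (snd w + c (fst w) v)" by (simp add: algebra_simps)
    then have "(snd w + c (fst w) u + c u v) mod p = (snd w + c (fst w) v) mod p" by (simp add: mod_eq_dvd_iff)
    then show ?thesis by (simp add: lift_def mod_add_left_eq)
  qed
  have symE: "sym E"
  proof (rule symI)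
    fix w w' assume "(w, w') \<in> E"
    then obtain u where u: "w \<in> W" "{fst w, u} \<in> \<Delta>" "w' = lift w u" by (auto simp: E_def)
    have "{fst w, u, fst w} \<in> \<Delta>" using u(2) by (simp add: insert_commute)
    then have "lift w' (fst w) = w" using lift_lift[OF u(1)] lift_self[OF u(1)] u(3) by simp
    moreover have "w' \<in> W" "{fst w', fst w} \<in> \<Delta>" using lift_in[OF u(1,2)] u(2,3) by (auto simp: insert_commute)
    ultimately show "(w', w) \<in> E"
      unfolding E_def mem_Collect_eq by (intro exI[of _ w'] exI[of _ "fst w"]) simp
  qed
  have symE': "sym (E\<^sup>*)" by (rule sym_rtrancl[OF symE])
  \<comment> \<open>The lift of a walk of value \<open>a\<close> that starts on sheet
    \<open>b\<close> ends on sheet \<open>b + a\<close>.\<close>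
  have walk_E: "((v0, b mod p), (v, (b + a) mod p)) \<in> E\<^sup>*" if "walk c v0 v a" for v a b
    using that
  proof (induction rule: walk.induct)
    case start
    show ?case by simp
  next
    case (step v a u)
    have "((v, (b + a) mod p), lift (v, (b + a) mod p) u) \<in> E"
      unfolding E_def using step.hyps(2) edge_vertices[OF step.hyps(2)] p1 by (auto simp: W_def)
    moreover have "lift (v, (b + a) mod p) u = (u, (b + (a + c v u)) mod p)"
      by (simp add: lift_def mod_add_left_eq add.assoc)
    ultimately show ?case using step.IH by (metis rtrancl.rtrancl_into_rtrancl)
  qed
  \<comment> \<open>Out along the first walk and back along the second changes the sheet by m -
    m'.\<close>
  have shift: "((v0, b mod p), (v0, (b + (m - m')) mod p)) \<in> E\<^sup>*" for b
  proof -
    have "((v0, b mod p), (v1, (b + m) mod p)) \<in> E\<^sup>*" by (rule walk_E[OF walks(2)])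
    moreover have "((v0, (b + (m - m')) mod p), (v1, (b + m) mod p)) \<in> E\<^sup>*"
      using walk_E[OF walks(3), of "b + (m - m')"] by (simp add: algebra_simps)
    ultimately show ?thesis using symE' by (meson rtrancl_trans symD)
  qed
  have shifts: "((v0, 0), (v0, (int k * (m - m')) mod p)) \<in> E\<^sup>*" for k
  proof (induction k)
    case (Suc k)
    have "((v0, (int k * (m - m')) mod p), (v0, (int k * (m - m') + (m - m')) mod p)) \<in> E\<^sup>*" by (rule shift)
    moreover have "int (Suc k) * (m - m') = int k * (m - m') + (m - m')" by (simp add: algebra_simps)
    ultimately show ?case using Suc.IH by (metis rtrancl_trans)
  qed simp
  \<comment> \<open>m - m' is invertible modulo the prime \<open>p\<close>, so its multiples reach
    every sheet.\<close>
  have base: "((v0, 0), (v0, r)) \<in> E\<^sup>*" if r: "r \<in> {0..<p}" for r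
  proof -
    have "coprime (m - m') p" using prime_imp_coprime[OF p walks(4)] by (simp add: coprime_commute)
    then obtain k' where "[(m - m') * k' = 1] (mod p)" using cong_solve_coprime_int by blast
    from cong_scalar_right[OF this, of r] have "[(m - m') * (k' * r) = r] (mod p)" by (simp add: mult.assoc)
    then obtain k where k: "((m - m') * k) mod p = r mod p" unfolding cong_def by blast
    have "int (nat (k mod p)) = k mod p" using p1 by simp
    then have "(int (nat (k mod p)) * (m - m')) mod p = (k * (m - m')) mod p"
      by (simp only: mod_mult_left_eq)
    also have "\<dots> = r" using k r by (simp add: mult.commute)
    finally have "(int (nat (k mod p)) * (m - m')) mod p = r" .
    then show ?thesis using shifts[of "nat (k mod p)"] by simp
  qed
  have reach: "((v0, 0), w) \<in> E\<^sup>*" if w: "w \<in> W" for w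
  proof -
    obtain v r where wr: "w = (v, r)" by (cases w)
    then have v: "w = (v, r)" "{v} \<in> \<Delta>" "r \<in> {0..<p}" using w by (auto simp: W_def vertices_def)
    obtain a where a: "walk c v0 v a" using walk_exists[OF walks(1) v(2)] by blast
    have "((v0, (r - a) mod p), (v, (r - a + a) mod p)) \<in> E\<^sup>*" by (rule walk_E[OF a])
    moreover have "((v0, 0), (v0, (r - a) mod p)) \<in> E\<^sup>*" using p1 by (intro base) simp
    ultimately show ?thesis using v by (simp add: rtrancl_trans)
  qed
  interpret pseudomanifold_cover \<Delta> d W fst lift
  proof unfold_locales
    show "(w, w') \<in> {(w, lift w u) | w u. w \<in> W \<and> {fst w, u} \<in> \<Delta>}\<^sup>*" if "w \<in> W" "w' \<in> W" for w w'
      using reach[OF that(1)] reach[OF that(2)] symE' unfolding E_def[symmetric] by (meson rtrancl_trans symD)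
    show "{fst w} \<in> \<Delta>" if "w \<in> W" for w using that by (auto simp: W_def vertices_def)
  qed (use finW lift_self lift_in lift_lift in auto)
  have "fibre v0 = {v0} \<times> {0..<p}" unfolding fibre_def using walks(1) by (auto simp: W_def vertices_def)
  then have "card (fibre v0) = nat p" by (simp add: card_cartesian_product)
  then show ?thesis using p1 by (intro edges_ge_of_cover[OF walks(1)]) simp
qed

text \<open>Two walks with common ends have \<omega>-values that differ by some nonzero \<delta>.
  Coordinates along \<delta> modulo \<open>N\<close> turn \<omega> into an integral cochain. The
  defect of its cocycle identity vanishes in the field, while the values on the two lifted walks
  differ there by the common denominator \<open>i\<close>, which does not; a suitable prime
  separates the two.\<close>

theorem edges_ge_of_betti:
  assumes "betti TYPE('k::field) \<Delta> 1 > 0" and v0: "{v0} \<in> \<Delta>"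
  shows "d * card vertices \<le> card edges"
proof -
  obtain \<omega> :: "'a \<Rightarrow> 'a \<Rightarrow> 'k" where coc: "\<And>u v w. {u, v, w} \<in> \<Delta> \<Longrightarrow> \<omega> u v + \<omega> v w = \<omega> u w"
    and non: "\<And>b. \<exists>u v. {u, v} \<in> \<Delta> \<and> \<omega> u v \<noteq> b v - b u"
    by (rule nontrivial_cocycle[OF assms(1)]) blast
  \<comment> \<open>If the walks to a vertex always had the same value, these values would be a
    potential \<open>b\<close> with coboundary \<omega>.\<close>
  have "\<exists>v a a'. walk \<omega> v0 v a \<and> walk \<omega> v0 v a' \<and> a \<noteq> a'"
  proof (rule ccontr)
    assume contra: "\<not> ?thesis"
    define b where "b v = (SOME a. walk \<omega> v0 v a)" for v
    have b: "walk \<omega> v0 v (b v)" if "{v} \<in> \<Delta>" for v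
      unfolding b_def by (rule someI_ex[OF walk_exists[OF v0 that]])
    have "\<omega> u v = b v - b u" if uv: "{u, v} \<in> \<Delta>" for u v
    proof -
      have "{u} \<in> \<Delta>" "{v} \<in> \<Delta>" using edge_vertices[OF uv] by (simp_all add: vertices_def)
      then have "walk \<omega> v0 v (b u + \<omega> u v)" "walk \<omega> v0 v (b v)" using walk.step[OF b uv] b by blast+
      then have "b u + \<omega> u v = b v" using contra by blast
      then show ?thesis by (simp add: algebra_simps)
    qed
    then show False using non[of b] by blast
  qed
  then obtain v1 a a' where w: "walk \<omega> v0 v1 a" "walk \<omega> v0 v1 a'" "a \<noteq> a'" by blast
  define \<delta> where "\<delta> = a - a'"
  have "\<delta> \<noteq> 0" using w(3) by (simp add: \<delta>_def)
  then obtain N where N: "prime_subspace N" "\<delta> \<notin> N" "\<And>M. prime_subspace M \<Longrightarrow> \<delta> \<notin> M \<Longrightarrow> N \<subseteq> M \<Longrightarrow> M = N"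
    by (rule maximal_prime_subspace) blast
  define X where "X = (\<lambda>(u, v). \<omega> u v) ` (vertices \<times> vertices)"
  have "finite X" using finite_vertices by (simp add: X_def)
  then obtain i J where iJ: "(of_int i :: 'k) \<noteq> 0" "\<And>y. y \<in> X \<Longrightarrow> of_int i * y - of_int (J y) * \<delta> \<in> N"
    using prime_field_coordinates[OF N(1,2,3), of X] by blast
  define c where "c u v = J (\<omega> u v)" for u v
  have c: "of_int i * \<omega> u v - of_int (c u v) * \<delta> \<in> N" if "{u, v} \<in> \<Delta>" for u v
    using edge_vertices[OF that] unfolding c_def by (intro iJ(2)) (auto simp: X_def)
  \<comment> \<open>An integer that is nonzero in the field could be divided out, which would put
    \<delta> into \<open>N\<close>.\<close>
  have zero: "(of_int n :: 'k) = 0" if "of_int n * \<delta> \<in> N" for n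
    using prime_subspace_divide[OF N(1) _ that] N(2) by blast
  have coc': "(of_int (c u v + c v x - c u x) :: 'k) = 0" if f: "{u, v, x} \<in> \<Delta>" for u v x
  proof (rule zero)
    have f': "{u, v} \<in> \<Delta>" "{v, x} \<in> \<Delta>" "{u, x} \<in> \<Delta>" by (rule face_subset[OF f]; auto)+
    have "(of_int i * \<omega> u x - of_int (c u x) * \<delta>) - ((of_int i * \<omega> u v - of_int (c u v) * \<delta>) + (of_int i * \<omega> v x - of_int (c v x) * \<delta>)) \<in> N"
      by (intro prime_subspace_diff[OF N(1)] prime_subspace_add[OF N(1)] c f')
    also have "(of_int i * \<omega> u x - of_int (c u x) * \<delta>) - ((of_int i * \<omega> u v - of_int (c u v) * \<delta>) + (of_int i * \<omega> v x - of_int (c v x) * \<delta>))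
        = of_int (c u v + c v x - c u x) * \<delta>"
      unfolding coc[OF f, symmetric] by (simp add: algebra_simps)
    finally show "of_int (c u v + c v x - c u x) * \<delta> \<in> N" .
  qed
  have lift_walk: "\<exists>m. walk c v0 v m \<and> of_int i * a - of_int m * \<delta> \<in> N" if "walk \<omega> v0 v a" for v a
    using that
  proof (induction rule: walk.induct)
    case start
    show ?case using walk.start[of c v0] prime_subspace_0[OF N(1)] by (intro exI[of _ 0]) simp
  next
    case (step v a u)
    then obtain m where m: "walk c v0 v m" "of_int i * a - of_int m * \<delta> \<in> N" by blast
    have "(of_int i * a - of_int m * \<delta>) + (of_int i * \<omega> v u - of_int (c v u) * \<delta>) \<in> N"
      by (rule prime_subspace_add[OF N(1) m(2) c[OF step.hyps(2)]])
    then have "of_int i * (a + \<omega> v u) - of_int (m + c v u) * \<delta> \<in> N" by (simp add: algebra_simps)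
    then show ?case using walk.step[OF m(1) step.hyps(2)] by blast
  qed
  obtain m where m: "walk c v0 v1 m" "of_int i * a - of_int m * \<delta> \<in> N" using lift_walk[OF w(1)] by blast
  obtain m' where m': "walk c v0 v1 m'" "of_int i * a' - of_int m' * \<delta> \<in> N" using lift_walk[OF w(2)] by blast
  have "(of_int i * a - of_int m * \<delta>) - (of_int i * a' - of_int m' * \<delta>) \<in> N"
    by (rule prime_subspace_diff[OF N(1) m(2) m'(2)])
  then have "of_int (i - (m - m')) * \<delta> \<in> N" by (simp add: \<delta>_def algebra_simps)
  then have "(of_int (m - m') :: 'k) = of_int i" using zero[of "i - (m - m')"] by simp
  then have "(of_int (m - m') :: 'k) \<noteq> 0" using iJ(1) by simp
  then obtain p where p: "prime p" "\<not> p dvd m - m'" "\<And>n. (of_int n :: 'k) = 0 \<Longrightarrow> p dvd n"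
    by (rule exists_prime_modulus) blast
  show ?thesis
    by (rule edges_ge_of_cochain[OF p(1) p(3)[OF coc'] v0 m(1) m'(1) p(2)])
qed

end

section \<open>The lower and the upper bound\<close>

context normal_pseudomanifold
begin

lemma f_vector_m1: "f_vector \<Delta> (- 1) = 1"
proof -
  have "{\<sigma>\<in>\<Delta>. face_dim \<sigma> = - 1} = {{}}"
    using complex finite_face by (auto simp: face_dim_def abstract_complex_def)
  then show ?thesis by (simp add: f_vector_def)
qed

lemma f_vector_0: "f_vector \<Delta> 0 = card vertices"
proof -
  have "{\<sigma>\<in>\<Delta>. face_dim \<sigma> = 0} = (\<lambda>v. {v}) ` vertices"
    by (auto simp: face_dim_def vertices_def card_1_singleton_iff)
  then show ?thesis by (simp add: f_vector_def card_image)
qed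

lemma f_vector_1: "f_vector \<Delta> 1 = card edges"
proof -
  have "{\<sigma>\<in>\<Delta>. face_dim \<sigma> = 1} = {\<sigma>\<in>\<Delta>. card \<sigma> = 2}" by (auto simp: face_dim_def)
  then show ?thesis using bij_betw_same_card[OF edges_bij] by (simp add: f_vector_def)
qed

lemma h_vector_1: "h_vector d \<Delta> 1 = int (card vertices) - int d"
  using d binomial_symmetric[of 1 d] by (simp add: h_vector_def f_vector_m1 f_vector_0)

lemma h_vector_2: "h_vector d \<Delta> 2 = int (card edges) - (int d - 1) * int (card vertices) + int (d choose 2)"
proof -
  have "{0..2} = {0, 1, 2 :: nat}" by auto
  moreover have "(d - 1) choose (d - 2) = d - 1" using binomial_symmetric[of "d - 2" "d - 1"] d by simp
  moreover have "d choose (d - 2) = d choose 2" using binomial_symmetric[of 2 d] d by simp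
  ultimately show ?thesis
    using d by (simp add: h_vector_def f_vector_m1 f_vector_0 f_vector_1 of_nat_diff algebra_simps)
qed

lemma two_choose_two: "2 * int (n choose 2) = int n * (int n - 1)"
proof -
  have "even (n * (n - 1))" by (cases n) simp_all
  then have "2 * (n choose 2) = n * (n - 1)" unfolding choose_two by (rule dvd_mult_div_cancel)
  then have "2 * int (n choose 2) = int (n * (n - 1))" by (metis of_nat_mult of_nat_numeral)
  then show ?thesis by (cases n) (simp_all add: algebra_simps)
qed

lemma g_2: "h_vector d \<Delta> 2 - h_vector d \<Delta> 1 = int (card edges) - int d * int (card vertices) + int ((d + 1) choose 2)"
proof -
  have "(d + 1) choose 2 = (d choose 2) + d" by (simp add: numeral_2_eq_2)
  then show ?thesis unfolding h_vector_1 h_vector_2 by (simp add: algebra_simps)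
qed

lemma card_edges_le: "card edges \<le> card vertices choose 2"
proof -
  have "card edges = card {\<sigma>\<in>\<Delta>. card \<sigma> = 2}" by (rule bij_betw_same_card[OF edges_bij])
  also have "\<dots> \<le> card {\<sigma>. \<sigma> \<subseteq> vertices \<and> card \<sigma> = 2}"
    using finite_vertices singleton_face by (intro card_mono) (auto simp: vertices_def)
  also have "\<dots> = card vertices choose 2" by (rule n_subsets[OF finite_vertices])
  finally show ?thesis .
qed

text \<open>With n vertices, the bound on the edges gives exactly the right-hand side, by the
  identity (n choose 2) - d n + (d + 1 choose 2) = (n - d choose 2) and h_1 = n - d.\<close>

lemma g_2_upper: "h_vector d \<Delta> 2 - h_vector d \<Delta> 1 \<le> h_vector d \<Delta> 1 gchoose 2"
proof -
  have "2 * (h_vector d \<Delta> 2 - h_vector d \<Delta> 1)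
      = 2 * int (card edges) - 2 * (int d * int (card vertices)) + 2 * int ((d + 1) choose 2)"
    unfolding g_2 by simp
  also have "\<dots> \<le> 2 * int (card vertices choose 2) - 2 * (int d * int (card vertices)) + 2 * int ((d + 1) choose 2)"
    using card_edges_le by simp
  also have "\<dots> = h_vector d \<Delta> 1 * (h_vector d \<Delta> 1 - 1)"
    unfolding two_choose_two h_vector_1 by (simp add: algebra_simps)
  finally have "2 * (h_vector d \<Delta> 2 - h_vector d \<Delta> 1) \<le> h_vector d \<Delta> 1 * (h_vector d \<Delta> 1 - 1)" .
  then have "real_of_int (2 * (h_vector d \<Delta> 2 - h_vector d \<Delta> 1))
      \<le> real_of_int (h_vector d \<Delta> 1 * (h_vector d \<Delta> 1 - 1))"
    by (simp only: of_int_le_iff)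
  moreover have "y gchoose 2 = y * (y - 1) / 2" for y :: real
    by (simp add: gbinomial_prod_rev numeral_2_eq_2)
  note this[of "real_of_int (h_vector d \<Delta> 1)"]
  ultimately show ?thesis by (simp del: One_nat_def)
qed

end

theorem theorem4p3:
  fixes \<Delta> :: "'a::linorder set set" and d :: nat and x :: "'a \<Rightarrow> real"
  assumes "closed_homology_manifold TYPE('k::field) d \<Delta>"
    and "connected (realization \<Delta>)"
    and "pure_of_dim (int d - 1) \<Delta>"
    and "d \<ge> 4"
    and "x \<in> realization \<Delta>"
  shows "(\<forall>t. has_subgroup_of_index (fundamental_group (realization \<Delta>) x) t \<longrightarrow>
            (real t - 1) / real t * real ((d + 1) choose 2)
              \<le> real_of_int (h_vector d \<Delta> 2 - h_vector d \<Delta> 1) \<and>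
            h_vector d \<Delta> 2 - h_vector d \<Delta> 1 \<le> h_vector d \<Delta> 1 gchoose 2) \<and>
         (finite (carrier (fundamental_group (realization \<Delta>) x)) \<and>
            order (fundamental_group (realization \<Delta>) x) > (d + 1) choose 2 \<or>
          betti TYPE('k) \<Delta> 1 > 0 \<longrightarrow>
            int ((d + 1) choose 2) \<le> h_vector d \<Delta> 2 - h_vector d \<Delta> 1 \<and>
            h_vector d \<Delta> 2 - h_vector d \<Delta> 1 \<le> h_vector d \<Delta> 1 gchoose 2)"
proof -
  let ?G = "fundamental_group (realization \<Delta>) x"
  interpret normal_pseudomanifold \<Delta> d
    by (rule closed_homology_manifold_normal[OF assms(1-4)])
  have strong: "int ((d + 1) choose 2) \<le> h_vector d \<Delta> 2 - h_vector d \<Delta> 1"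
    if "d * card vertices \<le> card edges"
  proof -
    have "int d * int (card vertices) \<le> int (card edges)" using that by (metis of_nat_le_iff of_nat_mult)
    then show ?thesis unfolding g_2 by linarith
  qed
  have index: "(real t - 1) / real t * real ((d + 1) choose 2) \<le> real_of_int (h_vector d \<Delta> 2 - h_vector d \<Delta> 1)"
    if t: "has_subgroup_of_index ?G t" for t
  proof -
    obtain H where H: "0 < t" "subgroup H ?G" "card (rcosets\<^bsub>?G\<^esub> H) = t"
      using t by (auto simp: has_subgroup_of_index_def)
    show ?thesis
    \<comment> \<open>For t = 1 the left-hand side is 0 and the bound without a cover suffices; for
      t >= 2 the cover gives the full binomial, of which only a fraction is claimed.\<close>
    proof (cases "t = 1")
      case True
      have "int (d * card vertices) \<le> int (card edges + ((d + 1) choose 2))" using edges_ge by (simp only: of_nat_le_iff)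
      then have "0 \<le> h_vector d \<Delta> 2 - h_vector d \<Delta> 1" unfolding g_2 by simp
      then show ?thesis using True by simp
    next
      case False
      have "int ((d + 1) choose 2) \<le> h_vector d \<Delta> 2 - h_vector d \<Delta> 1"
        using H False by (intro strong edges_ge_of_subgroup[OF assms(5) H(2)]) simp
      then have "real ((d + 1) choose 2) \<le> real_of_int (h_vector d \<Delta> 2 - h_vector d \<Delta> 1)" by linarith
      moreover have "(real t - 1) / real t * real ((d + 1) choose 2) \<le> 1 * real ((d + 1) choose 2)"
        using H(1) by (intro mult_right_mono) (simp_all add: field_simps)
      ultimately show ?thesis by linarith
    qed
  qed
  have large: "int ((d + 1) choose 2) \<le> h_vector d \<Delta> 2 - h_vector d \<Delta> 1"
    if "order ?G > (d + 1) choose 2"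
  proof -
    interpret G: group ?G by (rule group_fundamental_group[OF assms(5)])
    \<comment> \<open>The index of the trivial subgroup is the order of the group. As
      \<open>order\<close> is 0 for an infinite group, the bound makes this index finite as well as
      at least 2.\<close>
    have "0 < (d + 1) choose 2" using assms(4) by simp
    moreover have "card (rcosets\<^bsub>?G\<^esub> {\<one>\<^bsub>?G\<^esub>}) = order ?G"
      using G.lagrange[OF G.triv_subgroup] by simp
    ultimately have "2 \<le> card (rcosets\<^bsub>?G\<^esub> {\<one>\<^bsub>?G\<^esub>})" using that by linarith
    then show ?thesis by (intro strong edges_ge_of_subgroup[OF assms(5) G.triv_subgroup])
  qed
  have loops: "int ((d + 1) choose 2) \<le> h_vector d \<Delta> 2 - h_vector d \<Delta> 1"
    if "betti TYPE('k) \<Delta> 1 > 0"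
  proof -
    obtain v where "x v \<noteq> 0" by (rule realization_support[OF assms(5)])
    then have "{v} \<in> \<Delta>" using open_star_edge[OF assms(5), of v v] by simp
    then show ?thesis by (intro strong edges_ge_of_betti[OF that])
  qed
  show ?thesis using index large loops g_2_upper by blast
qed

end
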